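(* Let $G_0$ be a group acting decently on a set $X_0$ and let $x_0\in X_0$. Let $P$ be the set of points of the projective line $\mathbb{P}^1(k)$ over an algebraically closed field $k$, and let $H=\mathrm{Aut}(\mathbb{P}^1)$. For $p\in P$ let $(X_p,x_p)=(X_0,x_0)$. Then $G^\oplus$ acts decently on $\bigoplus_{p\in P}(X_p,x_p)$.
   Context: Decent actions. A group $\Gamma$ acts on a set $X$ purely elliptically if each element of $\Gamma$ fixes a point of $X$. A group $\Gamma$ acts on $X$ decently if (i) each subgroup of $\Gamma$ with a finite orbit in $X$ fixes a point of $X$, and (ii) each finitely generated subgroup of $\Gamma$ acting purely elliptically on $X$ fixes a point of $X$. Restricted product. For a family $\{(X_p,x_p)\}_{p\in P}$ of pointed sets, $\bigoplus_{p\in P}(X_p,x_p)$ is the set of sections $\{y_p\}_{p\in P}$ with $y_p\in X_p$ such that $y_p=x_p$ for all but finitely many $p$. Wreath product. Let $G_0$ act on $X_0$ and let $H$ act on $P$. The (unrestricted) wreath product $G_0\wr_P H$ is the semidirect product of $\prod_{p\in P}G_p$, where $G_p=G_0$, with $H$ acting by $h\cdot\{g_p\}_{p\in P}=\{g_{h^{-1}(p)}\}_{p\in P}$. It acts on $\prod_{p\in P}X_p$ (with $X_p=X_0$) as follows: $g=\{g_p\}_{p\in P}\in\prod_{p\in P} G_p$ acts by $g\cdot\{y_p\}_{p\in P}=\{g_p(y_p)\}_{p\in P}$, and $h\in H$ acts by $h\cdot\{y_p\}_{p\in P}=\{y_{h^{-1}(p)}\}_{p\in P}$. $G^\oplus$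 denotes the subgroup of $G_0\wr_P H$ consisting of the elements preserving the subset $\bigoplus_{p\in P}(X_p,x_p)$, where $x_p=x_0$ for all $p$. Here $H=\mathrm{Aut}(\mathbb{P}^1)=\mathrm{PGL}_2(k)$ acts on $P=\mathbb{P}^1(k)$ in the usual way. *)

theory Defs
  imports
    "HOL-Computational_Algebra.Polynomial"
    "HOL-Analysis.Determinants"
    "HOL-Algebra.Group_Action"
    "HOL-Algebra.Generated_Groups"
    "HOL-Algebra.Product_Groups"
begin

section \<open>Decent actions\<close>

definition fixes_point :: "('g \<Rightarrow> 'x \<Rightarrow> 'x) \<Rightarrow> 'x set \<Rightarrow> 'g set \<Rightarrow> bool" where
  "fixes_point \<phi> X K \<longleftrightarrow> (\<exists>x\<in>X. \<forall>g\<in>K. \<phi> g x = x)"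

definition purely_elliptic :: "('g \<Rightarrow> 'x \<Rightarrow> 'x) \<Rightarrow> 'x set \<Rightarrow> 'g set \<Rightarrow> bool" where
  "purely_elliptic \<phi> X K \<longleftrightarrow> (\<forall>g\<in>K. \<exists>x\<in>X. \<phi> g x = x)"

definition decent_action :: "('g, 'r) monoid_scheme \<Rightarrow> 'x set \<Rightarrow> ('g \<Rightarrow> 'x \<Rightarrow> 'x) \<Rightarrow> bool" where
  "decent_action G X \<phi> \<longleftrightarrow>
     group_action G X \<phi> \<and>
     (\<forall>K. subgroup K G \<longrightarrow> (\<exists>x\<in>X. finite (orbit (G\<lparr>carrier := K\<rparr>) \<phi> x)) \<longrightarrow> fixes_point \<phi> X K) \<and>
     (\<forall>S. finite S \<longrightarrow> S \<subseteq> carrier G \<longrightarrow> purely_elliptic \<phi> X (generate G S) \<longrightarrow>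
        fixes_point \<phi> X (generate G S))"

section \<open>Restricted products and wreath products\<close>

definition restricted_product :: "'p set \<Rightarrow> ('p \<Rightarrow> 'x set) \<Rightarrow> ('p \<Rightarrow> 'x) \<Rightarrow> ('p \<Rightarrow> 'x) set" where
  "restricted_product P X x = {y \<in> (\<Pi>\<^sub>E p\<in>P. X p). finite {p \<in> P. y p \<noteq> x p}}"

definition semidirect_product ::
    "('n, 'r) monoid_scheme \<Rightarrow> ('h, 's) monoid_scheme \<Rightarrow> ('h \<Rightarrow> 'n \<Rightarrow> 'n) \<Rightarrow> ('n \<times> 'h) monoid" where
  "semidirect_product N H \<theta> =
     \<lparr>carrier = carrier N \<times> carrier H,
      monoid.mult = (\<lambda>(m, h) (n, k). (m \<otimes>\<^bsub>N\<^esub> \<theta> h n, h \<otimes>\<^bsub>H\<^esub> k)),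
      one = (\<one>\<^bsub>N\<^esub>, \<one>\<^bsub>H\<^esub>)\<rparr>"

text \<open>In the following, \<open>\<phi>\<close> is the action of \<open>G\<close> on \<open>X\<close> and \<open>\<psi>\<close> the action of \<open>H\<close> on \<open>P\<close>.\<close>

definition wreath_product ::
    "('g, 'r) monoid_scheme \<Rightarrow> ('h, 's) monoid_scheme \<Rightarrow> 'p set \<Rightarrow> ('h \<Rightarrow> 'p \<Rightarrow> 'p) \<Rightarrow>
     (('p \<Rightarrow> 'g) \<times> 'h) monoid" where
  "wreath_product G H P \<psi> =
     semidirect_product (product_group P (\<lambda>_. G)) H (\<lambda>h g. \<lambda>p\<in>P. g (\<psi> (inv\<^bsub>H\<^esub> h) p))"

text \<open>The pair \<open>(g, h)\<close> is the product \<open>g h\<close> in the semidirect product, so \<open>h\<close> acts first.\<close>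

definition wreath_action ::
    "('h, 's) monoid_scheme \<Rightarrow> 'p set \<Rightarrow> ('h \<Rightarrow> 'p \<Rightarrow> 'p) \<Rightarrow> 'x set \<Rightarrow> ('g \<Rightarrow> 'x \<Rightarrow> 'x) \<Rightarrow>
     ('p \<Rightarrow> 'g) \<times> 'h \<Rightarrow> ('p \<Rightarrow> 'x) \<Rightarrow> ('p \<Rightarrow> 'x)" where
  "wreath_action H P \<psi> X \<phi> =
     (\<lambda>(g, h). \<lambda>y \<in> (\<Pi>\<^sub>E p\<in>P. X). \<lambda>p\<in>P. \<phi> (g p) (y (\<psi> (inv\<^bsub>H\<^esub> h) p)))"

definition wreath_oplus ::
    "('g, 'r) monoid_scheme \<Rightarrow> ('h, 's) monoid_scheme \<Rightarrow> 'p set \<Rightarrow> ('h \<Rightarrow> 'p \<Rightarrow> 'p) \<Rightarrow>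
     'x set \<Rightarrow> ('g \<Rightarrow> 'x \<Rightarrow> 'x) \<Rightarrow> 'x \<Rightarrow> (('p \<Rightarrow> 'g) \<times> 'h) monoid" where
  "wreath_oplus G H P \<psi> X \<phi> x =
     (wreath_product G H P \<psi>)
       \<lparr>carrier := {w \<in> carrier (wreath_product G H P \<psi>).
          wreath_action H P \<psi> X \<phi> w ` restricted_product P (\<lambda>_. X) (\<lambda>_. x)
            = restricted_product P (\<lambda>_. X) (\<lambda>_. x)}\<rparr>"

text \<open>\<^const>\<open>group_action\<close> requires the acting maps to be extensional, hence the restriction.\<close>

definition oplus_action ::
    "('h, 's) monoid_scheme \<Rightarrow> 'p set \<Rightarrow> ('h \<Rightarrow> 'p \<Rightarrow> 'p) \<Rightarrow> 'x set \<Rightarrow> ('g \<Rightarrow> 'x \<Rightarrow> 'x) \<Rightarrow> 'x \<Rightarrow>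
     ('p \<Rightarrow> 'g) \<times> 'h \<Rightarrow> ('p \<Rightarrow> 'x) \<Rightarrow> ('p \<Rightarrow> 'x)" where
  "oplus_action H P \<psi> X \<phi> x w =
     restrict (wreath_action H P \<psi> X \<phi> w) (restricted_product P (\<lambda>_. X) (\<lambda>_. x))"

section \<open>The projective line and its automorphism group\<close>

definition projective_line :: "('k::field ^ 2) set set" where
  "projective_line = {L. vec.subspace L \<and> vec.dim L = 1}"

definition GL2 :: "('k::field ^ 2 ^ 2) monoid" where
  "GL2 = \<lparr>carrier = {A. invertible A}, monoid.mult = (**), one = mat 1\<rparr>"

definition PGL2 :: "('k::field ^ 2 ^ 2) set monoid" where
  "PGL2 = GL2 Mod {mat c | c. c \<noteq> 0}"

text \<open>
  An element of \<^const>\<open>PGL2\<close> is a coset \<open>C\<close> of matrices differing by nonzero scalars. They all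
  map a line \<open>L\<close> onto the same line, so the union below is the image of \<open>L\<close> under any one of them.
\<close>

definition PGL2_action :: "('k::field ^ 2 ^ 2) set \<Rightarrow> ('k ^ 2) set \<Rightarrow> ('k ^ 2) set" where
  "PGL2_action C = (\<lambda>L\<in>projective_line. \<Union>A\<in>C. (\<lambda>v. A *v v) ` L)"

end

theory Submission
  imports Defs
begin

text \<open>
  The elements of \<open>G\<^sup>\<oplus>\<close> act on the trivial bundle over \<open>P\<^sup>1\<close> with fibre \<open>X\<^sub>0\<close>, and a fixed point is an
  invariant section. For a subgroup \<open>K\<close> with a finite orbit, such a section is built orbit by orbit on
  \<open>P\<^sup>1\<close>. Hence, for the second condition, \<open>K\<close> may be replaced by a subgroup of finite index.

  If the image in \<open>PGL\<^sub>2\<close> of a finitely generated elliptic group \<open>K\<close> is torsion, it is finite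
  (Burnside--Schur), and the kernel, again finitely generated, fixes a point in each fibre. Otherwise
  let \<open>a, b \<in> K\<close> be of infinite order in \<open>PGL\<^sub>2\<close>, with fixed sections \<open>y, y'\<close>. These are determined off
  the fixed points of \<open>a\<close> and \<open>b\<close>, and the claim is that they agree there, so that the fixed sections of
  all conjugates of \<open>a\<close> glue to one invariant under \<open>K\<close> off a finite set. Suppose \<open>y p \<noteq> y' p\<close>. One finds
  a word \<open>v = b\<^sup>-\<^sup>m a\<^sup>-\<^sup>n b\<^sup>m a\<^sup>k\<close> such that the walk \<open>\<dots>, p, a\<^sup>k p, b\<^sup>m a\<^sup>k p, \<dots>\<close> along \<open>v\<close> is infinite and
  meets the finite set \<open>{y \<noteq> y'}\<close> only once, in \<open>p\<close>. Then \<open>v\<close> has no fixed section, a contradiction.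

  The word comes from a valuation ring with maximal ideal \<open>M\<close> and finite residues, at which the
  coordinates of all the data are units. Some powers \<open>a\<^sup>n\<close> and \<open>b\<^sup>m\<close> are scalar modulo \<open>\<delta>\<close> and
  \<open>\<epsilon>\<close>, but move \<open>p\<close> modulo every smaller ideal, where \<open>\<delta> \<in> \<epsilon>M\<close> up to exchanging \<open>a\<close> and \<open>b\<close>. For suitable \<open>k\<close>
  the word \<open>v\<close> is then scalar modulo \<open>\<delta>M\<close>, whereas its proper initial subwords move \<open>p\<close> modulo this ideal.
  That \<open>v\<close> itself has infinite order follows by using two residue characteristics.
\<close>

section \<open>Valuation rings\<close>

text \<open>The field is arbitrary, so finiteness has to be produced: finitely many coordinates
  generate a ring with maps to finite fields, and Chevalley's extension theorem turns such a map
  into a valuation ring. Unit coordinates then become roots of unity modulo M, which is why suitable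
  powers of \<open>a\<close> and \<open>b\<close> become scalar there. The valuation need not be
  discrete; "the next smaller ideal" after the one generated by \<open>d\<close> is \<open>d\<close>
  times M, and \<open>\<delta>\<close>, \<open>\<epsilon>\<close> are compared by the totality of
  divisibility.

  One number, \<open>homog_sum x y n\<close>, measures both how far the n-th power is from a scalar
  and how far it moves \<open>p\<close>. The commutator of two powers is trivial modulo the product
  of their two numbers, hence closer to a scalar than either power; this makes the return along
  \<open>v\<close> so precise.

  The plain commutator could still fix \<open>p\<close> or have finite order. Therefore
  \<open>k\<close> is not \<open>n\<close> but \<open>n\<close> plus a multiple with a free
  parameter, of which finitely many values are bad. In positive characteristic both places have the
  same residue characteristic, so scalar multiples of unipotents survive the torsion argument; the
  parameter also avoids double eigenvalues.\<close>

definition subring_of_field :: "'k::field set \<Rightarrow> bool" where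
  "subring_of_field R \<longleftrightarrow> 1 \<in> R \<and> (\<forall>x\<in>R. \<forall>y\<in>R. x - y \<in> R \<and> x * y \<in> R)"

lemma subring_of_fieldI:
  assumes "1 \<in> R" "\<And>x y. x \<in> R \<Longrightarrow> y \<in> R \<Longrightarrow> x - y \<in> R" "\<And>x y. x \<in> R \<Longrightarrow> y \<in> R \<Longrightarrow> x * y \<in> R"
  shows "subring_of_field R"
  using assms by (auto simp: subring_of_field_def)

context
  fixes R :: "'k::field set"
  assumes R: "subring_of_field R"
begin

lemma sr_one: "1 \<in> R" and sr_diff: "x \<in> R \<Longrightarrow> y \<in> R \<Longrightarrow> x - y \<in> R"
  and sr_mult: "x \<in> R \<Longrightarrow> y \<in> R \<Longrightarrow> x * y \<in> R"
  using R by (auto simp: subring_of_field_def)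

lemma sr_zero: "0 \<in> R" using sr_diff[OF sr_one sr_one] by simp
lemma sr_minus: "x \<in> R \<Longrightarrow> - x \<in> R" using sr_diff[OF sr_zero] by fastforce
lemma sr_add: "x \<in> R \<Longrightarrow> y \<in> R \<Longrightarrow> x + y \<in> R" using sr_diff[OF _ sr_minus] by fastforce
lemma sr_power: "x \<in> R \<Longrightarrow> x ^ n \<in> R" by (induction n) (auto intro: sr_one sr_mult)
lemma sr_of_nat: "of_nat n \<in> R" by (induction n) (auto intro: sr_one sr_add sr_zero)
lemma sr_of_int: "of_int n \<in> R"
  by (cases n) (auto intro: sr_of_nat sr_minus sr_one sr_diff simp del: of_nat_Suc)
lemma sr_sum: "(\<And>i. i \<in> I \<Longrightarrow> f i \<in> R) \<Longrightarrow> sum f I \<in> R"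
  by (induction I rule: infinite_finite_induct) (auto intro: sr_add sr_zero)
lemma sr_prod: "(\<And>i. i \<in> I \<Longrightarrow> f i \<in> R) \<Longrightarrow> prod f I \<in> R"
  by (induction I rule: infinite_finite_induct) (auto intro: sr_mult sr_one)
lemma sr_poly: "(\<And>i. coeff p i \<in> R) \<Longrightarrow> x \<in> R \<Longrightarrow> poly p x \<in> R"
  by (simp add: poly_altdef) (intro sr_sum sr_mult sr_power, auto)

lemmas sr_closed = sr_one sr_zero sr_diff sr_mult sr_minus sr_add sr_power

end

definition adjoin :: "'k::field set \<Rightarrow> 'k \<Rightarrow> 'k set" where
  "adjoin R x = {poly p x |p. \<forall>i. coeff p i \<in> R}"

lemma coeff_mult_closed:
  assumes "subring_of_field R" "\<forall>i. coeff p i \<in> R" "\<forall>i. coeff q i \<in> R"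
  shows "coeff (p * q) i \<in> R"
  unfolding coeff_mult using assms by (auto intro!: sr_sum sr_mult)

lemma adjoin_subring:
  assumes R: "subring_of_field R" shows "subring_of_field (adjoin R x)"
proof (rule subring_of_fieldI)
  show "1 \<in> adjoin R x" unfolding adjoin_def
    using sr_one[OF R] sr_zero[OF R]
    by (intro CollectI exI[of _ "[:1:]"]) (auto simp: coeff_pCons split: nat.splits)
next
  fix a b assume "a \<in> adjoin R x" "b \<in> adjoin R x"
  then obtain p q where p: "a = poly p x" "\<forall>i. coeff p i \<in> R" and q: "b = poly q x" "\<forall>i. coeff q i \<in> R"
    unfolding adjoin_def by blast
  show "a - b \<in> adjoin R x" unfolding adjoin_def
    using p q by (intro CollectI exI[of _ "p - q"]) (auto intro: sr_diff[OF R])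
  show "a * b \<in> adjoin R x" unfolding adjoin_def
    using p q by (intro CollectI exI[of _ "p * q"]) (auto intro: coeff_mult_closed[OF R])
qed

lemma adjoin_base: "subring_of_field R \<Longrightarrow> R \<subseteq> adjoin R x"
  unfolding adjoin_def using sr_zero
  by (auto simp: coeff_pCons split: nat.splits intro!: exI[of _ "[:_:]"])

lemma adjoin_gen: "subring_of_field R \<Longrightarrow> x \<in> adjoin R x"
  unfolding adjoin_def using sr_zero sr_one
  by (auto simp: coeff_pCons split: nat.splits intro!: exI[of _ "[:0,1:]"])

lemma adjoin_least: "subring_of_field V \<Longrightarrow> R \<subseteq> V \<Longrightarrow> x \<in> V \<Longrightarrow> adjoin R x \<subseteq> V"
  unfolding adjoin_def by (auto intro: sr_poly)

section \<open>Ideals over subrings and the existence of valuation rings\<close>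

inductive_set ideal_span :: "'k::field set \<Rightarrow> 'k set \<Rightarrow> 'k set" for J R where
  span_zero: "0 \<in> ideal_span J R"
| span_add: "x \<in> ideal_span J R \<Longrightarrow> j \<in> J \<Longrightarrow> r \<in> R \<Longrightarrow> x + j * r \<in> ideal_span J R"

lemma ideal_span_add: "x \<in> ideal_span J R \<Longrightarrow> y \<in> ideal_span J R \<Longrightarrow> x + y \<in> ideal_span J R"
  by (rotate_tac, induction rule: ideal_span.induct) (auto intro: span_add simp: add.assoc[symmetric])

lemma ideal_span_mult:
  assumes "subring_of_field R" "x \<in> ideal_span J R" "r \<in> R" shows "x * r \<in> ideal_span J R"
  using assms(2)
proof induction
  case (span_add x j s)
  then show ?case using ideal_span.span_add[of "x * r" J R j "s * r"] sr_mult[OF assms(1)] assms(3)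
    by (auto simp: algebra_simps)
qed (auto intro: span_zero)

lemma ideal_span_gen: "subring_of_field R \<Longrightarrow> j \<in> J \<Longrightarrow> j \<in> ideal_span J R"
  using span_add[OF span_zero, of j J 1 R] sr_one by auto

lemma ideal_span_mono:
  assumes "x \<in> ideal_span J R" "R \<subseteq> S" shows "x \<in> ideal_span J S"
  using assms by induction (auto intro: ideal_span.intros)

lemma ideal_span_subset: "subring_of_field R \<Longrightarrow> J \<subseteq> R \<Longrightarrow> x \<in> ideal_span J R \<Longrightarrow> x \<in> R"
  by (rotate_tac 2, induction rule: ideal_span.induct) (auto intro: sr_closed)

lemma ideal_span_sum: "(\<And>i. i \<in> I \<Longrightarrow> f i \<in> ideal_span J R) \<Longrightarrow> sum f I \<in> ideal_span J R"
  by (induction I rule: infinite_finite_induct) (auto intro: ideal_span_add span_zero)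

text \<open>Turns "adjoining \<open>x\<close> makes the ideal improper" into a polynomial relation
  for 1 with coefficients in the old ideal, so that degrees of relations can be compared.\<close>

lemma ideal_span_adjoin:
  assumes R: "subring_of_field R" and "y \<in> ideal_span J (adjoin R x)"
  obtains p where "y = poly p x" "\<forall>i. coeff p i \<in> ideal_span J R"
  using assms(2)
proof (induction arbitrary: thesis)
  case span_zero
  show ?case by (rule span_zero[of 0]) (auto intro: ideal_span.span_zero)
next
  case (span_add y j r)
  obtain p where p: "y = poly p x" "\<forall>i. coeff p i \<in> ideal_span J R" using span_add.IH by blast
  obtain q where q: "r = poly q x" "\<forall>i. coeff q i \<in> R" using span_add(3) unfolding adjoin_def by blast
  show ?case
    by (rule span_add.prems[of "p + smult j q"]) (use p q span_add(2) in \<open>auto intro: ideal_span.span_add\<close>)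
qed

text \<open>The whole field is allowed; its maximal ideal is \<open>{0}\<close>. This trivial case
  is the place used for the prime field in positive characteristic.\<close>

definition valuation_ring :: "'k::field set \<Rightarrow> bool" where
  "valuation_ring V \<longleftrightarrow> subring_of_field V \<and> (\<forall>x. x \<noteq> 0 \<longrightarrow> x \<in> V \<or> inverse x \<in> V)"

definition max_ideal :: "'k::field set \<Rightarrow> 'k set" where
  "max_ideal V = {x \<in> V. x = 0 \<or> inverse x \<notin> V}"

text \<open>If both \<open>x\<close> and \<open>1/x\<close> destroy the properness of the ideal, the relation of higher
  degree can be shortened by the other one.\<close>

lemma shorten_relation:
  fixes x :: "'k::field"
  assumes V: "subring_of_field V" and JV: "J \<subseteq> V"
    and unit: "\<And>u. u \<in> ideal_span J V \<Longrightarrow> 1 - u \<noteq> 0 \<and> inverse (1 - u) \<in> V"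
    and p: "poly p x = 1" "\<forall>i. coeff p i \<in> ideal_span J V"
    and q: "poly q (inverse x) = 1" "\<forall>i. coeff q i \<in> ideal_span J V"
    and x: "x \<noteq> 0" and deg: "degree q \<le> degree p"
  shows "\<exists>p'. poly p' x = 1 \<and> (\<forall>i. coeff p' i \<in> ideal_span J V) \<and> degree p' < degree p"
proof -
  let ?I = "ideal_span J V"
  define n m where "n = degree p" and "m = degree q"
  have n0: "n \<noteq> 0"
  proof
    assume "n = 0"
    then obtain c where "p = [:c:]" unfolding n_def using degree_0_id by metis
    then have "1 \<in> ?I" using p(1) p(2)[rule_format, of 0] by simp
    from unit[OF this] show False by simp
  qed
  \<comment> \<open>The constant term of the relation for \<open>inverse x\<close> can be moved to
    the left, since 1 minus it is a unit. Hence 1 is a combination of strictly positive powers of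
    \<open>inverse x\<close>.\<close>
  define u where "u = inverse (1 - coeff q 0)"
  have u: "u \<in> V" "u * (1 - coeff q 0) = 1" using unit[of "coeff q 0"] q(2) unfolding u_def by auto
  have "1 = (\<Sum>i\<le>m. coeff q i * inverse x ^ i)" using q(1) unfolding m_def by (simp add: poly_altdef)
  also have "\<dots> = coeff q 0 + (\<Sum>i=1..m. coeff q i * inverse x ^ i)"
    by (simp add: atMost_atLeast0 sum.atLeast_Suc_atMost)
  finally have "1 - coeff q 0 = (\<Sum>i=1..m. coeff q i * inverse x ^ i)" by (simp add: algebra_simps)
  then have one: "1 = u * (\<Sum>i=1..m. coeff q i * inverse x ^ i)" using u by metis
  define c where "c = coeff p n"
  have cI: "c \<in> ?I" using p c_def by auto
  \<comment> \<open>The leading term \<open>c * x ^ n\<close> multiplied by this expression for 1: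
    its degree drops below \<open>n\<close>, and \<open>m \<le> n\<close> keeps the exponents
    nonnegative.\<close>
  define r where "r = (\<Sum>i=1..m. monom (c * (u * coeff q i)) (n - i))"
  have "poly r x = (\<Sum>i=1..m. c * (u * coeff q i) * x ^ (n - i))"
    unfolding r_def by (simp add: poly_sum poly_monom)
  also have "\<dots> = (\<Sum>i=1..m. c * x ^ n * (u * (coeff q i * inverse x ^ i)))"
    by (rule sum.cong) (use x deg in \<open>auto simp: n_def m_def power_diff field_simps\<close>)
  also have "\<dots> = c * x ^ n" using one by (simp add: sum_distrib_left[symmetric])
  finally have r: "poly r x = c * x ^ n" .
  define p' where "p' = p - monom c n + r"
  have "poly p' x = 1" using p(1) r by (simp add: p'_def poly_monom)
  moreover have "coeff p' i \<in> ?I" for i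
  proof -
    have "coeff r i \<in> ?I" unfolding r_def
      using ideal_span_mult[OF V cI] sr_mult[OF V] u(1) q(2) ideal_span_subset[OF V JV]
      by (auto simp: coeff_sum intro!: ideal_span_sum span_zero)
    moreover have "coeff p i - coeff (monom c n) i \<in> ?I"
      using p(2) cI by (auto simp: c_def intro: span_zero)
    ultimately show ?thesis unfolding p'_def by (auto intro: ideal_span_add)
  qed
  moreover have "degree p' < n"
  proof -
    have "degree p' \<le> n - 1"
    proof (rule degree_le, intro allI impI)
      fix i assume i: "n - 1 < i"
      have "coeff r i = 0" unfolding r_def using i n0 by (auto simp: coeff_sum intro!: sum.neutral)
      moreover have "coeff p i = coeff (monom c n) i"
        using i n0 unfolding c_def n_def by (cases "i = n") (auto simp: n_def coeff_eq_0)
      ultimately show "coeff p' i = 0" unfolding p'_def by simp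
    qed
    with n0 show ?thesis by linarith
  qed
  ultimately show ?thesis unfolding n_def by blast
qed

text \<open>Chevalley's theorem. Zorn's lemma gives a subring \<open>V\<close> above
  \<open>B\<close> that is maximal among those where \<open>J\<close> spans a proper ideal. If
  neither \<open>x\<close> nor \<open>inverse x\<close> were in \<open>V\<close>, both would satisfy
  relations for 1, and the longer of the two could be shortened forever.\<close>

theorem valuation_ring_extension:
  fixes B J :: "'k::field set"
  assumes B: "subring_of_field B" and JB: "J \<subseteq> B" and J: "1 \<notin> ideal_span J B"
  shows "\<exists>V. valuation_ring V \<and> B \<subseteq> V \<and> J \<subseteq> max_ideal V"
proof -
  define \<A> where "\<A> = {R. subring_of_field R \<and> B \<subseteq> R \<and> 1 \<notin> ideal_span J R}"
  have "\<exists>V\<in>\<A>. \<forall>X\<in>\<A>. V \<subseteq> X \<longrightarrow> X = V"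
  proof (rule subset_Zorn_nonempty)
    show "\<A> \<noteq> {}" using B J unfolding \<A>_def by blast
  next
    fix \<C> assume \<C>: "\<C> \<noteq> {}" "subset.chain \<A> \<C>"
    have ch: "R \<in> \<A>" "R \<subseteq> S \<or> S \<subseteq> R" if "R \<in> \<C>" "S \<in> \<C>" for R S
      using \<C>(2) that unfolding subset.chain_def by auto
    have two: "\<exists>R\<in>\<C>. x \<in> R \<and> y \<in> R" if "x \<in> \<Union>\<C>" "y \<in> \<Union>\<C>" for x y
      using that ch(2) by blast
    have sr: "subring_of_field (\<Union>\<C>)"
    proof (rule subring_of_fieldI)
      show "1 \<in> \<Union>\<C>" using \<C>(1) ch(1) sr_one unfolding \<A>_def by blast
      fix x y assume "x \<in> \<Union>\<C>" "y \<in> \<Union>\<C>"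
      then obtain R where R: "R \<in> \<C>" "x \<in> R" "y \<in> R" using two by blast
      then have "subring_of_field R" using ch(1) unfolding \<A>_def by blast
      with R show "x - y \<in> \<Union>\<C>" "x * y \<in> \<Union>\<C>" using sr_diff sr_mult by blast+
    qed
    have "\<exists>R\<in>\<C>. x \<in> ideal_span J R" if "x \<in> ideal_span J (\<Union>\<C>)" for x
      using that
    proof induction
      case span_zero then show ?case using \<C>(1) by (auto intro: ideal_span.span_zero)
    next
      case (span_add x j r)
      then obtain R S where R: "R \<in> \<C>" "x \<in> ideal_span J R" "S \<in> \<C>" "r \<in> S" by blast
      then show ?case using ch(2)[of R S] span_add(2)
        by (metis ideal_span.span_add ideal_span_mono subsetD)
    qed
    then show "\<Union>\<C> \<in> \<A>" using sr \<C>(1) ch(1) unfolding \<A>_def by blast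
  qed
  then obtain V where V: "V \<in> \<A>" and max: "\<And>X. X \<in> \<A> \<Longrightarrow> V \<subseteq> X \<Longrightarrow> X = V" by blast
  have sV: "subring_of_field V" and BV: "B \<subseteq> V" and nV: "1 \<notin> ideal_span J V"
    using V unfolding \<A>_def by auto
  have JV: "J \<subseteq> V" using JB BV by blast
  have adj: "x \<in> V" if "1 \<notin> ideal_span J (adjoin V x)" for x
    using max[of "adjoin V x"] adjoin_subring[OF sV] adjoin_base[OF sV] adjoin_gen[OF sV] BV that
    unfolding \<A>_def by blast
  have unit: "1 - u \<noteq> 0 \<and> inverse (1 - u) \<in> V" if u: "u \<in> ideal_span J V" for u
  proof
    show ne: "1 - u \<noteq> 0" using u nV by auto
    define w where "w = 1 - u"
    have w0: "w \<noteq> 0" using ne w_def by simp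
    have wV: "w \<in> V" unfolding w_def using sr_diff[OF sV sr_one[OF sV]] ideal_span_subset[OF sV JV u] .
    \<comment> \<open>If adjoining the inverse of \<open>w\<close> made the ideal improper, clearing
      denominators would put a power of \<open>w\<close> into the ideal, although \<open>w\<close>
      is 1 modulo the ideal.\<close>
    show "inverse (1 - u) \<in> V"
    proof (rule adj, rule notI)
      assume "1 \<in> ideal_span J (adjoin V (inverse (1 - u)))"
      then obtain p where p: "1 = poly p (inverse w)" "\<forall>i. coeff p i \<in> ideal_span J V"
        using ideal_span_adjoin[OF sV] unfolding w_def by blast
      have "w ^ degree p = (\<Sum>i\<le>degree p. coeff p i * w ^ (degree p - i))"
      proof -
        have "w ^ degree p = (\<Sum>i\<le>degree p. coeff p i * inverse w ^ i) * w ^ degree p"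
          using p(1) by (simp add: poly_altdef)
        also have "\<dots> = (\<Sum>i\<le>degree p. coeff p i * w ^ (degree p - i))"
          unfolding sum_distrib_right
          by (rule sum.cong) (auto simp: power_diff w0 field_simps)
        finally show ?thesis .
      qed
      then have I: "w ^ degree p \<in> ideal_span J V"
        using p(2) sr_power[OF sV wV] by (auto intro!: ideal_span_sum ideal_span_mult[OF sV])
      have "1 - w ^ n \<in> ideal_span J V" for n
      proof (induction n)
        case (Suc n)
        have "1 - w ^ Suc n = (1 - w ^ n) * w + u" by (simp add: w_def algebra_simps)
        then show ?case using ideal_span_add[OF ideal_span_mult[OF sV Suc wV] u] by simp
      qed (auto intro: span_zero)
      from ideal_span_add[OF this[of "degree p"] I] nV show False by simp
    qed
  qed
  have val: "x \<in> V \<or> inverse x \<in> V" if x: "x \<noteq> 0" for x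
  proof (rule ccontr)
    assume neg: "\<not> ?thesis"
    have F: False if "poly p x = 1" "\<forall>i. coeff p i \<in> ideal_span J V"
       "poly q (inverse x) = 1" "\<forall>i. coeff q i \<in> ideal_span J V" for p q
      using that
    proof (induction "degree p + degree q" arbitrary: p q rule: less_induct)
      case less
      show ?case
      proof (cases "degree q \<le> degree p")
        case True
        obtain p' where "poly p' x = 1" "\<forall>i. coeff p' i \<in> ideal_span J V" "degree p' < degree p"
          using shorten_relation[OF sV JV _ less.prems x True] unit by blast
        then show ?thesis using less.hyps[of p' q] less.prems(3,4) by auto
      next
        case False
        obtain q' where "poly q' (inverse x) = 1" "\<forall>i. coeff q' i \<in> ideal_span J V"
            "degree q' < degree q"
          using shorten_relation[OF sV JV _ less.prems(3,4), of p] less.prems(1,2) x False unit by auto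
        then show ?thesis using less.hyps[of p q'] less.prems(1,2) by auto
      qed
    qed
    from neg adj[of x] adj[of "inverse x"] have
      "1 \<in> ideal_span J (adjoin V x)" "1 \<in> ideal_span J (adjoin V (inverse x))" by blast+
    then show False using F by (metis ideal_span_adjoin[OF sV])
  qed
  have "J \<subseteq> max_ideal V"
  proof
    fix j assume j: "j \<in> J"
    have "inverse j \<notin> V" if "j \<noteq> 0"
      using ideal_span_mult[OF sV ideal_span_gen[OF sV j], of "inverse j"] that nV by auto
    then show "j \<in> max_ideal V" using j JV unfolding max_ideal_def by blast
  qed
  with val sV BV show ?thesis unfolding valuation_ring_def by blast
qed

section \<open>Arithmetic of the maximal ideal\<close>

context
  fixes V :: "'k::field set"
  assumes V: "valuation_ring V"
begin

lemma vr_subring: "subring_of_field V" using V by (simp add: valuation_ring_def)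

lemmas vr_closed = sr_closed[OF vr_subring]

lemma vr_total: "x \<noteq> 0 \<Longrightarrow> x \<in> V \<or> inverse x \<in> V" using V by (simp add: valuation_ring_def)

lemma max_ideal_subset: "x \<in> max_ideal V \<Longrightarrow> x \<in> V" by (simp add: max_ideal_def)
lemma max_ideal_zero: "0 \<in> max_ideal V" using vr_closed by (simp add: max_ideal_def)
lemma max_ideal_one: "1 \<notin> max_ideal V" using vr_closed by (simp add: max_ideal_def)
lemma vr_unit: "x \<in> V \<Longrightarrow> x \<notin> max_ideal V \<Longrightarrow> inverse x \<in> V" by (simp add: max_ideal_def)
lemma vr_unit_nonzero: "x \<notin> max_ideal V \<Longrightarrow> x \<noteq> 0" using max_ideal_zero by auto

lemma max_ideal_mult: assumes "x \<in> max_ideal V" "y \<in> V" shows "x * y \<in> max_ideal V" "y * x \<in> max_ideal V"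
proof -
  show "x * y \<in> max_ideal V"
  proof (cases "x * y = 0")
    case False
    have "inverse (x * y) \<notin> V"
    proof
      assume "inverse (x * y) \<in> V"
      then have "y * inverse (x * y) \<in> V" using vr_closed assms by blast
      then show False using False assms(1) by (simp add: max_ideal_def field_simps)
    qed
    then show ?thesis using assms vr_closed by (auto simp: max_ideal_def)
  qed (auto simp: max_ideal_zero)
  then show "y * x \<in> max_ideal V" by (simp add: mult.commute)
qed

lemma max_ideal_add: assumes "x \<in> max_ideal V" "y \<in> max_ideal V" shows "x + y \<in> max_ideal V"
proof -
  have *: "a + b \<in> max_ideal V" if "a \<in> max_ideal V" "b \<in> max_ideal V" "b \<noteq> 0" "a / b \<in> V" for a b
  proof -
    have "a + b = b * (1 + a / b)" using that by (simp add: field_simps)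
    then show ?thesis using that max_ideal_mult vr_closed by metis
  qed
  show ?thesis
  proof (cases "x = 0 \<or> y = 0")
    case False
    then show ?thesis
      using *[of x y] *[of y x] assms vr_total[of "x / y"] by (auto simp: add.commute)
  qed (use assms in auto)
qed

lemma max_ideal_minus: "x \<in> max_ideal V \<Longrightarrow> - x \<in> max_ideal V"
  using max_ideal_mult(1)[of x "- 1"] sr_minus[OF vr_subring sr_one[OF vr_subring]] by simp

lemma max_ideal_diff: "x \<in> max_ideal V \<Longrightarrow> y \<in> max_ideal V \<Longrightarrow> x - y \<in> max_ideal V"
  using max_ideal_add[OF _ max_ideal_minus] by fastforce

lemma max_ideal_sum: "(\<And>i. i \<in> I \<Longrightarrow> f i \<in> max_ideal V) \<Longrightarrow> sum f I \<in> max_ideal V"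
  by (induction I rule: infinite_finite_induct) (auto intro: max_ideal_add max_ideal_zero)

lemma max_ideal_prime:
  assumes "x \<in> V" "y \<in> V" "x * y \<in> max_ideal V" shows "x \<in> max_ideal V \<or> y \<in> max_ideal V"
proof (rule ccontr)
  assume "\<not> ?thesis"
  then have "inverse x \<in> V" "inverse y \<in> V" "x \<noteq> 0" "y \<noteq> 0"
    using assms vr_unit vr_unit_nonzero by auto
  then have "inverse x * inverse y * (x * y) \<in> max_ideal V"
    using max_ideal_mult(2)[OF assms(3) sr_mult[OF vr_subring]] by blast
  then show False using max_ideal_one \<open>x \<noteq> 0\<close> \<open>y \<noteq> 0\<close> by (simp add: field_simps)
qed

lemma max_ideal_power: "x \<in> V \<Longrightarrow> x ^ n \<in> max_ideal V \<Longrightarrow> x \<in> max_ideal V"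
proof (induction n)
  case 0 then show ?case using max_ideal_one by simp
next
  case (Suc n) then show ?case using max_ideal_prime[of x "x ^ n"] vr_closed by auto
qed

lemma max_ideal_cong_unit: "x - y \<in> max_ideal V \<Longrightarrow> y \<notin> max_ideal V \<Longrightarrow> x \<notin> max_ideal V"
  using max_ideal_diff[of x "x - y"] by auto

lemma max_ideal_inverse: "x \<in> max_ideal V \<Longrightarrow> x \<noteq> 0 \<Longrightarrow> inverse x \<notin> V"
  by (simp add: max_ideal_def)

lemma vr_unitI: "x \<in> V \<Longrightarrow> inverse x \<in> V \<Longrightarrow> x \<noteq> 0 \<Longrightarrow> x \<notin> max_ideal V"
  by (simp add: max_ideal_def)

text \<open>Integral closedness in degree two: for \<open>x\<close> outside \<open>V\<close>,
  dividing the equation by the square of \<open>x\<close> would express 1 by elements of the maximal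
  ideal. It places the eigenvalues of a matrix over \<open>V\<close> in \<open>V\<close>.\<close>

lemma vr_integral_quadratic:
  assumes "t \<in> V" "d \<in> V" "x\<^sup>2 = t * x - d" shows "x \<in> V"
proof (rule ccontr)
  assume x: "x \<notin> V"
  then have x0: "x \<noteq> 0" using vr_closed by auto
  then have i: "inverse x \<in> V" using x vr_total by auto
  then have m: "inverse x \<in> max_ideal V" using x x0 by (simp add: max_ideal_def)
  have "x * x = t * x - d" using assms(3) by (simp add: power2_eq_square)
  then have "1 = (t - d * inverse x) * inverse x" using x0 by (simp add: field_simps)
  then have "1 \<in> max_ideal V" using max_ideal_mult(2)[OF m, of "t - d * inverse x"] assms i vr_closed
    by metis
  then show False using max_ideal_one by simp
qed

end

text \<open>Only the image of the subring \<open>A\<close> in the residue field is required to be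
  finite: for an algebraically closed field the residue field of \<open>V\<close> is algebraically
  closed too, hence infinite.\<close>

definition finite_residue :: "'k::field set \<Rightarrow> 'k set \<Rightarrow> bool" where
  "finite_residue A V \<longleftrightarrow> (\<exists>F. finite F \<and> F \<subseteq> A \<and> (\<forall>a\<in>A. \<exists>f\<in>F. a - f \<in> max_ideal V))"

lemma finite_residue_pigeonhole:
  fixes s :: "nat \<Rightarrow> 'k::field"
  assumes V: "valuation_ring V" and fr: "finite_residue A V" and s: "\<And>n. s n \<in> A"
  shows "\<exists>i j. i < j \<and> s j - s i \<in> max_ideal V"
proof -
  obtain F where F: "finite F" "\<And>a. a \<in> A \<Longrightarrow> \<exists>f\<in>F. a - f \<in> max_ideal V"
    using fr unfolding finite_residue_def by blast
  obtain r where r: "\<And>n. r n \<in> F" "\<And>n. s n - r n \<in> max_ideal V" using F(2)[OF s] by metis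
  have "\<not> inj r" using F(1) r(1) by (meson finite_subset image_subsetI infinite_UNIV_nat range_inj_infinite)
  then obtain i j where "i < j" "r i = r j" unfolding inj_def by (metis nat_neq_iff)
  moreover have "s j - s i = (s j - r j) - (s i - r i)" using calculation by simp
  ultimately show ?thesis using max_ideal_diff[OF V r(2) r(2)] by metis
qed

text \<open>Two powers of \<open>a\<close> are congruent by the pigeonhole principle, and the
  smaller one can be cancelled because it is a unit.\<close>

lemma finite_residue_root_of_unity:
  assumes V: "valuation_ring V" and A: "subring_of_field A" "A \<subseteq> V" and fr: "finite_residue A V"
    and a: "a \<in> A" "a \<notin> max_ideal V"
  shows "\<exists>L>0. a ^ L - 1 \<in> max_ideal V"
proof -
  obtain i j where ij: "i < j" "a ^ j - a ^ i \<in> max_ideal V"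
    using finite_residue_pigeonhole[OF V fr, of "\<lambda>n. a ^ n"] sr_power[OF A(1) a(1)] by blast
  have "a ^ j - a ^ i = a ^ i * (a ^ (j - i) - 1)"
    using ij(1) by (simp add: algebra_simps flip: power_add)
  then have "a ^ i \<in> max_ideal V \<or> a ^ (j - i) - 1 \<in> max_ideal V"
    using ij a A max_ideal_prime[OF V, of "a ^ i" "a ^ (j - i) - 1"] vr_closed[OF V] by auto
  then show ?thesis using max_ideal_power[OF V] a A ij by (metis subsetD zero_less_diff)
qed

text \<open>The residue characteristic is positive: two distinct natural numbers are congruent, and
  primality of the maximal ideal passes from their difference to one of its prime factors.\<close>

lemma finite_residue_prime:
  assumes V: "valuation_ring V" and A: "subring_of_field A" "A \<subseteq> V" and fr: "finite_residue A V"
  shows "\<exists>l::nat. prime l \<and> of_nat l \<in> max_ideal V"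
proof -
  obtain i j where ij: "i < j" "of_nat j - of_nat i \<in> max_ideal V"
    using finite_residue_pigeonhole[OF V fr, of of_nat] sr_of_nat[OF A(1)] by blast
  have "\<exists>l::nat. prime l \<and> of_nat l \<in> max_ideal V" if "n > 0" "of_nat n \<in> max_ideal V" for n :: nat
    using that
  proof (induction n rule: less_induct)
    case (less n)
    have "n \<noteq> 1" using less max_ideal_one[OF V] by auto
    then obtain p where p: "prime p" "p dvd n" using prime_factor_nat by blast
    then obtain m where m: "n = p * m" by blast
    have "of_nat p \<in> max_ideal V \<or> of_nat m \<in> max_ideal V"
      using less(3) m max_ideal_prime[OF V, of "of_nat p" "of_nat m"] sr_of_nat[OF vr_subring[OF V]] by auto
    moreover have "m < n" "m > 0" using m p less.prems(1) prime_gt_1_nat by auto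
    ultimately show ?case using less.IH p by blast
  qed
  from this[of "j - i"] ij show ?thesis by (simp add: of_nat_diff)
qed

text \<open>Division with remainder by \<open>g\<close>, carried out modulo the maximal ideal: every
  element of the enlarged ring is congruent to a polynomial in \<open>x\<close> of degree below
  \<open>degree g\<close>, with coefficients among finitely many representatives.\<close>

lemma finite_residue_adjoin:
  assumes V: "valuation_ring V" and A: "subring_of_field A" "A \<subseteq> V" and fr: "finite_residue A V"
    and x: "x \<in> V" and g: "\<forall>i. coeff g i \<in> A" "lead_coeff g \<notin> max_ideal V" "poly g x \<in> max_ideal V"
  shows "finite_residue (adjoin A x) V"
proof -
  let ?M = "max_ideal V"
  obtain F where F: "finite F" "F \<subseteq> A" "\<And>a. a \<in> A \<Longrightarrow> \<exists>f\<in>F. a - f \<in> ?M"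
    using fr unfolding finite_residue_def by blast
  define d a where "d = degree g" and "a = lead_coeff g"
  have aA: "a \<in> A" using g a_def by auto
  obtain L where L: "L > 0" "a ^ L - 1 \<in> ?M"
    using finite_residue_root_of_unity[OF V A fr aA] g a_def by auto
  \<comment> \<open>The leading coefficient \<open>a\<close> is a unit of \<open>V\<close>, but its
    inverse may lie outside \<open>A\<close>. As \<open>a\<close> is a root of unity modulo the
    maximal ideal, its power \<open>b\<close> is an inverse modulo that ideal and stays in
    \<open>A\<close>.\<close>
  define b where "b = a ^ (L - 1)"
  have b: "b \<in> A" "1 - b * a \<in> ?M"
    using sr_power[OF A(1) aA] L max_ideal_minus[OF V L(2)] power_minus_mult[OF L(1), of a]
    unfolding b_def by auto
  define F' where "F' = (\<lambda>f. \<Sum>i<d. f i * x ^ i) ` ({..<d} \<rightarrow>\<^sub>E F)"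
  have "\<exists>f\<in>F'. poly p x - f \<in> ?M" if "\<forall>i. coeff p i \<in> A" for p
    using that
  proof (induction "degree p" arbitrary: p rule: less_induct)
    case less
    show ?case
    proof (cases "degree p < d")
      case True
      have "\<forall>i. \<exists>f. f \<in> F \<and> coeff p i - f \<in> ?M" using F(3) less.prems by blast
      then obtain r where r: "\<And>i. r i \<in> F" "\<And>i. coeff p i - r i \<in> ?M" by metis
      have "poly p x = (\<Sum>i<d. coeff p i * x ^ i)"
        unfolding poly_altdef using True by (intro sum.mono_neutral_left) (auto simp: coeff_eq_0)
      then have "poly p x - (\<Sum>i<d. r i * x ^ i) = (\<Sum>i<d. (coeff p i - r i) * x ^ i)"
        by (simp add: sum_subtractf left_diff_distrib)
      also have "\<dots> \<in> ?M"
        using r x by (intro max_ideal_sum[OF V] max_ideal_mult(1)[OF V] sr_power[OF vr_subring[OF V]])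
      finally have "poly p x - (\<Sum>i<d. restrict r {..<d} i * x ^ i) \<in> ?M" by simp
      moreover have "restrict r {..<d} \<in> {..<d} \<rightarrow>\<^sub>E F" using r by auto
      ultimately show ?thesis unfolding F'_def by blast
    next
      case False
      define n c where "n = degree p" and "c = lead_coeff p"
      have cA: "c \<in> A" using less.prems c_def by auto
      have n0: "0 < n"
      proof (rule ccontr)
        assume "\<not> 0 < n"
        then have "d = 0" using False n_def by simp
        then obtain e where "g = [:e:]" using degree_0_id d_def by metis
        then show False using g by simp
      qed
      \<comment> \<open>The part of the leading coefficient that survives since \<open>b\<close>
        inverts \<open>a\<close> only approximately. It lies in the maximal ideal and is discarded
        together with the multiple of \<open>g\<close>.\<close>
      define e where "e = c * (1 - b * a)"
      define p' where "p' = p - smult (b * c) (monom 1 (n - d) * g) - monom e n"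
      have eM: "e \<in> ?M" unfolding e_def using max_ideal_mult[OF V b(2)] cA A by blast
      have eA: "e \<in> A" unfolding e_def using cA aA b by (intro sr_mult[OF A(1)] sr_diff[OF A(1)] sr_one[OF A(1)])
      have cp': "\<forall>i. coeff p' i \<in> A"
        unfolding p'_def using less.prems g(1) cA b eA
        by (auto simp: coeff_monom_mult sr_zero[OF A(1)] intro!: sr_diff[OF A(1)] sr_mult[OF A(1)])
      have dp': "degree p' < n"
      proof -
        have "degree p' \<le> n - 1"
        proof (rule degree_le, intro allI impI)
          fix i assume "n - 1 < i"
          then have i: "i = n \<or> i > n" using n0 by linarith
          then show "coeff p' i = 0"
          proof
            assume "i = n"
            moreover have "coeff g (n - (n - d)) = a" using False by (simp add: a_def d_def n_def)
            ultimately have "coeff p' i = c - b * c * a - e"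
              unfolding p'_def by (simp add: coeff_monom_mult c_def n_def)
            then show ?thesis by (simp add: e_def algebra_simps)
          next
            assume "i > n"
            then have "i - (n - d) > d" using False n_def by simp
            with \<open>i > n\<close> show ?thesis
              unfolding p'_def by (simp add: coeff_monom_mult coeff_eq_0 n_def d_def)
          qed
        qed
        with n0 show ?thesis by linarith
      qed
      then obtain f where f: "f \<in> F'" "poly p' x - f \<in> ?M" using less.hyps[of p'] cp' n_def by auto
      have "poly p x - f = (poly p' x - f) + (b * c * x ^ (n - d)) * poly g x + x ^ n * e"
        unfolding p'_def by (simp add: poly_monom algebra_simps)
      moreover have "b * c * x ^ (n - d) \<in> V" "x ^ n \<in> V"
        using x b cA A by (auto intro!: vr_closed[OF V])
      ultimately have "poly p x - f \<in> ?M"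
        using f(2) eM g(3) max_ideal_add[OF V] max_ideal_mult(2)[OF V] by metis
      with f(1) show ?thesis by blast
    qed
  qed
  moreover have "F' \<subseteq> adjoin A x"
    unfolding F'_def using adjoin_gen[OF A(1)] adjoin_base[OF A(1)] F(2) sr_closed[OF adjoin_subring[OF A(1)]]
    by (auto intro!: sr_sum[OF adjoin_subring[OF A(1)]]) (metis PiE_mem lessThan_iff subsetD)
  moreover have "finite F'" unfolding F'_def using F(1) by (intro finite_imageI finite_PiE) auto
  ultimately show ?thesis unfolding finite_residue_def adjoin_def by (intro exI[of _ F']) auto
qed

text \<open>The inductive form of the Nullstellensatz over the integers.\<close>

definition good_ring :: "'k::field set \<Rightarrow> bool" where
  "good_ring A \<longleftrightarrow> subring_of_field A \<and>
     (\<forall>f\<in>A. f \<noteq> 0 \<longrightarrow> (\<exists>V. valuation_ring V \<and> A \<subseteq> V \<and> f \<notin> max_ideal V \<and> finite_residue A V))"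

text \<open>In positive characteristic the integers have the finite prime field as image, and the
  trivial valuation ring serves. In characteristic zero a prime larger than the given integer keeps
  it a unit, by Bezout.\<close>

lemma good_ring_integers: "good_ring (range of_int :: 'k::field set)"
  unfolding good_ring_def
proof (intro conjI ballI impI)
  let ?B = "range of_int :: 'k set"
  show B: "subring_of_field ?B"
    by (rule subring_of_fieldI) (auto simp flip: of_int_diff of_int_mult intro: range_eqI[of _ _ 1])
  fix f :: 'k assume "f \<in> ?B" "f \<noteq> 0"
  then obtain n where n: "f = of_int n" by blast
  have fr: "finite_residue ?B V" if V: "valuation_ring V" and l: "of_nat l \<in> max_ideal V" "l > 0"
    for V :: "'k set" and l
    unfolding finite_residue_def
  proof (intro exI conjI ballI)
    show "finite (of_int ` {0..<int l})" "of_int ` {0..<int l} \<subseteq> ?B" by auto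
    fix a assume "a \<in> ?B"
    then obtain m where m: "a = of_int m" by blast
    have "m - m mod int l = int l * (m div int l)" by (simp add: minus_mod_eq_mult_div)
    then have "(of_int m - of_int (m mod int l) :: 'k) = of_nat l * of_int (m div int l)"
      by (metis of_int_diff of_int_mult of_int_of_nat_eq)
    also have "\<dots> \<in> max_ideal V"
      using max_ideal_mult[OF V l(1)] sr_of_int[OF vr_subring[OF V]] by blast
    finally show "\<exists>f\<in>of_int ` {0..<int l}. a - f \<in> max_ideal V" using m l by auto
  qed
  show "\<exists>V. valuation_ring V \<and> ?B \<subseteq> V \<and> f \<notin> max_ideal V \<and> finite_residue ?B V"
  proof (cases "CHAR('k) = 0")
    case False
    have V: "valuation_ring (UNIV :: 'k set)" by (simp add: valuation_ring_def subring_of_field_def)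
    have M: "max_ideal (UNIV :: 'k set) = {0}" by (auto simp: max_ideal_def)
    show ?thesis using fr[OF V, of "CHAR('k)"] V M \<open>f \<noteq> 0\<close> False by (intro exI[of _ UNIV]) auto
  next
    case True
    obtain l :: nat where l: "prime l" "l > nat \<bar>n\<bar>" using bigger_prime by blast
    have inj: "(of_int i :: 'k) = of_int j \<longleftrightarrow> i = j" for i j
      using of_int_eq_0_iff_char_dvd[of "i - j", where 'a = 'k] True by simp
    have "1 \<notin> ideal_span {of_nat l} ?B"
    proof
      have "\<exists>r. x = of_nat l * of_int r" if "x \<in> ideal_span {of_nat l} ?B" for x :: 'k
        using that
      proof induction
        case (span_add x j r)
        then show ?case by (auto simp flip: distrib_left of_int_add)
      qed (auto intro: exI[of _ 0])
      moreover assume "1 \<in> ideal_span {of_nat l} ?B"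
      ultimately obtain r where "(1::'k) = of_nat l * of_int r" by blast
      then have "(of_int 1 :: 'k) = of_int (int l * r)" by simp
      then have "1 = int l * r" using inj by blast
      then show False using l(1) by (metis dvd_triv_left int_dvd_int_iff not_prime_unit of_nat_1)
    qed
    then obtain V where V: "valuation_ring V" "?B \<subseteq> V" "of_nat l \<in> max_ideal V"
      using valuation_ring_extension[OF B, of "{of_nat l}"] by (auto simp: range_eqI[of _ _ "int l"])
    have "f \<notin> max_ideal V"
    proof
      assume fM: "f \<in> max_ideal V"
      have "n \<noteq> 0" using \<open>f \<noteq> 0\<close> n by auto
      then have "\<not> int l dvd n" using l(2) zdvd_imp_le[of "int l" "\<bar>n\<bar>"] by auto
      then have "coprime (int l) n" using l(1) by (intro prime_imp_coprime) auto
      then obtain u w where "u * int l + w * n = 1" using bezout_int[of "int l" n] by auto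
      then have "of_int u * of_nat l + of_int w * f = (1::'k)"
        unfolding n by (metis of_int_1 of_int_add of_int_mult of_int_of_nat_eq)
      then show False
        using max_ideal_one[OF V(1)] max_ideal_add[OF V(1) max_ideal_mult(2)[OF V(1,3)] max_ideal_mult(2)[OF V(1) fM]]
          sr_of_int[OF vr_subring[OF V(1)]] by metis
    qed
    then show ?thesis using fr[OF V(1,3)] V l prime_gt_0_nat by auto
  qed
qed

text \<open>The hypothesis says that \<open>x\<close> is transcendental over \<open>A\<close>. A
  place of \<open>A\<close> at which the leading coefficient \<open>a\<close> of \<open>f\<close> is
  a unit is extended so that \<open>x\<close> becomes a root of a polynomial with leading
  coefficient \<open>a\<close> that also forces \<open>f\<close> to be a unit.\<close>

lemma good_ring_adjoin:
  assumes A: "good_ring A" and tr: "\<And>g. \<forall>i. coeff g i \<in> A \<Longrightarrow> poly g x = 0 \<Longrightarrow> g = 0"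
  shows "good_ring (adjoin A x)"
  unfolding good_ring_def
proof (intro conjI ballI impI)
  have sA: "subring_of_field A" using A good_ring_def by blast
  let ?B = "adjoin A x"
  show B: "subring_of_field ?B" using adjoin_subring[OF sA] .
  note AB = adjoin_base[OF sA, of x]
  fix f assume "f \<in> ?B" and f0: "f \<noteq> 0"
  then obtain r where r: "f = poly r x" "\<forall>i. coeff r i \<in> A" unfolding adjoin_def by blast
  define a where "a = lead_coeff r"
  have a: "a \<in> A" "a \<noteq> 0" using r f0 a_def by auto
  then obtain V0 where V0: "valuation_ring V0" "A \<subseteq> V0" "a \<notin> max_ideal V0" "finite_residue A V0"
    using A unfolding good_ring_def by blast
  let ?m = "max_ideal V0 \<inter> A"
  \<comment> \<open>That is, \<open>g\<close> is 1 plus the variable times \<open>r\<close>, with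
    value \<open>1 + x * f\<close> at \<open>x\<close>. If this value is in the maximal ideal, then
    \<open>f\<close> is not; and \<open>x\<close> is a root of \<open>g\<close> in the residue
    field, as needed for finite residues.\<close>
  define g where "g = pCons 1 r"
  have g: "\<forall>i. coeff g i \<in> A" "lead_coeff g = a" "degree g = Suc (degree r)" "poly g x = 1 + x * f"
    using r f0 sr_one[OF sA] by (auto simp: g_def a_def coeff_pCons split: nat.splits)
  have mul: "s * t \<in> ?m" if "s \<in> ?m" "t \<in> A" for s t
    using that max_ideal_mult[OF V0(1)] sr_mult[OF sA] V0(2) by blast
  have proper: "1 \<notin> ideal_span (insert (poly g x) ?m) ?B"
  proof
    have "\<exists>P Q. y = poly (P + Q * g) x \<and> (\<forall>i. coeff P i \<in> ?m) \<and> (\<forall>i. coeff Q i \<in> A)"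
      if "y \<in> ideal_span (insert (poly g x) ?m) ?B" for y
      using that
    proof induction
      case span_zero
      show ?case by (rule exI[of _ 0], rule exI[of _ 0]) (auto simp: max_ideal_zero[OF V0(1)] sr_zero[OF sA])
    next
      case (span_add y j s)
      then obtain P Q where PQ: "y = poly (P + Q * g) x" "\<forall>i. coeff P i \<in> ?m" "\<forall>i. coeff Q i \<in> A" by blast
      obtain q where q: "s = poly q x" "\<forall>i. coeff q i \<in> A" using span_add(3) unfolding adjoin_def by blast
      show ?case
      proof (cases "j = poly g x")
        case True
        then show ?thesis using PQ q sr_add[OF sA]
          by (intro exI[of _ P] exI[of _ "Q + q"]) (auto simp: algebra_simps)
      next
        case False
        then have "j \<in> ?m" using span_add by blast
        then show ?thesis using PQ q mul max_ideal_add[OF V0(1)] sr_add[OF sA]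
          by (intro exI[of _ "P + smult j q"] exI[of _ Q]) (auto simp: algebra_simps)
      qed
    qed
    moreover assume "1 \<in> ideal_span (insert (poly g x) ?m) ?B"
    ultimately obtain P Q where PQ: "1 = poly (P + Q * g) x" "\<forall>i. coeff P i \<in> ?m" "\<forall>i. coeff Q i \<in> A"
      by blast
    define h where "h = P + Q * g - 1"
    have "\<forall>i. coeff h i \<in> A"
      unfolding h_def using PQ coeff_mult_closed[OF sA PQ(3) g(1)]
      by (auto simp: coeff_1 sr_one[OF sA] sr_zero[OF sA] intro!: sr_diff[OF sA] sr_add[OF sA])
    moreover have "poly h x = 0" using PQ(1) by (simp add: h_def)
    ultimately have h: "h = 0" using tr by blast
    \<comment> \<open>Downward induction: in degree \<open>i + degree g\<close> the coefficient of
      \<open>Q * g\<close> is \<open>coeff Q i * a\<close> plus terms containing higher coefficients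
      of \<open>Q\<close>, and \<open>a\<close> is a unit at \<open>V0\<close>. The constant terms
      of \<open>P + Q * g = 1\<close> then put 1 into the maximal ideal.\<close>
    have QM: "coeff Q i \<in> ?m" for i
    proof (induction "degree Q + 1 - i" arbitrary: i rule: less_induct)
      case less
      show ?case
      proof (cases "i \<le> degree Q")
        case False then show ?thesis using max_ideal_zero[OF V0(1)] sr_zero[OF sA] by (simp add: coeff_eq_0)
      next
        case True
        define N where "N = i + degree g"
        have "coeff (P + Q * g) N = 0" using h g(3) unfolding h_def N_def by (simp add: coeff_1)
        then have "coeff (Q * g) N \<in> ?m"
          using PQ(2)[rule_format, of N] max_ideal_minus[OF V0(1)] sr_minus[OF sA]
          by (simp add: add_eq_0_iff)
        moreover have "coeff (Q * g) N = coeff Q i * a + (\<Sum>k\<in>{..N} - {i}. coeff Q k * coeff g (N - k))"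
          unfolding coeff_mult
          by (subst sum.remove[of _ i]) (auto simp: N_def g(2)[symmetric])
        moreover have "coeff Q k * coeff g (N - k) \<in> max_ideal V0" if "k \<in> {..N} - {i}" for k
        proof (cases "k > i")
          case True
          then have "coeff Q k \<in> ?m" using less[of k] \<open>i \<le> degree Q\<close> by auto
          then show ?thesis using max_ideal_mult[OF V0(1)] g(1) V0(2) by blast
        next
          case False
          then have "coeff g (N - k) = 0" using that unfolding N_def by (intro coeff_eq_0) auto
          then show ?thesis using max_ideal_zero[OF V0(1)] by simp
        qed
        then have "(\<Sum>k\<in>{..N} - {i}. coeff Q k * coeff g (N - k)) \<in> max_ideal V0"
          by (rule max_ideal_sum[OF V0(1)])
        ultimately have "coeff Q i * a \<in> max_ideal V0"
          using max_ideal_diff[OF V0(1)] by (metis IntD1 add_diff_cancel_right')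
        then show ?thesis using max_ideal_prime[OF V0(1), of "coeff Q i" a] PQ(3) V0 a by blast
      qed
    qed
    have "coeff (P + Q * g) 0 = 1" using h unfolding h_def by (simp add: algebra_simps)
    then have "coeff P 0 + coeff Q 0 = 1" by (simp add: g_def coeff_mult)
    then show False using QM[of 0] PQ(2) max_ideal_add[OF V0(1)] max_ideal_one[OF V0(1)] by (metis IntD1)
  qed
  have xB: "x \<in> ?B" "f \<in> ?B" using adjoin_gen[OF sA] \<open>f \<in> ?B\<close> by auto
  have "insert (poly g x) ?m \<subseteq> ?B" using g(4) AB sr_closed[OF B] xB by auto
  then obtain V where V: "valuation_ring V" "?B \<subseteq> V" "insert (poly g x) ?m \<subseteq> max_ideal V"
    using valuation_ring_extension[OF B _ proper] by blast
  have AV: "A \<subseteq> V" using V AB by blast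
  have fr: "finite_residue A V"
  proof -
    obtain F where F: "finite F" "F \<subseteq> A" "\<And>a. a \<in> A \<Longrightarrow> \<exists>f\<in>F. a - f \<in> max_ideal V0"
      using V0(4) unfolding finite_residue_def by blast
    have "\<exists>f\<in>F. b - f \<in> max_ideal V" if "b \<in> A" for b
    proof -
      obtain f where f: "f \<in> F" "b - f \<in> max_ideal V0" using F(3) \<open>b \<in> A\<close> by blast
      then have "b - f \<in> ?m" using \<open>b \<in> A\<close> F(2) sr_diff[OF sA] by blast
      then show ?thesis using V(3) f by blast
    qed
    then show ?thesis unfolding finite_residue_def using F by blast
  qed
  \<comment> \<open>The construction only guarantees that elements of \<open>?m\<close> stay in the
    maximal ideal. That \<open>a\<close> stays a unit is deduced from \<open>a ^ L - 1\<close> lying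
    in \<open>?m\<close>.\<close>
  have aV: "a \<notin> max_ideal V"
  proof
    assume aM: "a \<in> max_ideal V"
    obtain L where L: "L > 0" "a ^ L - 1 \<in> max_ideal V0"
      using finite_residue_root_of_unity[OF V0(1) sA V0(2,4) a(1) V0(3)] by blast
    moreover have "a ^ L - 1 \<in> A" using a(1) by (intro sr_diff[OF sA] sr_power[OF sA] sr_one[OF sA])
    ultimately have "a ^ L - 1 \<in> max_ideal V" using V(3) by blast
    moreover have "a ^ L \<in> max_ideal V"
      using max_ideal_mult(1)[OF V(1) aM, of "a ^ (L - 1)"] L(1) a(1) AV vr_closed[OF V(1)]
      by (metis power_eq_if not_gr0 subsetD)
    ultimately show False using max_ideal_one[OF V(1)] max_ideal_diff[OF V(1)]
      by (metis add_diff_cancel_left' diff_add_cancel diff_diff_eq2)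
  qed
  have "f \<notin> max_ideal V"
  proof
    assume "f \<in> max_ideal V"
    then have "x * f \<in> max_ideal V" using max_ideal_mult[OF V(1)] V(2) xB by blast
    then have "1 \<in> max_ideal V" using V(3) g(4) max_ideal_diff[OF V(1)]
      by (metis add_diff_cancel_right' insert_subset)
    then show False using max_ideal_one[OF V(1)] by blast
  qed
  moreover have "finite_residue ?B V"
    using finite_residue_adjoin[OF V(1) sA AV fr _ g(1)] V xB g(2) aV by auto
  ultimately show "\<exists>V. valuation_ring V \<and> ?B \<subseteq> V \<and> f \<notin> max_ideal V \<and> finite_residue ?B V"
    using V by blast
qed

text \<open>Only those elements of \<open>T\<close> are adjoined that are transcendental over the
  ring built so far, so that \<open>good_ring_adjoin\<close> applies; the others are algebraic over
  it, but perhaps not integral.\<close>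

lemma algebraic_over_good_ring:
  assumes "finite (T :: 'k::field set)"
  shows "\<exists>A. good_ring A \<and> (\<forall>c\<in>T. \<exists>g. g \<noteq> 0 \<and> (\<forall>i. coeff g i \<in> A) \<and> poly g c = 0)"
  using assms
proof induction
  case empty then show ?case using good_ring_integers by blast
next
  case (insert c T)
  then obtain A where A: "good_ring A" "\<forall>c\<in>T. \<exists>g. g \<noteq> 0 \<and> (\<forall>i. coeff g i \<in> A) \<and> poly g c = 0" by blast
  have sA: "subring_of_field A" using A good_ring_def by blast
  show ?case
  proof (cases "\<exists>g. g \<noteq> 0 \<and> (\<forall>i. coeff g i \<in> A) \<and> poly g c = 0")
    case True then show ?thesis using A by blast
  next
    case False
    have "\<forall>i. coeff [:- c, 1:] i \<in> adjoin A c"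
      using adjoin_gen[OF sA] sr_closed[OF adjoin_subring[OF sA]] by (auto simp: coeff_pCons split: nat.splits)
    then have "\<exists>g. g \<noteq> 0 \<and> (\<forall>i. coeff g i \<in> adjoin A c) \<and> poly g c = 0"
      by (intro exI[of _ "[:- c, 1:]"]) auto
    moreover have "good_ring (adjoin A c)" using good_ring_adjoin[OF A(1)] False by blast
    ultimately show ?thesis using A(2) adjoin_base[OF sA]
      by (intro exI[of _ "adjoin A c"]) (auto, meson subsetD)
  qed
qed

text \<open>Reversing the polynomial shows that inverses of units are adjoined in the same way.\<close>

theorem finite_residue_place:
  assumes T: "finite (T :: 'k::field set)" "0 \<notin> T"
  obtains A V where "subring_of_field A" "valuation_ring V" "A \<subseteq> V" "finite_residue A V"
    "T \<subseteq> A" "inverse ` T \<subseteq> A"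
proof -
  obtain A where A: "good_ring A" and alg: "\<forall>c\<in>T. \<exists>g. g \<noteq> 0 \<and> (\<forall>i. coeff g i \<in> A) \<and> poly g c = 0"
    using algebraic_over_good_ring[OF T(1)] by blast
  have sA: "subring_of_field A" using A good_ring_def by blast
  have "\<exists>g. g \<noteq> 0 \<and> (\<forall>i. coeff g i \<in> A) \<and> poly g c = 0" if c: "c \<in> T \<union> inverse ` T" for c
  proof (cases "c \<in> T")
    case False
    then obtain d where d: "d \<in> T" "c = inverse d" using c by blast
    obtain g where g: "g \<noteq> 0" "\<forall>i. coeff g i \<in> A" "poly g d = 0" using alg d by blast
    have "poly (reflect_poly g) (inverse d) = 0"
      using poly_reflect_poly_nz[of "inverse d" g] g(3) d T by auto
    then show ?thesis using g d sr_zero[OF sA]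
      by (intro exI[of _ "reflect_poly g"]) (auto simp: coeff_reflect_poly)
  qed (use alg in blast)
  then obtain G where G: "\<And>c. c \<in> T \<union> inverse ` T \<Longrightarrow> G c \<noteq> 0 \<and> (\<forall>i. coeff (G c) i \<in> A) \<and> poly (G c) c = 0"
    by metis
  define U where "U = T \<union> inverse ` T"
  have finU: "finite U" using T U_def by auto
  \<comment> \<open>At a place where \<open>f\<close> is a unit, every leading coefficient is a
    unit, so all elements of \<open>U\<close> become integral and have finite residues.\<close>
  define f where "f = (\<Prod>c\<in>U. lead_coeff (G c))"
  have "f \<in> A" "f \<noteq> 0" unfolding f_def using G finU by (auto simp: U_def intro!: sr_prod[OF sA])
  then obtain V where V: "valuation_ring V" "A \<subseteq> V" "f \<notin> max_ideal V" "finite_residue A V"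
    using A unfolding good_ring_def by blast
  have lc: "lead_coeff (G c) \<notin> max_ideal V" if c: "c \<in> U" for c
  proof
    assume "lead_coeff (G c) \<in> max_ideal V"
    moreover have "(\<Prod>c\<in>U-{c}. lead_coeff (G c)) \<in> V"
      using G V(2) by (intro sr_prod[OF vr_subring[OF V(1)]]) (auto simp: U_def)
    ultimately have "lead_coeff (G c) * (\<Prod>c\<in>U-{c}. lead_coeff (G c)) \<in> max_ideal V"
      using max_ideal_mult[OF V(1)] by blast
    then show False using V(3) c finU unfolding f_def by (simp add: prod.remove)
  qed
  have UV: "c \<in> V" if c: "c \<in> U" for c
  proof (rule ccontr)
    assume cV: "c \<notin> V"
    define i where "i = inverse c"
    have c0: "c \<noteq> 0" using cV vr_closed[OF V(1)] by auto
    have i: "i \<in> max_ideal V" using cV c0 vr_total[OF V(1) c0] by (auto simp: i_def max_ideal_def)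
    let ?g = "G c"
    have "0 = poly (reflect_poly ?g) i"
      unfolding i_def using G[of c] c c0 U_def by (simp add: poly_reflect_poly_nz)
    also have "\<dots> = coeff (reflect_poly ?g) 0 + (\<Sum>k=1..degree (reflect_poly ?g). coeff (reflect_poly ?g) k * i ^ k)"
      unfolding poly_altdef by (simp add: atMost_atLeast0 sum.atLeast_Suc_atMost)
    finally have "lead_coeff ?g = - (\<Sum>k=1..degree (reflect_poly ?g). coeff (reflect_poly ?g) k * i ^ k)"
      by (simp add: add_eq_0_iff2)
    also have "\<dots> \<in> max_ideal V"
    proof (intro max_ideal_minus[OF V(1)] max_ideal_sum[OF V(1)])
      fix k assume "k \<in> {1..degree (reflect_poly ?g)}"
      then have "i ^ k = i * i ^ (k - 1)" by (simp add: power_eq_if)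
      then have "i ^ k \<in> max_ideal V"
        using max_ideal_mult[OF V(1) i] vr_closed[OF V(1)] max_ideal_subset[OF V(1) i] by metis
      moreover have "coeff (reflect_poly ?g) k \<in> V"
        using G[of c] c V(2) vr_closed[OF V(1)] by (auto simp: coeff_reflect_poly U_def)
      ultimately show "coeff (reflect_poly ?g) k * i ^ k \<in> max_ideal V" using max_ideal_mult[OF V(1)] by blast
    qed
    finally show False using lc[OF c] by blast
  qed
  have "\<exists>A'. subring_of_field A' \<and> A \<subseteq> A' \<and> A' \<subseteq> V \<and> finite_residue A' V \<and> S \<subseteq> A'" if "S \<subseteq> U" for S
    using finite_subset[OF that finU] that
  proof (induction S)
    case empty then show ?case using sA V by blast
  next
    case (insert c S)
    then obtain A' where A': "subring_of_field A'" "A \<subseteq> A'" "A' \<subseteq> V" "finite_residue A' V" "S \<subseteq> A'" by auto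
    have c: "c \<in> U" using insert by blast
    have "finite_residue (adjoin A' c) V"
      using finite_residue_adjoin[OF V(1) A'(1,3,4) UV[OF c], of "G c"] G[of c] c lc[OF c] A'(2) max_ideal_zero[OF V(1)]
      by (auto simp: U_def)
    then show ?case
      using adjoin_subring[OF A'(1)] adjoin_base[OF A'(1)] adjoin_gen[OF A'(1)]
        adjoin_least[OF vr_subring[OF V(1)] A'(3) UV[OF c]] A' by (intro exI[of _ "adjoin A' c"]) blast
  qed
  from this[of U] obtain A' where "subring_of_field A'" "A' \<subseteq> V" "finite_residue A' V" "U \<subseteq> A'" by blast
  with V(1) that show thesis unfolding U_def by auto
qed

section \<open>Two by two matrices\<close>

text \<open>The quotient of \<open>x ^ n - y ^ n\<close> by \<open>x - y\<close>, written without
  division so that it also covers \<open>x = y\<close>, where it is \<open>n\<close> times a power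
  of \<open>x\<close>. For eigenvalues \<open>x\<close>, \<open>y\<close> its vanishing means that
  the n-th power of the matrix is scalar, unless the matrix is scalar already.\<close>

fun homog_sum :: "'a::comm_ring_1 \<Rightarrow> 'a \<Rightarrow> nat \<Rightarrow> 'a" where
  "homog_sum x y 0 = 0"
| "homog_sum x y (Suc n) = x * homog_sum x y n + y ^ n"

lemma homog_sum_diff: "(x - y) * homog_sum x y n = x ^ n - y ^ n"
proof (induction n)
  case (Suc n)
  have "(x - y) * homog_sum x y (Suc n) = x * ((x - y) * homog_sum x y n) + (x - y) * y ^ n"
    by (simp add: algebra_simps)
  then show ?case unfolding Suc by (simp add: algebra_simps)
qed simp

lemma homog_sum_add: "homog_sum x y (m + n) = x ^ n * homog_sum x y m + y ^ m * homog_sum x y n"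
  by (induction n) (auto simp: algebra_simps power_add)

text \<open>Multiplying the exponent multiplies the displacement by a further factor, which is how
  displacements are pushed into smaller ideals.\<close>

lemma homog_sum_mult: "homog_sum x y (n * r) = homog_sum x y n * homog_sum (x ^ n) (y ^ n) r"
proof (induction r)
  case (Suc r)
  have "homog_sum x y (n * Suc r) = homog_sum x y (n * r + n)" by (simp add: add.commute)
  also have "\<dots> = x ^ n * homog_sum x y (n * r) + y ^ (n * r) * homog_sum x y n" by (rule homog_sum_add)
  finally show ?case by (simp add: Suc.IH algebra_simps power_mult)
qed simp

lemma homog_sum_same: "homog_sum x x (Suc n) = of_nat (Suc n) * x ^ n"
  by (induction n) (auto simp: algebra_simps)

lemma homog_sum_closed:
  "subring_of_field V \<Longrightarrow> x \<in> V \<Longrightarrow> y \<in> V \<Longrightarrow> homog_sum x y n \<in> V"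
  by (induction n) (auto intro: sr_closed)

lemma homog_sum_cong:
  assumes V: "valuation_ring V" and xy: "x \<in> V" "y \<in> V" "x - y \<in> max_ideal V"
  shows "homog_sum x y n - homog_sum y y n \<in> max_ideal V"
proof (induction n)
  case (Suc n)
  have eq: "homog_sum x y (Suc n) - homog_sum y y (Suc n)
    = x * (homog_sum x y n - homog_sum y y n) + (x - y) * homog_sum y y n" by (simp add: algebra_simps)
  have "homog_sum y y n \<in> V" using homog_sum_closed[OF vr_subring[OF V]] xy by blast
  then show ?case unfolding eq
    using max_ideal_add[OF V max_ideal_mult(2)[OF V Suc xy(1)] max_ideal_mult(1)[OF V xy(3)]] by blast
qed (simp add: max_ideal_zero[OF V])

text \<open>Modulo the maximal ideal \<open>x\<close> may be replaced by \<open>y\<close>, and the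
  sum becomes \<open>n\<close> times a unit; only the residue characteristic matters.\<close>

lemma homog_sum_in_max_ideal_iff:
  assumes V: "valuation_ring V" and xy: "x \<in> V" "y \<in> V" "x - y \<in> max_ideal V" "y \<notin> max_ideal V"
  shows "homog_sum x y n \<in> max_ideal V \<longleftrightarrow> of_nat n \<in> max_ideal V"
proof (cases n)
  case (Suc k)
  have y: "y ^ k \<in> V" "y ^ k \<notin> max_ideal V"
    using max_ideal_power[OF V xy(2)] xy sr_power[OF vr_subring[OF V]] by auto
  have "homog_sum x y n \<in> max_ideal V \<longleftrightarrow> homog_sum y y n \<in> max_ideal V"
    using homog_sum_cong[OF V xy(1-3), of n] max_ideal_cong_unit[OF V] max_ideal_add[OF V]
    by (metis diff_add_cancel)
  also have "\<dots> \<longleftrightarrow> of_nat n * y ^ k \<in> max_ideal V" using homog_sum_same[of y k] Suc by simp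
  also have "\<dots> \<longleftrightarrow> of_nat n \<in> max_ideal V"
    using max_ideal_prime[OF V sr_of_nat[OF vr_subring[OF V]] y(1)] max_ideal_mult(1)[OF V _ y(1)] y by blast
  finally show ?thesis .
qed simp

primrec mpow :: "'k::field^2^2 \<Rightarrow> nat \<Rightarrow> 'k^2^2" where
  "mpow A 0 = mat 1"
| "mpow A (Suc n) = A ** mpow A n"

definition minv :: "'k::field^2^2 \<Rightarrow> 'k^2^2" where
  "minv A = (\<chi> i j. (if i = j then A$1$1 + A$2$2 - A$i$i else - A$i$j) / det A)"

text \<open>The determinant of two vectors. Between nonzero vectors it vanishes exactly when they
  span the same point of the projective line, and it makes congruence of points measurable.\<close>

definition wedge :: "'k::field^2 \<Rightarrow> 'k^2 \<Rightarrow> 'k" where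
  "wedge x y = x$1 * y$2 - x$2 * y$1"

definition eigen_pair :: "'k::field^2^2 \<Rightarrow> 'k \<Rightarrow> 'k \<Rightarrow> bool" where
  "eigen_pair A x y \<longleftrightarrow> x + y = A$1$1 + A$2$2 \<and> x * y = det A"

lemma mat2_eq_iff: "(A :: 'k^2^2) = B \<longleftrightarrow> A$1$1 = B$1$1 \<and> A$1$2 = B$1$2 \<and> A$2$1 = B$2$1 \<and> A$2$2 = B$2$2"
  by (auto simp: vec_eq_iff forall_2)

lemma vec2_eq_iff: "(x :: 'k^2) = y \<longleftrightarrow> x$1 = y$1 \<and> x$2 = y$2"
  by (auto simp: vec_eq_iff forall_2)

lemma mat2_mult: "((A :: 'k::field^2^2) ** B)$i$j = A$i$1 * B$1$j + A$i$2 * B$2$j"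
  by (simp add: matrix_matrix_mult_def sum_2)

lemma mat2_vec: "((A :: 'k::field^2^2) *v x)$i = A$i$1 * x$1 + A$i$2 * x$2"
  by (simp add: matrix_vector_mult_def sum_2)

lemma mat2_mat: "(mat c :: 'k::field^2^2)$1$1 = c" "(mat c :: 'k^2^2)$2$2 = c"
  "(mat c :: 'k^2^2)$1$2 = 0" "(mat c :: 'k^2^2)$2$1 = 0"
  by (auto simp: mat_def)

lemma minv_entries: "minv A$1$1 = A$2$2 / det A" "minv A$2$2 = A$1$1 / det A"
  "minv A$1$2 = - A$1$2 / det A" "minv A$2$1 = - A$2$1 / det A"
  by (auto simp: minv_def)

lemma minv_right: assumes "det A \<noteq> 0" shows "A ** minv A = mat 1"
proof -
  define D where "D = det A"
  then have D: "D = det A" "A$1$1 * A$2$2 = D + A$1$2 * A$2$1" by (simp_all add: det_2)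
  show ?thesis using assms D(2)
    unfolding mat2_eq_iff mat2_mult mat2_mat minv_entries D(1)[symmetric] by (simp add: field_simps)
qed

lemma minv_left: assumes "det A \<noteq> 0" shows "minv A ** A = mat 1"
proof -
  define D where "D = det A"
  then have D: "D = det A" "A$1$1 * A$2$2 = D + A$1$2 * A$2$1" by (simp_all add: det_2)
  show ?thesis using assms D(2)
    unfolding mat2_eq_iff mat2_mult mat2_mat minv_entries D(1)[symmetric] by (simp add: field_simps)
qed

lemma det_minv: "det (minv A) = 1 / det A"
proof (cases "det A = 0")
  case True
  then show ?thesis by (simp add: det_2[of "minv A"] minv_entries)
next
  case False
  have "det (minv A) * det A = 1" using minv_left[OF False] by (metis det_I det_mul)
  with False show ?thesis by (simp add: field_simps)
qed

lemma det_mpow: "det (mpow A n) = det A ^ n"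
  by (induction n) (auto simp: det_mul)

lemma mpow_add: "mpow A (m + n) = mpow A m ** mpow A n"
  by (induction m) (auto simp: matrix_mul_assoc)

lemma eigen_pair_exists: "\<exists>x y. eigen_pair (A :: 'k::alg_closed_field^2^2) x y"
proof -
  let ?p = "[:det A, - (A$1$1 + A$2$2), 1:]"
  obtain x where "poly ?p x = 0" using alg_closed_imp_poly_has_root[of ?p] by auto
  then have "x * (A$1$1 + A$2$2 - x) = det A" by (simp add: algebra_simps)
  then show ?thesis unfolding eigen_pair_def
    by (intro exI[of _ x] exI[of _ "A$1$1 + A$2$2 - x"]) simp
qed

lemma eigen_pair_disc:
  assumes "eigen_pair A x y" shows "(x - y)\<^sup>2 = (A$1$1 + A$2$2)\<^sup>2 - 4 * det A"
proof -
  have "(x - y)\<^sup>2 = (x + y)\<^sup>2 - 4 * (x * y)" by (simp add: power2_eq_square algebra_simps)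
  with assms show ?thesis by (simp add: eigen_pair_def)
qed

lemma eigen_pair_root:
  assumes "eigen_pair A x y"
  shows "x\<^sup>2 = (A$1$1 + A$2$2) * x - det A" "y\<^sup>2 = (A$1$1 + A$2$2) * y - det A"
proof -
  have "x\<^sup>2 = (x + y) * x - x * y" "y\<^sup>2 = (x + y) * y - x * y"
    by (simp_all add: power2_eq_square algebra_simps)
  with assms show "x\<^sup>2 = (A$1$1 + A$2$2) * x - det A" "y\<^sup>2 = (A$1$1 + A$2$2) * y - det A"
    by (simp_all only: eigen_pair_def)
qed

text \<open>By Cayley--Hamilton, \<open>A^n = y^n + U\<^sub>n(A - y)\<close> for the eigenvalues \<open>x, y\<close> and the
  homogeneous sum \<open>U\<^sub>n\<close>, also for a double eigenvalue.\<close>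

lemma mpow_entries:
  assumes "eigen_pair A x y"
  shows "mpow A n$1$1 = y ^ n + homog_sum x y n * (A$1$1 - y)"
    "mpow A n$2$2 = y ^ n + homog_sum x y n * (A$2$2 - y)"
    "mpow A n$1$2 = homog_sum x y n * A$1$2" "mpow A n$2$1 = homog_sum x y n * A$2$1"
proof (induction n)
  case 0
  show "mpow A 0$1$1 = y ^ 0 + homog_sum x y 0 * (A$1$1 - y)" "mpow A 0$2$2 = y ^ 0 + homog_sum x y 0 * (A$2$2 - y)"
    "mpow A 0$1$2 = homog_sum x y 0 * A$1$2" "mpow A 0$2$1 = homog_sum x y 0 * A$2$1" by (simp_all add: mat2_mat)
next
  case (Suc n)
  let ?u = "homog_sum x y n"
  have tr: "A$2$2 = x + y - A$1$1" and dt: "A$1$2 * A$2$1 = A$1$1 * A$2$2 - x * y"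
    using assms by (simp_all add: eigen_pair_def det_2)
  have dt': "A$1$2 * A$2$1 = A$1$1 * (x + y - A$1$1) - x * y" using tr dt by simp
  have e1: "?u * (A$1$2 * A$2$1) = ?u * (A$1$1 * (x + y - A$1$1) - x * y)" using dt' by simp
  show "mpow A (Suc n)$1$1 = y ^ Suc n + homog_sum x y (Suc n) * (A$1$1 - y)"
    using e1 by (simp add: mat2_mult Suc algebra_simps)
  show "mpow A (Suc n)$2$2 = y ^ Suc n + homog_sum x y (Suc n) * (A$2$2 - y)"
    using e1 by (simp add: mat2_mult Suc tr algebra_simps)
  show "mpow A (Suc n)$1$2 = homog_sum x y (Suc n) * A$1$2"
    by (simp add: mat2_mult Suc tr algebra_simps)
  show "mpow A (Suc n)$2$1 = homog_sum x y (Suc n) * A$2$1"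
    by (simp add: mat2_mult Suc tr algebra_simps)
qed

text \<open>By Cayley--Hamilton the n-th power is a scalar plus \<open>homog_sum x y n\<close> times
  \<open>A\<close>, and scalars do not contribute to the displacement of \<open>p\<close>.\<close>

lemma wedge_mpow: "eigen_pair A x y \<Longrightarrow> wedge (mpow A n *v p) p = homog_sum x y n * wedge (A *v p) p"
  by (simp add: wedge_def mat2_vec mpow_entries algebra_simps)

lemma wedge_mat: "wedge (A *v x) (A *v y) = det A * wedge x y"
  by (simp add: wedge_def mat2_vec det_2 algebra_simps)

lemma wedge_swap: "wedge x y = - wedge y x" by (simp add: wedge_def)

lemma wedge_self [simp]: "wedge x x = 0" by (simp add: wedge_def)

lemma wedge_zero_iff: assumes "x \<noteq> 0" shows "wedge y x = 0 \<longleftrightarrow> (\<exists>c. y = c *s x)"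
proof
  assume w: "wedge y x = 0"
  show "\<exists>c. y = c *s x"
  proof (cases "x$1 = 0")
    case True
    then have "x$2 \<noteq> 0" using assms by (simp add: vec2_eq_iff)
    then show ?thesis using w True by (intro exI[of _ "y$2 / x$2"]) (simp add: vec2_eq_iff wedge_def)
  next
    case False
    then show ?thesis using w by (intro exI[of _ "y$1 / x$1"]) (simp add: vec2_eq_iff wedge_def field_simps)
  qed
qed (auto simp: wedge_def)

lemma wedge_trans: "x \<noteq> 0 \<Longrightarrow> wedge y x = 0 \<Longrightarrow> wedge z x = 0 \<Longrightarrow> wedge y z = 0"
  using wedge_zero_iff[of x y] wedge_zero_iff[of x z] by (auto simp: wedge_def)

lemma minv_wedge: "det A \<noteq> 0 \<Longrightarrow> wedge (minv A *v z) p * det A = wedge z (A *v p)"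
  using wedge_mat[of A "minv A *v z" p] by (simp add: matrix_vector_mul_assoc minv_right mult.commute)

section \<open>Congruence subgroups\<close>

definition vr_ideal :: "'k::field set \<Rightarrow> 'k set \<Rightarrow> bool" where
  "vr_ideal V J \<longleftrightarrow> J \<subseteq> max_ideal V \<and> 0 \<in> J \<and> (\<forall>x\<in>J. \<forall>y\<in>J. x + y \<in> J) \<and> (\<forall>x\<in>J. \<forall>v\<in>V. x * v \<in> J)"

lemma vr_ideal_max: "valuation_ring V \<Longrightarrow> vr_ideal V (max_ideal V)"
  using max_ideal_add max_ideal_mult max_ideal_zero unfolding vr_ideal_def by blast

text \<open>For nonzero \<open>d\<close> this is the largest ideal not containing \<open>d\<close>:
  a unit multiple of \<open>d\<close> is nonzero modulo it. It replaces the next power of a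
  uniformizer in a valuation ring that may not be discrete.\<close>

lemma vr_ideal_times:
  assumes V: "valuation_ring V" and d: "d \<in> V" shows "vr_ideal V ((*) d ` max_ideal V)"
  unfolding vr_ideal_def
proof (intro conjI ballI)
  show "(*) d ` max_ideal V \<subseteq> max_ideal V" using max_ideal_mult(2)[OF V _ d] by blast
  show "0 \<in> (*) d ` max_ideal V" using max_ideal_zero[OF V] by (intro image_eqI[of _ _ 0]) auto
  fix x assume "x \<in> (*) d ` max_ideal V"
  then obtain a where a: "x = d * a" "a \<in> max_ideal V" by blast
  { fix y assume "y \<in> (*) d ` max_ideal V"
    then obtain b where b: "y = d * b" "b \<in> max_ideal V" by blast
    show "x + y \<in> (*) d ` max_ideal V"
      using a b max_ideal_add[OF V a(2) b(2)] by (intro image_eqI[of _ _ "a + b"]) (auto simp: algebra_simps) }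
  { fix v assume "v \<in> V"
    then have "a * v \<in> max_ideal V" by (rule max_ideal_mult(1)[OF V a(2)])
    moreover have "x * v = d * (a * v)" using a by simp
    ultimately show "x * v \<in> (*) d ` max_ideal V" by blast }
qed

definition mat_in :: "'k::field set \<Rightarrow> 'k^2^2 \<Rightarrow> bool" where
  "mat_in V A \<longleftrightarrow> (\<forall>i j. A$i$j \<in> V)"

definition vec_in :: "'k::field set \<Rightarrow> 'k^2 \<Rightarrow> bool" where
  "vec_in V x \<longleftrightarrow> (\<forall>i. x$i \<in> V)"

lemma mat_in_2: "mat_in V A \<longleftrightarrow> A$1$1 \<in> V \<and> A$1$2 \<in> V \<and> A$2$1 \<in> V \<and> A$2$2 \<in> V"
  by (auto simp: mat_in_def forall_2)

lemma vec_in_2: "vec_in V x \<longleftrightarrow> x$1 \<in> V \<and> x$2 \<in> V"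
  by (auto simp: vec_in_def forall_2)

definition gl_in :: "'k::field set \<Rightarrow> 'k^2^2 \<Rightarrow> bool" where
  "gl_in V A \<longleftrightarrow> mat_in V A \<and> det A \<noteq> 0 \<and> inverse (det A) \<in> V"

text \<open>The matrices in GL2 over \<open>V\<close> whose reduction modulo \<open>J\<close> is
  scalar, a congruence subgroup for the projective group.\<close>

definition congruent_scalar :: "'k::field set \<Rightarrow> 'k set \<Rightarrow> 'k^2^2 \<Rightarrow> bool" where
  "congruent_scalar V J A \<longleftrightarrow> gl_in V A \<and> A$1$2 \<in> J \<and> A$2$1 \<in> J \<and> A$1$1 - A$2$2 \<in> J"

lemma congruent_scalar_mono: "congruent_scalar V I A \<Longrightarrow> I \<subseteq> J \<Longrightarrow> congruent_scalar V J A"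
  unfolding congruent_scalar_def by blast

context
  fixes V :: "'k::field set"
  assumes V: "subring_of_field V"
begin

lemma mat_in_mult: "mat_in V A \<Longrightarrow> mat_in V B \<Longrightarrow> mat_in V (A ** B)"
  unfolding mat_in_2 by (simp add: mat2_mult sr_add[OF V] sr_mult[OF V])

lemma mat_in_vec: "mat_in V A \<Longrightarrow> vec_in V x \<Longrightarrow> vec_in V (A *v x)"
  unfolding mat_in_2 vec_in_2 by (simp add: mat2_vec sr_add[OF V] sr_mult[OF V])

lemma det_in: "mat_in V A \<Longrightarrow> det A \<in> V"
  unfolding mat_in_2 by (simp add: det_2 sr_diff[OF V] sr_mult[OF V])

lemma wedge_in: "vec_in V x \<Longrightarrow> vec_in V y \<Longrightarrow> wedge x y \<in> V"
  unfolding vec_in_2 by (simp add: wedge_def sr_diff[OF V] sr_mult[OF V])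

lemma gl_in_one: "gl_in V (mat 1)"
  unfolding gl_in_def mat_in_2 by (simp add: mat2_mat sr_one[OF V] sr_zero[OF V])

lemma gl_in_mult: "gl_in V A \<Longrightarrow> gl_in V B \<Longrightarrow> gl_in V (A ** B)"
  unfolding gl_in_def using mat_in_mult sr_mult[OF V] by (simp add: det_mul)

lemma gl_in_minv: "gl_in V A \<Longrightarrow> gl_in V (minv A)"
  unfolding gl_in_def using det_in[of A]
  by (auto simp: mat_in_2 minv_entries det_minv divide_inverse intro: sr_mult[OF V] sr_minus[OF V])

lemma gl_in_mpow: "gl_in V A \<Longrightarrow> gl_in V (mpow A n)"
  by (induction n) (auto intro: gl_in_one gl_in_mult)

end

context
  fixes V :: "'k::field set" and J
  assumes V: "valuation_ring V" and J: "vr_ideal V J"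
begin

private lemma sV: "subring_of_field V" using vr_subring[OF V] .

lemma ideal_zero: "0 \<in> J" and ideal_add: "x \<in> J \<Longrightarrow> y \<in> J \<Longrightarrow> x + y \<in> J"
  and ideal_mult: "x \<in> J \<Longrightarrow> v \<in> V \<Longrightarrow> x * v \<in> J" and ideal_max: "x \<in> J \<Longrightarrow> x \<in> max_ideal V"
  using J unfolding vr_ideal_def by auto

lemma ideal_mult': "x \<in> J \<Longrightarrow> v \<in> V \<Longrightarrow> v * x \<in> J"
  using ideal_mult[of x v] by (simp add: mult.commute)

lemma ideal_minus: "x \<in> J \<Longrightarrow> - x \<in> J"
  using ideal_mult[of x "- 1"] sr_minus[OF sV sr_one[OF sV]] by simp

lemma ideal_diff: "x \<in> J \<Longrightarrow> y \<in> J \<Longrightarrow> x - y \<in> J"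
  using ideal_add[OF _ ideal_minus] by fastforce

lemma congruent_scalar_one: "congruent_scalar V J (mat 1)"
  unfolding congruent_scalar_def using gl_in_one[OF sV] ideal_zero by (simp add: mat2_mat)

lemma congruent_scalar_mult:
  assumes A: "congruent_scalar V J A" and B: "congruent_scalar V J B"
  shows "congruent_scalar V J (A ** B)"
proof -
  have a: "A$1$1 \<in> V" "A$1$2 \<in> V" "A$2$1 \<in> V" "A$2$2 \<in> V" "A$1$2 \<in> J" "A$2$1 \<in> J" "A$1$1 - A$2$2 \<in> J"
    and b: "B$1$1 \<in> V" "B$1$2 \<in> V" "B$2$1 \<in> V" "B$2$2 \<in> V" "B$1$2 \<in> J" "B$2$1 \<in> J" "B$1$1 - B$2$2 \<in> J"
    using A B unfolding congruent_scalar_def gl_in_def mat_in_2 by auto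
  have "(A ** B)$1$2 \<in> J" "(A ** B)$2$1 \<in> J"
    unfolding mat2_mult using a b by (auto intro!: ideal_add intro: ideal_mult ideal_mult')
  moreover have "(A ** B)$1$1 - (A ** B)$2$2 =
     (A$1$1 - A$2$2) * B$1$1 + A$2$2 * (B$1$1 - B$2$2) + A$1$2 * B$2$1 - A$2$1 * B$1$2"
    by (simp add: mat2_mult algebra_simps)
  then have "(A ** B)$1$1 - (A ** B)$2$2 \<in> J"
    using a b by (auto intro!: ideal_add ideal_diff intro: ideal_mult ideal_mult')
  ultimately show ?thesis using A B gl_in_mult[OF sV] unfolding congruent_scalar_def by blast
qed

lemma congruent_scalar_minv:
  assumes A: "congruent_scalar V J A" shows "congruent_scalar V J (minv A)"
proof -
  have a: "inverse (det A) \<in> V" "A$1$2 \<in> J" "A$2$1 \<in> J" "A$1$1 - A$2$2 \<in> J"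
    using A unfolding congruent_scalar_def gl_in_def by auto
  have "minv A$1$1 - minv A$2$2 = - (A$1$1 - A$2$2) * inverse (det A)"
    by (simp add: minv_entries divide_inverse algebra_simps)
  then show ?thesis using A gl_in_minv[OF sV, of A] a
    unfolding congruent_scalar_def by (auto simp: minv_entries divide_inverse intro!: ideal_mult ideal_minus simp del: minus_diff_eq)
qed

lemma gl_in_det_unit: "gl_in V A \<Longrightarrow> det A \<notin> max_ideal V"
  unfolding gl_in_def using det_in[OF sV] vr_unitI[OF V] by blast

lemma congruent_scalar_unit:
  assumes A: "congruent_scalar V J A" shows "A$2$2 \<in> V" "A$2$2 \<notin> max_ideal V"
proof -
  have a: "A$1$1 \<in> V" "A$1$2 \<in> V" "A$2$1 \<in> V" "A$2$2 \<in> V" "A$1$2 \<in> max_ideal V" "A$2$1 \<in> J" "A$1$1 - A$2$2 \<in> J"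
    using A ideal_max unfolding congruent_scalar_def gl_in_def mat_in_2 by auto
  show "A$2$2 \<in> V" using a by blast
  show "A$2$2 \<notin> max_ideal V"
  proof
    assume "A$2$2 \<in> max_ideal V"
    then have "A$1$1 * A$2$2 - A$1$2 * A$2$1 \<in> max_ideal V"
      using a by (intro max_ideal_diff[OF V] max_ideal_mult(2)[OF V _ a(1)] max_ideal_mult(1)[OF V]) auto
    then show False using gl_in_det_unit A unfolding congruent_scalar_def det_2 by blast
  qed
qed

lemma congruent_scalar_vec:
  assumes A: "congruent_scalar V J A" and x: "vec_in V x"
  shows "vec_in J (A *v x - A$2$2 *s x)"
proof -
  have a: "A$1$2 \<in> J" "A$2$1 \<in> J" "A$1$1 - A$2$2 \<in> J" using A unfolding congruent_scalar_def by auto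
  have "(A *v x - A$2$2 *s x)$1 = (A$1$1 - A$2$2) * x$1 + A$1$2 * x$2"
    "(A *v x - A$2$2 *s x)$2 = A$2$1 * x$1"
    by (simp_all add: mat2_vec algebra_simps)
  then show ?thesis unfolding vec_in_2 using a x[unfolded vec_in_2]
    by (auto intro!: ideal_add intro: ideal_mult)
qed

lemma wedge_ideal: "vec_in J x \<Longrightarrow> vec_in V y \<Longrightarrow> wedge x y \<in> J"
  unfolding vec_in_2 wedge_def by (auto intro!: ideal_diff intro: ideal_mult)

lemma vec_in_ideal_mat: "mat_in V A \<Longrightarrow> vec_in J x \<Longrightarrow> vec_in J (A *v x)"
  unfolding vec_in_2 mat_in_2 by (auto simp: mat2_vec intro!: ideal_add intro: ideal_mult')

text \<open>A factor that is scalar modulo \<open>J\<close> may be replaced by a number inside a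
  word; by \<open>congruent_scalar_unit\<close> this number is a unit.\<close>

lemma wedge_congruent:
  assumes A: "congruent_scalar V J A" and B: "mat_in V B" and x: "vec_in V x" and y: "vec_in V y"
  shows "wedge (B *v (A *v x)) y - A$2$2 * wedge (B *v x) y \<in> J"
proof -
  have "wedge (B *v (A *v x)) y - A$2$2 * wedge (B *v x) y = wedge (B *v (A *v x - A$2$2 *s x)) y"
    by (simp add: wedge_def mat2_vec algebra_simps)
  also have "\<dots> \<in> J"
    by (intro wedge_ideal y vec_in_ideal_mat B congruent_scalar_vec A x)
  finally show ?thesis .
qed

end

lemma congruent_scalar_wedge_unit:
  assumes V: "valuation_ring V" and A: "congruent_scalar V (max_ideal V) A"
    and x: "vec_in V x" and y: "vec_in V y" and w: "wedge x y \<notin> max_ideal V"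
  shows "wedge (A *v x) y \<notin> max_ideal V"
proof -
  note sV = vr_subring[OF V] and M = vr_ideal_max[OF V]
  have "A$2$2 * wedge x y \<notin> max_ideal V"
    using max_ideal_prime[OF V congruent_scalar_unit(1)[OF V M A] wedge_in[OF sV x y]] w
      congruent_scalar_unit(2)[OF V M A] by blast
  moreover have "wedge (A *v x) y - A$2$2 * wedge x y \<in> max_ideal V"
    using wedge_congruent[OF V M A _ x y, of "mat 1"] gl_in_one[OF sV] by (simp add: gl_in_def)
  ultimately show ?thesis using max_ideal_cong_unit[OF V] by blast
qed

text \<open>The eigenvalues are integral over \<open>V\<close>. The discriminant
  \<open>(x - y)\<close> squared lies in the maximal ideal, as does the square of
  \<open>A$2$2 - y\<close>, by the characteristic equation.\<close>

lemma congruent_scalar_eigen: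
  assumes V: "valuation_ring V" and A: "congruent_scalar V (max_ideal V) A" and e: "eigen_pair A x y"
  shows "x \<in> V" "y \<in> V" "x - y \<in> max_ideal V" "x \<notin> max_ideal V" "y \<notin> max_ideal V"
    "A$1$1 - y \<in> max_ideal V" "A$2$2 - y \<in> max_ideal V"
proof -
  note sV = vr_subring[OF V] and M = vr_ideal_max[OF V]
  have a: "A$1$1 \<in> V" "A$2$2 \<in> V" "A$1$2 \<in> max_ideal V" "A$2$1 \<in> max_ideal V" "A$1$1 - A$2$2 \<in> max_ideal V"
    using A unfolding congruent_scalar_def gl_in_def mat_in_2 by auto
  have d: "det A \<in> V" "det A \<notin> max_ideal V"
    using A gl_in_det_unit[OF V M] det_in[OF sV] unfolding congruent_scalar_def gl_in_def by auto
  have t: "A$1$1 + A$2$2 \<in> V" using a sr_add[OF sV] by blast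
  show xV: "x \<in> V" and yV: "y \<in> V" using vr_integral_quadratic[OF V t d(1)] eigen_pair_root[OF e] by auto
  have sq: "z \<in> max_ideal V" if "z \<in> V" "z\<^sup>2 \<in> max_ideal V" for z
    using that max_ideal_power[OF V] by blast
  have "(x - y)\<^sup>2 = (A$1$1 - A$2$2)\<^sup>2 + 4 * (A$1$2 * A$2$1)"
    unfolding eigen_pair_disc[OF e] det_2 by (simp add: power2_eq_square algebra_simps)
  also have "\<dots> \<in> max_ideal V"
    using a max_ideal_subset[OF V] sr_of_nat[OF sV, of 4]
    by (auto simp: power2_eq_square intro!: max_ideal_add[OF V] max_ideal_mult(1)[OF V] max_ideal_mult(2)[OF V])
  finally show xy: "x - y \<in> max_ideal V" using sq sr_diff[OF sV xV yV] by blast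
  show "x \<notin> max_ideal V" "y \<notin> max_ideal V"
    using d(2) e max_ideal_mult(1)[OF V _ yV, of x] max_ideal_mult(2)[OF V _ xV, of y]
    unfolding eigen_pair_def by auto
  have "(A$1$1 - y) * (A$2$2 - y) = A$1$2 * A$2$1"
  proof -
    have "(A$1$1 - y) * (A$2$2 - y) = A$1$1 * A$2$2 - y * (A$1$1 + A$2$2) + y * y" by (simp add: algebra_simps)
    also have "\<dots> = A$1$1 * A$2$2 - y * (x + y) + y * y" using e by (simp add: eigen_pair_def)
    also have "\<dots> = A$1$1 * A$2$2 - x * y" by (simp add: algebra_simps)
    also have "\<dots> = A$1$2 * A$2$1" using e by (simp add: eigen_pair_def det_2)
    finally show ?thesis .
  qed
  then have "(A$2$2 - y)\<^sup>2 = A$1$2 * A$2$1 - (A$1$1 - A$2$2) * (A$2$2 - y)"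
    by (simp add: power2_eq_square algebra_simps)
  also have "\<dots> \<in> max_ideal V"
    using a max_ideal_subset[OF V] yV sr_diff[OF sV a(2) yV]
    by (intro max_ideal_diff[OF V] max_ideal_mult(1)[OF V a(3)] max_ideal_mult(1)[OF V a(5)]) auto
  finally show *: "A$2$2 - y \<in> max_ideal V" using sq sr_diff[OF sV a(2) yV] by blast
  show "A$1$1 - y \<in> max_ideal V" using max_ideal_add[OF V * a(5)] by simp
qed

text \<open>The congruence subgroup of a place of residue characteristic \<open>l\<close> has only \<open>l\<close>-power torsion,
  so two places of different residue characteristics exclude torsion in characteristic zero.\<close>

lemma congruence_torsion:
  fixes A :: "'k::field^2^2"
  assumes V1: "valuation_ring V1" "congruent_scalar V1 (max_ideal V1) A"
    and V2: "valuation_ring V2" "congruent_scalar V2 (max_ideal V2) A"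
    and q: "\<And>q::nat. prime q \<Longrightarrow> of_nat q \<noteq> (0::'k) \<Longrightarrow> of_nat q \<notin> max_ideal V1 \<or> of_nat q \<notin> max_ideal V2"
    and e: "eigen_pair A x y" and j: "j > 0" "homog_sum x y j = 0"
  shows "CHAR('k) > 0 \<and> x = y"
proof -
  define n where "n = (LEAST j. j > 0 \<and> homog_sum x y j = 0)"
  have n: "n > 0" "homog_sum x y n = 0" and min: "\<And>i. i < n \<Longrightarrow> i > 0 \<Longrightarrow> homog_sum x y i \<noteq> 0"
    unfolding n_def using LeastI[of "\<lambda>j. j > 0 \<and> homog_sum x y j = 0" j] j not_less_Least by auto
  have "n \<noteq> 1" using n by auto
  \<comment> \<open>Passing to the r-th powers of the eigenvalues leaves a relation of prime
    exponent \<open>p\<close>, which forces \<open>p\<close> into the maximal ideal of each of the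
    two places.\<close>
  then obtain p where p: "prime p" "p dvd n" using prime_factor_nat by blast
  then obtain r where r: "n = r * p" by (metis dvd_div_mult_self)
  have "r > 0" "r < n" using r n p prime_gt_1_nat[OF p(1)] by auto
  then have Ur: "homog_sum x y r \<noteq> 0" using min by blast
  then have Up: "homog_sum (x ^ r) (y ^ r) p = 0" using n r by (simp add: homog_sum_mult)
  have M: "of_nat p \<in> max_ideal V" if V: "valuation_ring V" "congruent_scalar V (max_ideal V) A" for V
  proof -
    note E = congruent_scalar_eigen[OF V e] and sV = vr_subring[OF V(1)]
    have "x ^ r - y ^ r \<in> max_ideal V"
      using max_ideal_mult(1)[OF V(1) E(3), of "homog_sum x y r"] homog_sum_closed[OF sV E(1,2)]
      by (simp add: homog_sum_diff)
    moreover have "y ^ r \<notin> max_ideal V" using max_ideal_power[OF V(1) E(2)] E(5) by blast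
    ultimately show ?thesis
      using homog_sum_in_max_ideal_iff[OF V(1), of "x ^ r" "y ^ r" p] sr_power[OF sV] E Up max_ideal_zero[OF V(1)]
      by auto
  qed
  have p0: "of_nat p = (0::'k)" using M[OF V1] M[OF V2] q[OF p(1)] by blast
  then have "CHAR('k) dvd p" by (simp add: of_nat_eq_0_iff_char_dvd)
  then have c: "CHAR('k) = p" using p(1) CHAR_not_1[where 'a = 'k] by (metis One_nat_def prime_nat_iff)
  have "x ^ (r * p) - y ^ (r * p) = 0" using n(2) r homog_sum_diff[of x y n] by simp
  \<comment> \<open>In characteristic \<open>p\<close> equal p-th powers have equal bases, so
    \<open>x ^ r = y ^ r\<close>; as \<open>homog_sum x y r\<close> is nonzero by minimality of
    \<open>n\<close>, the eigenvalues coincide.\<close>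
  moreover have "(y ^ r + (x ^ r - y ^ r)) ^ p = (y ^ r) ^ p + (x ^ r - y ^ r) ^ p"
    by (rule freshmans_dream) (use c p(1) in auto)
  then have "(x ^ r) ^ p = (y ^ r) ^ p + (x ^ r - y ^ r) ^ p" by simp
  ultimately have "(x ^ r - y ^ r) ^ p = 0" by (simp add: power_mult)
  then have "(x - y) * homog_sum x y r = 0" by (simp add: homog_sum_diff)
  then show ?thesis using Ur c p(1) prime_gt_0_nat by auto
qed

section \<open>Words separating a point from a finite set\<close>

text \<open>\<open>N\<close> stands for a congruence subgroup containing the word, of which only the
  subgroup properties are kept. The path conditions range over all of \<open>N\<close> and hence
  over all powers of the word. The start \<open>C *v p\<close> is only kept away from
  \<open>E\<close>, since \<open>C\<close> may fix \<open>p\<close>.\<close>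

definition separating_word ::
  "'k::field^2^2 \<Rightarrow> 'k^2^2 \<Rightarrow> 'k^2 \<Rightarrow> ('k^2) set \<Rightarrow> nat \<Rightarrow> nat \<Rightarrow> nat \<Rightarrow> bool" where
  "separating_word A B p E n m k \<longleftrightarrow>
    (\<exists>N. minv (mpow B m) ** (minv (mpow A n) ** (mpow B m ** mpow A k)) \<in> N \<and> mat 1 \<in> N \<and>
      (\<forall>C\<in>N. det C \<noteq> 0 \<and> minv C \<in> N \<and> (\<forall>D\<in>N. C ** D \<in> N)) \<and>
      (\<forall>C\<in>N. (\<forall>e\<in>E. wedge (C *v p) e \<noteq> 0) \<and>
        (\<forall>e\<in>insert p E. wedge (mpow A k *v (C *v p)) e \<noteq> 0 \<and>
          wedge (mpow B m *v (mpow A k *v (C *v p))) e \<noteq> 0 \<and>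
          wedge (minv (mpow A n) *v (mpow B m *v (mpow A k *v (C *v p)))) e \<noteq> 0))) \<and>
    (\<forall>j>0. wedge (mpow (minv (mpow B m) ** (minv (mpow A n) ** (mpow B m ** mpow A k))) j *v p) p \<noteq> 0)"

lemma congruent_scalar_mpow_base:
  assumes V: "valuation_ring V" and J: "vr_ideal V J" and A: "gl_in V A" and e: "eigen_pair A x y"
    and u: "homog_sum x y n \<in> J"
  shows "congruent_scalar V J (mpow A n)"
proof -
  note sV = vr_subring[OF V]
  have a: "A$1$2 \<in> V" "A$2$1 \<in> V" "A$1$1 - A$2$2 \<in> V"
    using A sr_diff[OF sV] unfolding gl_in_def mat_in_2 by auto
  have "mpow A n$1$1 - mpow A n$2$2 = homog_sum x y n * (A$1$1 - A$2$2)"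
    by (simp add: mpow_entries[OF e] algebra_simps)
  then show ?thesis
    unfolding congruent_scalar_def using gl_in_mpow[OF sV A] a u
    by (auto simp: mpow_entries(3,4)[OF e] intro: ideal_mult[OF V J])
qed

text \<open>Each power is a scalar plus its \<open>homog_sum\<close> times the matrix, so
  \<open>b ** a - a ** b\<close> is the product of both sums times \<open>B ** A - A ** B\<close>.
  Multiplication by the inverse of \<open>a ** b\<close> gives the commutator.\<close>

lemma commutator_congruent:
  assumes V: "valuation_ring V" and J: "vr_ideal V J" and A: "gl_in V A" and B: "gl_in V B"
    and ea: "eigen_pair A x y" and eb: "eigen_pair B f g"
    and u: "homog_sum x y n * homog_sum f g m \<in> J"
  shows "congruent_scalar V J (minv (mpow B m) ** (minv (mpow A n) ** (mpow B m ** mpow A n)))"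
proof -
  note sV = vr_subring[OF V]
  define a b where "a = mpow A n" and "b = mpow B m"
  have ga: "gl_in V a" "gl_in V b" unfolding a_def b_def using gl_in_mpow[OF sV] A B by auto
  define W where "W = minv b ** (minv a ** (b ** a))"
  define R where "R = minv b ** minv a"
  define c where "c = homog_sum x y n * homog_sum f g m"
  have gR: "gl_in V R" unfolding R_def using ga gl_in_minv[OF sV] gl_in_mult[OF sV] by blast
  have "R ** (a ** b) = minv b ** ((minv a ** a) ** b)" by (simp add: R_def matrix_mul_assoc)
  also have "\<dots> = mat 1" using ga unfolding gl_in_def by (simp add: minv_left)
  finally have R: "R ** (a ** b) = mat 1" .
  have WR: "W = R ** (b ** a)" by (simp add: W_def R_def matrix_mul_assoc)
  have cm: "(b ** a)$i$j - (a ** b)$i$j = c * ((B ** A)$i$j - (A ** B)$i$j)" for i j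
    using exhaust_2[of i] exhaust_2[of j]
    by (auto simp: a_def b_def c_def mat2_mult mpow_entries[OF ea] mpow_entries[OF eb] algebra_simps)
  have AB: "mat_in V (B ** A)" "mat_in V (A ** B)"
    using A B mat_in_mult[OF sV] unfolding gl_in_def by auto
  have J1: "(b ** a)$i$j - (a ** b)$i$j \<in> J" for i j
    unfolding cm using AB u by (intro ideal_mult[OF V J] sr_diff[OF sV]) (auto simp: c_def mat_in_def)
  have J2: "W$i$j - (mat 1 :: 'a^2^2)$i$j \<in> J" for i j
  proof -
    have "W$i$j - (mat 1 :: 'a^2^2)$i$j = W$i$j - (R ** (a ** b))$i$j" using R by simp
    also have "\<dots> = R$i$1 * ((b ** a)$1$j - (a ** b)$1$j) + R$i$2 * ((b ** a)$2$j - (a ** b)$2$j)"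
      unfolding WR mat2_mult[of R] by (simp add: algebra_simps)
    also have "\<dots> \<in> J" using J1 gR unfolding gl_in_def mat_in_def
      by (intro ideal_add[OF V J] ideal_mult'[OF V J]) auto
    finally show ?thesis .
  qed
  have "W$1$1 - W$2$2 \<in> J" using ideal_diff[OF V J J2[of 1 1] J2[of 2 2]] by (simp add: mat2_mat)
  moreover have "W$1$2 \<in> J" "W$2$1 \<in> J" using J2[of 1 2] J2[of 2 1] by (simp_all add: mat2_mat)
  moreover have "gl_in V W" unfolding W_def using ga gl_in_minv[OF sV] gl_in_mult[OF sV] by blast
  ultimately show ?thesis unfolding congruent_scalar_def W_def a_def b_def by blast
qed

text \<open>With \<open>r = (x / y) ^ n\<close>, the condition that \<open>W ** mpow A n\<close> has
  vanishing discriminant is a polynomial equation of degree two in \<open>r\<close>. Its leading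
  coefficient is nonzero by the trace hypothesis, and distinct parameters give distinct
  \<open>r\<close>.\<close>

lemma finite_double_eigenvalue:
  fixes W :: "'k::field^2^2"
  assumes e: "eigen_pair A x y" and xy: "x \<noteq> y" "x \<noteq> 0" "y \<noteq> 0" and W: "det W = 1"
    and tr: "(W ** A)$1$1 + (W ** A)$2$2 \<noteq> y * (W$1$1 + W$2$2)"
    and inj: "inj_on (\<lambda>t. (x / y) ^ s t) T"
  shows "finite {t\<in>T. ((W ** mpow A (s t))$1$1 + (W ** mpow A (s t))$2$2)\<^sup>2 = 4 * det (W ** mpow A (s t))}"
proof -
  \<comment> \<open>The trace of \<open>W ** mpow A n\<close>, divided by \<open>y ^ n\<close>, is
    the linear function \<open>\<kappa> * r + (\<tau> - \<kappa>)\<close>; the determinant divided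
    by the square of \<open>y ^ n\<close> is \<open>r\<close>.\<close>
  define \<tau> \<kappa> where "\<tau> = W$1$1 + W$2$2" and "\<kappa> = ((W ** A)$1$1 + (W ** A)$2$2 - y * \<tau>) / (x - y)"
  define P where "P = [:(\<tau> - \<kappa>)\<^sup>2, 2 * \<kappa> * (\<tau> - \<kappa>) - 4, \<kappa>\<^sup>2:]"
  have P0: "P \<noteq> 0" unfolding P_def \<kappa>_def using tr xy \<tau>_def by auto
  have root: "poly P ((x / y) ^ n) = 0"
    if "((W ** mpow A n)$1$1 + (W ** mpow A n)$2$2)\<^sup>2 = 4 * det (W ** mpow A n)" for n
  proof -
    define r where "r = (x / y) ^ n"
    have xr: "x ^ n = y ^ n * r" using xy by (simp add: r_def power_divide)
    have k: "\<kappa> * (x - y) = (W ** A)$1$1 + (W ** A)$2$2 - y * \<tau>" using xy by (simp add: \<kappa>_def)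
    have "(W ** mpow A n)$1$1 + (W ** mpow A n)$2$2 = y ^ n * \<tau> + homog_sum x y n * (\<kappa> * (x - y))"
      unfolding k by (simp add: mat2_mult mpow_entries[OF e] \<tau>_def algebra_simps)
    also have "\<dots> = y ^ n * \<tau> + \<kappa> * ((x - y) * homog_sum x y n)" by (simp add: mult_ac)
    also have "\<dots> = y ^ n * (\<kappa> * r + (\<tau> - \<kappa>))" unfolding homog_sum_diff xr by (simp add: algebra_simps)
    finally have t: "(W ** mpow A n)$1$1 + (W ** mpow A n)$2$2 = y ^ n * (\<kappa> * r + (\<tau> - \<kappa>))" .
    have "det (W ** mpow A n) = (y ^ n)\<^sup>2 * r"
    proof -
      have "det A = x * y" using e by (simp add: eigen_pair_def)
      then show ?thesis using W xr by (simp add: det_mul det_mpow power_mult_distrib power2_eq_square)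
    qed
    then have "(y ^ n)\<^sup>2 * (\<kappa> * r + (\<tau> - \<kappa>))\<^sup>2 = (y ^ n)\<^sup>2 * (4 * r)"
      using that unfolding t by (simp add: power_mult_distrib)
    then have "(\<kappa> * r + (\<tau> - \<kappa>))\<^sup>2 - 4 * r = 0" using xy by simp
    moreover have "poly P r = (\<kappa> * r + (\<tau> - \<kappa>))\<^sup>2 - 4 * r"
      by (simp add: P_def power2_eq_square algebra_simps)
    ultimately show ?thesis unfolding r_def by simp
  qed
  let ?B = "{t\<in>T. ((W ** mpow A (s t))$1$1 + (W ** mpow A (s t))$2$2)\<^sup>2 = 4 * det (W ** mpow A (s t))}"
  have "(\<lambda>t. (x / y) ^ s t) ` ?B \<subseteq> {r. poly P r = 0}" using root by blast
  then have "finite ((\<lambda>t. (x / y) ^ s t) ` ?B)" using poly_roots_finite[OF P0] finite_subset by blast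
  moreover have "inj_on (\<lambda>t. (x / y) ^ s t) ?B" using inj by (rule inj_on_subset) auto
  ultimately show ?thesis using finite_imageD by blast
qed

text \<open>The displacement of \<open>mpow A n\<close> is strictly divisible by that of
  \<open>mpow B m\<close>, through the factor \<open>z\<close>. Path conditions are checked at the
  first place alone; the second place serves only to exclude torsion of the word.\<close>

lemma separating_word_exists_core:
  fixes A B :: "'k::alg_closed_field^2^2"
  assumes V1: "valuation_ring V1" and V2: "valuation_ring V2"
    and l: "prime l" "of_nat l \<in> max_ideal V1"
    and q: "\<And>q::nat. prime q \<Longrightarrow> of_nat q \<noteq> (0::'k) \<Longrightarrow> of_nat q \<notin> max_ideal V1 \<or> of_nat q \<notin> max_ideal V2"
    and ea: "eigen_pair A x y" and eb: "eigen_pair B f g"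
    and gl: "gl_in V1 A" "gl_in V1 B" "gl_in V2 A" "gl_in V2 B"
    and xy: "x \<in> V1" "y \<in> V1" "x \<notin> max_ideal V1" "y \<notin> max_ideal V1" "x \<in> V2" "y \<in> V2"
    and xd: "x \<noteq> y \<Longrightarrow> x - y \<notin> max_ideal V1"
    and p: "p \<noteq> 0" "vec_in V1 p" and E: "\<And>e. e \<in> E \<Longrightarrow> vec_in V1 e \<and> wedge p e \<notin> max_ideal V1"
    and wa: "wedge (A *v p) p \<notin> max_ideal V1" and wb: "wedge (B *v p) p \<notin> max_ideal V1"
    and inf: "\<And>n. n > 0 \<Longrightarrow> homog_sum x y n \<noteq> 0"
    and n: "n > 0" "x ^ n - y ^ n \<in> max_ideal V1"
    and n2: "homog_sum x y n \<in> max_ideal V2" and m2: "homog_sum f g m \<in> max_ideal V2"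
    and m1: "homog_sum f g m \<in> max_ideal V1"
    and z: "homog_sum x y n = homog_sum f g m * z" "z \<in> max_ideal V1"
  shows "\<exists>k. separating_word A B p E n m k"
proof -
  note s1 = vr_subring[OF V1] and s2 = vr_subring[OF V2] and M1 = vr_ideal_max[OF V1] and M2 = vr_ideal_max[OF V2]
  define \<delta> \<epsilon> where "\<delta> = homog_sum x y n" and "\<epsilon> = homog_sum f g m"
  have \<delta>0: "\<delta> \<noteq> 0" and \<epsilon>0: "\<epsilon> \<noteq> 0" using inf[OF n(1)] z(1) by (auto simp: \<delta>_def \<epsilon>_def)
  have \<epsilon>V: "\<epsilon> \<in> V1" "\<epsilon> \<in> max_ideal V1" using m1 max_ideal_subset[OF V1] by (auto simp: \<epsilon>_def)
  have \<delta>\<epsilon>: "\<delta> = \<epsilon> * z" using z by (simp add: \<delta>_def \<epsilon>_def)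
  have \<delta>V: "\<delta> \<in> V1" unfolding \<delta>\<epsilon> using sr_mult[OF s1 \<epsilon>V(1)] max_ideal_subset[OF V1 z(2)] by blast
  \<comment> \<open>The word is scalar modulo \<open>I\<close>, whereas \<open>a\<close> moves
    \<open>p\<close> by a unit multiple of \<open>\<delta>\<close>, just outside \<open>I\<close>.
    Likewise \<open>b\<close> moves \<open>p\<close> by a unit multiple of
    \<open>\<epsilon>\<close>, just outside \<open>I2\<close>, and \<open>a\<close> is already
    scalar modulo \<open>I2\<close>.\<close>
  define I I2 where "I = (*) \<delta> ` max_ideal V1" and "I2 = (*) \<epsilon> ` max_ideal V1"
  have I: "vr_ideal V1 I" and I2: "vr_ideal V1 I2"
    unfolding I_def I2_def using vr_ideal_times[OF V1] \<delta>V \<epsilon>V by auto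
  have \<delta>I2: "\<delta> \<in> I2" unfolding I2_def \<delta>\<epsilon> using z(2) by blast
  have II2: "I \<subseteq> I2"
  proof
    fix a assume "a \<in> I"
    then obtain b where b: "a = \<epsilon> * (z * b)" "b \<in> max_ideal V1" unfolding I_def \<delta>\<epsilon> by (auto simp: mult.assoc)
    then show "a \<in> I2" unfolding I2_def
      using max_ideal_mult(1)[OF V1 z(2) max_ideal_subset[OF V1 b(2)]] by blast
  qed
  have I2M: "I2 \<subseteq> max_ideal V1" using I2 unfolding vr_ideal_def by blast
  \<comment> \<open>The form of all displacement estimates below: the product of \<open>c\<close>
    with two units survives an error in \<open>c\<close> times the maximal ideal.\<close>
  have nz: "r \<noteq> 0" if H: "c \<noteq> 0" "u \<notin> max_ideal V1" "r - u * (c * w) \<in> (*) c ` max_ideal V1"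
    "w \<notin> max_ideal V1" "u \<in> V1" "w \<in> V1" for r c u w
  proof
    assume "r = 0"
    obtain b where b: "r - u * (c * w) = c * b" "b \<in> max_ideal V1" using H(3) by blast
    have "c * (- (u * w)) = r - u * (c * w)" using \<open>r = 0\<close> by (simp add: mult_ac)
    then have "c * (- (u * w)) = c * b" using b(1) by simp
    then have "u * w = - b" using H(1) by (metis minus_minus mult_cancel_left)
    then have "u * w \<in> max_ideal V1" using max_ideal_minus[OF V1 \<open>b \<in> max_ideal V1\<close>] by simp
    then show False using max_ideal_prime[OF V1] H by blast
  qed
  have xyn: "x ^ n \<in> V1" "y ^ n \<in> V1" "y ^ n \<notin> max_ideal V1"
    using sr_power[OF s1] max_ideal_power[OF V1] xy by blast+
  \<comment> \<open>The factor \<open>l\<close> is the residue characteristic and puts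
    \<open>homog_sum x y (s t)\<close> into \<open>I\<close> instead of merely making it a multiple
    of \<open>\<delta>\<close>; \<open>t\<close> remains free.\<close>
  define s where "s t = n * (l * t)" for t :: nat
  have U1: "homog_sum x y (s t) \<in> I" for t
  proof -
    have "of_nat (l * t) \<in> max_ideal V1"
      using max_ideal_mult(1)[OF V1 l(2) sr_of_nat[OF s1, of t]] by simp
    then have "homog_sum (x ^ n) (y ^ n) (l * t) \<in> max_ideal V1"
      using homog_sum_in_max_ideal_iff[OF V1 xyn(1,2) n(2) xyn(3)] by blast
    then show ?thesis unfolding s_def homog_sum_mult[of x y n] I_def \<delta>_def by blast
  qed
  have U2: "homog_sum x y (s t) \<in> max_ideal V2" for t
    unfolding s_def homog_sum_mult[of x y n]
    by (intro max_ideal_mult(1)[OF V2 n2] homog_sum_closed[OF s2] sr_power[OF s2] xy)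
  define a b where "a = mpow A n" and "b = mpow B m"
  define W where "W = minv b ** (minv a ** (b ** a))"
  define v where "v t = minv b ** (minv a ** (b ** mpow A (n + s t)))" for t
  have vW: "v t = W ** mpow A (s t)" for t
    by (simp add: v_def W_def mpow_add a_def matrix_mul_assoc)
  have As1: "congruent_scalar V1 I (mpow A (s t))" and As2: "congruent_scalar V2 (max_ideal V2) (mpow A (s t))" for t
    using congruent_scalar_mpow_base[OF V1 I gl(1) ea U1] congruent_scalar_mpow_base[OF V2 M2 gl(3) ea U2] by auto
  have a1: "congruent_scalar V1 I2 a" and a2: "congruent_scalar V2 (max_ideal V2) a"
    unfolding a_def using congruent_scalar_mpow_base[OF V1 I2 gl(1) ea] \<delta>I2 \<delta>_def
      congruent_scalar_mpow_base[OF V2 M2 gl(3) ea n2] by auto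
  have b1: "congruent_scalar V1 (max_ideal V1) b" and b2: "congruent_scalar V2 (max_ideal V2) b"
    unfolding b_def using congruent_scalar_mpow_base[OF V1 M1 gl(2) eb m1]
      congruent_scalar_mpow_base[OF V2 M2 gl(4) eb m2] by auto
  have a1M: "congruent_scalar V1 (max_ideal V1) a" using congruent_scalar_mono[OF a1 I2M] .
  have da: "det a \<noteq> 0" "det b \<noteq> 0" using a1 b1 unfolding congruent_scalar_def gl_in_def by auto
  have "\<delta> * \<epsilon> \<in> I" using \<epsilon>V(2) unfolding I_def by blast
  then have W1: "congruent_scalar V1 I W"
    unfolding W_def a_def b_def using commutator_congruent[OF V1 I gl(1,2) ea eb] \<delta>_def \<epsilon>_def by blast
  have W2: "congruent_scalar V2 (max_ideal V2) W"
    unfolding W_def using a2 b2 congruent_scalar_mult[OF V2 M2] congruent_scalar_minv[OF V2 M2] by blast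
  have v1: "congruent_scalar V1 I (v t)" and v2: "congruent_scalar V2 (max_ideal V2) (v t)" for t
    unfolding vW using congruent_scalar_mult[OF V1 I W1 As1] congruent_scalar_mult[OF V2 M2 W2 As2] by auto
  have detW: "det W = 1" unfolding W_def using da by (simp add: det_mul det_minv)

  have mi: "mat_in V1 a" "mat_in V1 b" "mat_in V1 B" "mat_in V1 A"
    using a1 b1 gl unfolding congruent_scalar_def gl_in_def by auto
  have path: "(\<forall>e\<in>E. wedge (C *v p) e \<noteq> 0) \<and>
        (\<forall>e\<in>insert p E. wedge (mpow A (n + s t) *v (C *v p)) e \<noteq> 0 \<and>
          wedge (b *v (mpow A (n + s t) *v (C *v p))) e \<noteq> 0 \<and>
          wedge (minv a *v (b *v (mpow A (n + s t) *v (C *v p)))) e \<noteq> 0)"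
    if C: "congruent_scalar V1 I C" for C t
  proof -
    define D where "D = mpow A (s t) ** C"
    have D: "congruent_scalar V1 I D" unfolding D_def using congruent_scalar_mult[OF V1 I As1 C] .
    have D2: "congruent_scalar V1 I2 D" and CM: "congruent_scalar V1 (max_ideal V1) C"
      using congruent_scalar_mono[OF D II2] congruent_scalar_mono[OF D] congruent_scalar_mono[OF C] II2 I2M by auto
    have eq: "mpow A (n + s t) *v (C *v p) = a *v (D *v p)"
      by (simp add: a_def D_def mpow_add matrix_vector_mul_assoc matrix_mul_assoc)
    \<comment> \<open>The points of \<open>E\<close> differ from \<open>p\<close> already modulo the
      maximal ideal, where every letter of the word is scalar.\<close>
    have unitE: "wedge (R *v p) e \<noteq> 0" if "congruent_scalar V1 (max_ideal V1) R" "e \<in> E" for R e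
      using congruent_scalar_wedge_unit[OF V1 that(1) p(2)] E[OF that(2)] max_ideal_zero[OF V1] by metis
    have w1: "wedge (a *v (D *v p)) p \<noteq> 0"
    proof (rule nz[OF \<delta>0])
      have "wedge (a *v p) p = \<delta> * wedge (A *v p) p" unfolding a_def \<delta>_def by (rule wedge_mpow[OF ea])
      then show "wedge (a *v (D *v p)) p - D$2$2 * (\<delta> * wedge (A *v p) p) \<in> (*) \<delta> ` max_ideal V1"
        using wedge_congruent[OF V1 I D mi(1) p(2) p(2)] unfolding I_def by simp
    qed (use congruent_scalar_unit[OF V1 I D] wa wedge_in[OF s1 mat_in_vec[OF s1 mi(4) p(2)] p(2)] in auto)
    have aD: "congruent_scalar V1 I2 (a ** D)" using congruent_scalar_mult[OF V1 I2 a1 D2] .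
    have w2: "wedge (b *v (a *v (D *v p))) p \<noteq> 0"
    proof (rule nz[OF \<epsilon>0])
      have "wedge (b *v p) p = \<epsilon> * wedge (B *v p) p" unfolding b_def \<epsilon>_def by (rule wedge_mpow[OF eb])
      then show "wedge (b *v (a *v (D *v p))) p - (a ** D)$2$2 * (\<epsilon> * wedge (B *v p) p) \<in> (*) \<epsilon> ` max_ideal V1"
        using wedge_congruent[OF V1 I2 aD mi(2) p(2) p(2)] unfolding I2_def
        by (simp add: matrix_vector_mul_assoc)
    qed (use congruent_scalar_unit[OF V1 I2 aD] wb wedge_in[OF s1 mat_in_vec[OF s1 mi(3) p(2)] p(2)] in auto)
    \<comment> \<open>Applying \<open>a\<close> to both points reduces this to \<open>b\<close>
      moving \<open>r = a *v p\<close>. The inner factor \<open>D\<close> turns into its conjugate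
      \<open>F\<close>, which is scalar modulo \<open>I2\<close>.\<close>
    have w3: "wedge (minv a *v (b *v (a *v (D *v p)))) p \<noteq> 0"
    proof -
      define r where "r = a *v p"
      define F where "F = a ** D ** minv a"
      have rV: "vec_in V1 r" unfolding r_def using mat_in_vec[OF s1 mi(1) p(2)] .
      have F: "congruent_scalar V1 I2 F"
        unfolding F_def using congruent_scalar_mult[OF V1 I2 aD congruent_scalar_minv[OF V1 I2 a1]] .
      have "F ** a = a ** (D ** (minv a ** a))" by (simp add: F_def matrix_mul_assoc)
      then have "F ** a = a ** D" using da by (simp add: minv_left)
      then have Fr: "F *v r = a *v (D *v p)" by (simp add: r_def matrix_vector_mul_assoc)
      have BpV: "vec_in V1 (B *v p)" using mat_in_vec[OF s1 mi(3) p(2)] .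
      have "wedge p (B *v p) \<notin> max_ideal V1" using wb wedge_swap[of p "B *v p"] max_ideal_minus[OF V1] by fastforce
      then have "wedge r (B *v p) \<notin> max_ideal V1"
        unfolding r_def using congruent_scalar_wedge_unit[OF V1 a1M p(2) BpV] by blast
      then have u1: "wedge (B *v p) r \<notin> max_ideal V1"
        using wedge_swap[of r "B *v p"] max_ideal_minus[OF V1] by fastforce
      have "wedge (B *v r) r - a$2$2 * wedge (B *v p) r \<in> max_ideal V1"
        unfolding r_def using wedge_congruent[OF V1 M1 a1M mi(3) p(2) mat_in_vec[OF s1 mi(1) p(2)]] .
      moreover have "a$2$2 * wedge (B *v p) r \<notin> max_ideal V1"
        using max_ideal_prime[OF V1 congruent_scalar_unit(1)[OF V1 M1 a1M] wedge_in[OF s1 BpV rV]]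
          congruent_scalar_unit(2)[OF V1 M1 a1M] u1 by blast
      ultimately have u2: "wedge (B *v r) r \<notin> max_ideal V1" using max_ideal_cong_unit[OF V1] by blast
      have "wedge (b *v (F *v r)) r \<noteq> 0"
      proof (rule nz[OF \<epsilon>0])
        have "wedge (b *v r) r = \<epsilon> * wedge (B *v r) r" unfolding b_def \<epsilon>_def by (rule wedge_mpow[OF eb])
        then show "wedge (b *v (F *v r)) r - F$2$2 * (\<epsilon> * wedge (B *v r) r) \<in> (*) \<epsilon> ` max_ideal V1"
          using wedge_congruent[OF V1 I2 F mi(2) rV rV] unfolding I2_def by simp
      qed (use congruent_scalar_unit[OF V1 I2 F] u2 wedge_in[OF s1 mat_in_vec[OF s1 mi(3) rV] rV] in auto)
      then have "wedge (minv a *v (b *v (a *v (D *v p)))) p * det a \<noteq> 0"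
        unfolding minv_wedge[OF da(1)] Fr by (simp add: r_def)
      then show ?thesis by simp
    qed
    have aDM: "congruent_scalar V1 (max_ideal V1) (a ** D)" using congruent_scalar_mono[OF aD I2M] .
    have "congruent_scalar V1 (max_ideal V1) (b ** (a ** D))"
      "congruent_scalar V1 (max_ideal V1) (minv a ** (b ** (a ** D)))"
      using congruent_scalar_mult[OF V1 M1] congruent_scalar_minv[OF V1 M1 a1M] b1 aDM by blast+
    then show ?thesis unfolding eq using unitE CM aDM w1 w2 w3
      by (auto simp: matrix_vector_mul_assoc matrix_mul_assoc)
  qed

  have inf': "x ^ i \<noteq> y ^ i" if "x \<noteq> y" "i > 0" for i
    using inf[OF that(2)] homog_sum_diff[of x y i] that by auto
  have x0: "x \<noteq> 0" "y \<noteq> 0" using vr_unit_nonzero[OF V1] xy by auto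
  have s_mono: "s t < s t'" if "t < t'" for t t' unfolding s_def using that n l prime_gt_0_nat by auto
  \<comment> \<open>The bad parameters: those for which the word fixes \<open>p\<close>, and those
    giving a double eigenvalue in positive characteristic, where such a matrix has finite order
    modulo scalars.\<close>
  define T1 where "T1 = {t. wedge (v t *v p) p = 0}"
  define T2 where "T2 = {t. CHAR('k) > 0 \<and> ((v t)$1$1 + (v t)$2$2)\<^sup>2 = 4 * det (v t)}"
  \<comment> \<open>If two words fix \<open>p\<close>, the common factor \<open>W\<close> cancels
    and a positive power of \<open>A\<close> fixes \<open>p\<close>.\<close>
  have "t = t'" if "t \<in> T1" "t' \<in> T1" for t t'
  proof -
    have F: False if T: "t \<in> T1" "t' \<in> T1" and "t < t'" for t t'
    proof -
      obtain i where i: "s t' = s t + i" "i > 0" using less_imp_add_positive[OF s_mono[OF \<open>t < t'\<close>]] by metis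
      have "wedge (v t *v p) (v t' *v p) = 0" using wedge_trans[OF p(1)] T unfolding T1_def by blast
      then have "wedge (mpow A (s t) *v p) (mpow A (s t') *v p) = 0"
        using wedge_mat[of W "mpow A (s t) *v p" "mpow A (s t') *v p"] detW
        unfolding vW by (simp add: matrix_vector_mul_assoc)
      then have "wedge (mpow A (s t) *v p) (mpow A (s t) *v (mpow A i *v p)) = 0"
        by (simp add: i mpow_add matrix_vector_mul_assoc)
      then have "wedge (mpow A i *v p) p = 0"
        using wedge_swap[of p] As1[of t] unfolding wedge_mat congruent_scalar_def gl_in_def by auto
      then show False using wedge_mpow[OF ea, of i p] inf[OF i(2)] wa max_ideal_zero[OF V1] by auto
    qed
    show ?thesis using F[of t t'] F[of t' t] that by (metis nat_neq_iff)
  qed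
  then have T1: "finite T1" by (metis finite.emptyI finite_insert finite_subset insertI1 singletonI subsetI)
  have T2: "finite T2"
  proof (cases "CHAR('k) > 0")
    case False
    then show ?thesis unfolding T2_def by simp
  next
    case True
    have ne: "x \<noteq> y"
    proof
      assume "x = y"
      then have "homog_sum x y (CHAR('k)) = 0"
        using homog_sum_same[of x "CHAR('k) - 1"] True by (simp del: of_nat_Suc)
      then show False using inf[OF True] by blast
    qed
    have inj: "inj_on (\<lambda>t. (x / y) ^ s t) UNIV"
    proof (rule linorder_inj_onI)
      fix t t' :: nat assume "t < t'"
      then obtain i where i: "s t' = s t + i" "i > 0" using less_imp_add_positive[OF s_mono[OF \<open>t < t'\<close>]] by metis
      have "(x / y) ^ i \<noteq> 1" using inf'[OF ne i(2)] x0 by (auto simp: power_divide)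
      then show "(x / y) ^ s t \<noteq> (x / y) ^ s t'" using x0 by (simp add: i power_add)
    qed auto
    \<comment> \<open>Modulo the maximal ideal \<open>W\<close> is scalar, so the difference of the
      two sides is a unit times \<open>x - y\<close>, itself a unit by \<open>xd\<close>.\<close>
    have tr: "(W ** A)$1$1 + (W ** A)$2$2 \<noteq> y * (W$1$1 + W$2$2)"
    proof
      assume eq: "(W ** A)$1$1 + (W ** A)$2$2 = y * (W$1$1 + W$2$2)"
      have w: "W$1$2 \<in> max_ideal V1" "W$2$1 \<in> max_ideal V1" "W$1$1 - W$2$2 \<in> max_ideal V1"
        "W$2$2 \<in> V1" "W$2$2 \<notin> max_ideal V1"
        using W1 II2 I2M congruent_scalar_unit[OF V1 I W1] unfolding congruent_scalar_def by auto
      have xy_tr: "x + y = A$1$1 + A$2$2" using ea by (simp add: eigen_pair_def)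
      have "W$2$2 * (x - y) = W$2$2 * (x + y) - 2 * y * W$2$2" by (simp add: algebra_simps)
      then have "W$2$2 * (x - y) = W$2$2 * (A$1$1 + A$2$2) - 2 * y * W$2$2" unfolding xy_tr .
      also have "\<dots> = - ((W$1$1 - W$2$2) * (A$1$1 - y) + W$1$2 * A$2$1 + W$2$1 * A$1$2)"
        using eq by (simp add: mat2_mult algebra_simps)
      also have "\<dots> \<in> max_ideal V1"
        using w mi(4)[unfolded mat_in_2] xy(2)
        by (intro max_ideal_minus[OF V1] max_ideal_add[OF V1] max_ideal_mult(1)[OF V1] sr_diff[OF s1]) auto
      finally show False
        using max_ideal_prime[OF V1 w(4) sr_diff[OF s1 xy(1,2)]] w(5) xd[OF ne] by blast
    qed
    show ?thesis unfolding T2_def vW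
      using finite_double_eigenvalue[OF ea ne x0 detW tr inj] by (rule rev_finite_subset) auto
  qed
  obtain t where t: "t \<notin> T1 \<union> T2" using T1 T2 ex_new_if_finite[OF infinite_UNIV_nat] by blast
  \<comment> \<open>As the word moves \<open>p\<close>, a power fixing \<open>p\<close> would have
    vanishing \<open>homog_sum\<close>. \<open>congruence_torsion\<close> then leaves only the
    double eigenvalues excluded through \<open>T2\<close>.\<close>
  have inf_order: "wedge (mpow (v t) j *v p) p \<noteq> 0" if "j > 0" for j
  proof
    obtain X Y where XY: "eigen_pair (v t) X Y" using eigen_pair_exists by blast
    assume "wedge (mpow (v t) j *v p) p = 0"
    then have "homog_sum X Y j = 0" using t unfolding wedge_mpow[OF XY] T1_def by auto
    then have "CHAR('k) > 0" "X = Y"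
      using congruence_torsion[OF V1 _ V2 v2 q XY \<open>j > 0\<close>] congruent_scalar_mono[OF v1] II2 I2M by blast+
    then show False using t eigen_pair_disc[OF XY] unfolding T2_def by auto
  qed
  have "separating_word A B p E n m (n + s t)"
    unfolding separating_word_def a_def[symmetric] b_def[symmetric] v_def[symmetric]
  proof (intro conjI exI[of _ "Collect (congruent_scalar V1 I)"] ballI allI impI)
    fix C D assume "C \<in> Collect (congruent_scalar V1 I)" "D \<in> Collect (congruent_scalar V1 I)"
    then show "C ** D \<in> Collect (congruent_scalar V1 I)" using congruent_scalar_mult[OF V1 I] by blast
  qed (use v1 inf_order path congruent_scalar_minv[OF V1 I] congruent_scalar_one[OF V1 I]
     in \<open>auto simp: congruent_scalar_def gl_in_def\<close>)
  then show ?thesis by blast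
qed

section \<open>Choice of the places and exponents\<close>

lemma common_root_of_unity_exponent:
  assumes V: "valuation_ring V" and A: "subring_of_field A" "A \<subseteq> V" "finite_residue A V"
    and S: "finite S" "S \<subseteq> A" "S \<inter> max_ideal V = {}"
  shows "\<exists>L>0. \<forall>s\<in>S. s ^ L - 1 \<in> max_ideal V"
  using S
proof (induction S)
  case (insert a S)
  then obtain L where L: "L > 0" "\<forall>s\<in>S. s ^ L - 1 \<in> max_ideal V" by auto
  obtain K where K: "K > 0" "a ^ K - 1 \<in> max_ideal V"
    using finite_residue_root_of_unity[OF V A, of a] insert by auto
  have pw: "s ^ (i * j) - 1 \<in> max_ideal V" if "s ^ i - 1 \<in> max_ideal V" "s \<in> A" for s i j
  proof -
    have "homog_sum (s ^ i) 1 j \<in> V"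
      using that(2) A(2) homog_sum_closed[OF vr_subring[OF V]] sr_power[OF vr_subring[OF V]] sr_one[OF vr_subring[OF V]]
      by (meson subsetD)
    then have "(s ^ i - 1) * homog_sum (s ^ i) 1 j \<in> max_ideal V" using max_ideal_mult(1)[OF V that(1)] by blast
    then show ?thesis by (simp add: homog_sum_diff power_mult)
  qed
  have "\<forall>s\<in>insert a S. s ^ (K * L) - 1 \<in> max_ideal V"
    using pw[OF K(2), of L] pw[of _ L K] L(2) insert.prems by (auto simp: mult.commute[of L K])
  then show ?case using K L by (intro exI[of _ "K * L"]) auto
qed auto

lemma residue_prime_unique:
  assumes V: "valuation_ring V" and p: "prime (p::nat)" "of_nat p \<in> max_ideal V"
    and q: "prime (q::nat)" "of_nat q \<in> max_ideal V"
  shows "p = q"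
proof (rule ccontr)
  assume "p \<noteq> q"
  then have "coprime (int p) (int q)" using p q by (simp add: primes_coprime)
  then obtain u w where "u * int p + w * int q = 1" using bezout_int[of "int p" "int q"] by auto
  then have "of_int u * of_nat p + of_int w * of_nat q = (1::'a)"
    by (metis of_int_1 of_int_add of_int_mult of_int_of_nat_eq)
  moreover have "of_int u * of_nat p + of_int w * of_nat q \<in> max_ideal V"
    using sr_of_int[OF vr_subring[OF V]] by (intro max_ideal_add[OF V] max_ideal_mult(2)[OF V] p q)
  ultimately show False using max_ideal_one[OF V] by simp
qed

text \<open>The last assertion says that the residue characteristics of the two places differ, unless the
  field has positive characteristic.\<close>

lemma two_places:
  assumes S: "finite (S :: 'k::field set)"
  obtains A1 V1 l A2 V2 where
    "subring_of_field A1" "valuation_ring V1" "A1 \<subseteq> V1" "finite_residue A1 V1"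
    "S \<subseteq> A1" "inverse ` S \<subseteq> A1" "prime (l::nat)" "of_nat l \<in> max_ideal V1"
    "subring_of_field A2" "valuation_ring V2" "A2 \<subseteq> V2" "finite_residue A2 V2"
    "S \<subseteq> A2" "inverse ` S \<subseteq> A2"
    "\<And>q::nat. prime q \<Longrightarrow> of_nat q \<noteq> (0::'k) \<Longrightarrow> of_nat q \<notin> max_ideal V1 \<or> of_nat q \<notin> max_ideal V2"
proof -
  obtain A1 V1 where 1: "subring_of_field A1" "valuation_ring V1" "A1 \<subseteq> V1" "finite_residue A1 V1"
    "S - {0} \<subseteq> A1" "inverse ` (S - {0}) \<subseteq> A1"
    by (rule finite_residue_place[of "S - {0}"]) (use S in auto)
  obtain l :: nat where l: "prime l" "of_nat l \<in> max_ideal V1"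
    using finite_residue_prime[OF 1(2,1,3,4)] by blast
  \<comment> \<open>Including \<open>of_nat l\<close>, unless it is zero in the field, makes it a
    unit at the second place, so the residue characteristics differ.\<close>
  obtain A2 V2 where 2: "subring_of_field A2" "valuation_ring V2" "A2 \<subseteq> V2" "finite_residue A2 V2"
    "insert (of_nat l) S - {0} \<subseteq> A2" "inverse ` (insert (of_nat l) S - {0}) \<subseteq> A2"
    by (rule finite_residue_place[of "insert (of_nat l) S - {0}"]) (use S in auto)
  have z: "S \<subseteq> A1" "inverse ` S \<subseteq> A1" "S \<subseteq> A2" "inverse ` S \<subseteq> A2"
  proof -
    have "inverse ` (S - {0}) \<subseteq> inverse ` (insert (of_nat l) S - {0})" by auto
    then have "inverse ` (S - {0}) \<subseteq> A2" using 2(6) by (rule order_trans)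
    then have "insert 0 (inverse ` (S - {0})) \<subseteq> A1" "insert 0 (inverse ` (S - {0})) \<subseteq> A2"
      using 1(6) sr_zero[OF 1(1)] sr_zero[OF 2(1)] by simp_all
    moreover have "inverse ` S \<subseteq> insert 0 (inverse ` (S - {0}))" by auto
    ultimately show "inverse ` S \<subseteq> A1" "inverse ` S \<subseteq> A2" by (simp_all add: subset_trans)
    have "S - {0} \<subseteq> A2" using 2(5) by auto
    then show "S \<subseteq> A1" "S \<subseteq> A2"
      using 1(5) sr_zero[OF 1(1)] sr_zero[OF 2(1)] by (auto simp: subset_iff)
  qed
  have "of_nat q \<notin> max_ideal V1 \<or> of_nat q \<notin> max_ideal V2" if q: "prime q" "of_nat q \<noteq> (0::'k)" for q :: nat
  proof (rule ccontr)
    assume c: "\<not> ?thesis"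
    then have "of_nat q \<in> max_ideal V1" "of_nat q \<in> max_ideal V2" by simp_all
    with residue_prime_unique[OF 1(2) q(1) _ l] have l': "of_nat l \<noteq> (0::'k)" "of_nat l \<in> max_ideal V2"
      using q(2) by auto
    then have "inverse (of_nat l) \<in> inverse ` (insert (of_nat l) S - {0})" by simp
    then have "inverse (of_nat l) \<in> V2" using 2(3,6) by (meson subsetD)
    with max_ideal_inverse[OF 2(2) l'(2,1)] show False by contradiction
  qed
  then show thesis by (rule that[OF 1(1-4) z(1,2) l 2(1-4) z(3,4)])
qed

text \<open>For a common exponent \<open>n0\<close> the displacements of both powers lie in the
  maximal ideals of both places. One of the two quotients of these displacements lies in
  \<open>V1\<close>, and this decides which matrix plays the role of \<open>A\<close> in the core
  lemma.\<close>

theorem separating_word_exists: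
  fixes A B :: "'k::alg_closed_field^2^2"
  assumes A: "det A \<noteq> 0" and B: "det B \<noteq> 0" and p: "p \<noteq> 0"
    and infA: "\<And>n. n > 0 \<Longrightarrow> wedge (mpow A n *v p) p \<noteq> 0"
    and infB: "\<And>n. n > 0 \<Longrightarrow> wedge (mpow B n *v p) p \<noteq> 0"
    and E: "finite E" "\<And>e. e \<in> E \<Longrightarrow> wedge p e \<noteq> 0"
  shows "\<exists>n m k. separating_word A B p E n m k \<or> separating_word B A p E n m k"
proof -
  obtain x y f g where ea: "eigen_pair A x y" and eb: "eigen_pair B f g" using eigen_pair_exists by metis
  \<comment> \<open>Everything that must be integral, together with all numbers that must be units
    when nonzero: determinants, eigenvalues, their differences, and the values of
    \<open>wedge\<close> at \<open>p\<close>.\<close>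
  define S where "S = {A$1$1, A$1$2, A$2$1, A$2$2, det A, x, y, x - y, wedge (A *v p) p} \<union>
    {B$1$1, B$1$2, B$2$1, B$2$2, det B, f, g, f - g, wedge (B *v p) p} \<union> {p$1, p$2} \<union>
    (\<lambda>e. e$1) ` E \<union> (\<lambda>e. e$2) ` E \<union> wedge p ` E"
  have "finite S" unfolding S_def using E(1) by auto
  from two_places[OF this] obtain A1 V1 l A2 V2 where
    1: "subring_of_field A1" "valuation_ring V1" "A1 \<subseteq> V1" "finite_residue A1 V1" "S \<subseteq> A1" "inverse ` S \<subseteq> A1"
    and l: "prime (l::nat)" "of_nat l \<in> max_ideal V1"
    and 2: "subring_of_field A2" "valuation_ring V2" "A2 \<subseteq> V2" "finite_residue A2 V2" "S \<subseteq> A2" "inverse ` S \<subseteq> A2"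
    and q: "\<And>q::nat. prime q \<Longrightarrow> of_nat q \<noteq> (0::'k) \<Longrightarrow> of_nat q \<notin> max_ideal V1 \<or> of_nat q \<notin> max_ideal V2"
    by metis
  obtain l2 :: nat where l2: "prime l2" "of_nat l2 \<in> max_ideal V2"
    using finite_residue_prime[OF 2(2,1,3,4)] by blast
  have unit1: "s \<notin> max_ideal V1" and unit2: "s \<notin> max_ideal V2" if "s \<in> S" "s \<noteq> 0" for s
    using max_ideal_inverse[OF 1(2)] max_ideal_inverse[OF 2(2)] that 1 2 by (meson image_subset_iff subsetD)+
  have xyfg0: "x \<noteq> 0" "y \<noteq> 0" "f \<noteq> 0" "g \<noteq> 0" using A B ea eb by (auto simp: eigen_pair_def)
  have xyfg: "{x, y, f, g} \<subseteq> S" by (auto simp: S_def)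
  then have xyfgV: "{x, y, f, g} \<subseteq> V1" "{x, y, f, g} \<subseteq> V2" using 1 2 by blast+
  obtain R1 where R1: "R1 > 0" "\<forall>s\<in>{x, y, f, g}. s ^ R1 - 1 \<in> max_ideal V1"
    using common_root_of_unity_exponent[OF 1(2,1,3,4), of "{x, y, f, g}"] xyfg 1(5) unit1 xyfg0 by blast
  obtain R2 where R2: "R2 > 0" "\<forall>s\<in>{x, y, f, g}. s ^ R2 - 1 \<in> max_ideal V2"
    using common_root_of_unity_exponent[OF 2(2,1,3,4), of "{x, y, f, g}"] xyfg 2(5) unit2 xyfg0 by blast
  \<comment> \<open>The factors \<open>R1\<close> and \<open>R2\<close> make the eigenvalue powers
    congruent to 1 at the two places; \<open>l\<close> and \<open>l2\<close> are the residue
    characteristics, which then push \<open>homog_sum\<close> into the maximal ideals.\<close>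
  define n0 where "n0 = R1 * R2 * (l * l2)"
  have n0: "n0 > 0" "R1 * l * (R2 * l2) = n0" "R2 * l2 * (R1 * l) = n0"
    using R1 R2 l l2 prime_gt_0_nat by (auto simp: n0_def)
  have div: "homog_sum a b n0 \<in> max_ideal V" "a ^ n0 - b ^ n0 \<in> max_ideal V"
    if V: "valuation_ring V" and ab: "a \<in> V" "b \<in> V" "a ^ R - 1 \<in> max_ideal V" "b ^ R - 1 \<in> max_ideal V"
      and L: "of_nat L \<in> max_ideal V" and n: "R * L * k = n0" for V a b R L k
  proof -
    note sV = vr_subring[OF V]
    have V': "a ^ R \<in> V" "b ^ R \<in> V" using sr_power[OF sV] ab by auto
    have b1: "b ^ R \<notin> max_ideal V" using max_ideal_cong_unit[OF V ab(4) max_ideal_one[OF V]] .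
    have "a ^ R - b ^ R \<in> max_ideal V" using max_ideal_diff[OF V ab(3,4)] by simp
    then have "homog_sum (a ^ R) (b ^ R) L \<in> max_ideal V"
      using homog_sum_in_max_ideal_iff[OF V V' _ b1] L by blast
    then have "homog_sum a b (R * L) \<in> max_ideal V"
      unfolding homog_sum_mult[of a b R] using homog_sum_closed[OF sV ab(1,2)] by (intro max_ideal_mult(2)[OF V])
    then show *: "homog_sum a b n0 \<in> max_ideal V"
      unfolding n[symmetric] homog_sum_mult[of a b "R * L"]
      by (intro max_ideal_mult(1)[OF V] homog_sum_closed[OF sV] sr_power[OF sV] ab)
    show "a ^ n0 - b ^ n0 \<in> max_ideal V"
      unfolding homog_sum_diff[symmetric] by (intro max_ideal_mult(2)[OF V *] sr_diff[OF sV] ab)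
  qed
  define Good where "Good C a b \<longleftrightarrow> eigen_pair C a b \<and> gl_in V1 C \<and> gl_in V2 C \<and> {a, b} \<subseteq> V1 \<and> {a, b} \<subseteq> V2 \<and>
    a \<notin> max_ideal V1 \<and> b \<notin> max_ideal V1 \<and> (a \<noteq> b \<longrightarrow> a - b \<notin> max_ideal V1) \<and>
    wedge (C *v p) p \<notin> max_ideal V1 \<and> (\<forall>n>0. homog_sum a b n \<noteq> 0) \<and>
    homog_sum a b n0 \<in> max_ideal V1 \<and> homog_sum a b n0 \<in> max_ideal V2 \<and> a ^ n0 - b ^ n0 \<in> max_ideal V1"
    for C :: "'k^2^2" and a b
  have hs: "homog_sum a b n \<noteq> 0" "wedge (C *v p) p \<noteq> 0"
    if "eigen_pair C a b" "n > 0" "\<And>n. n > 0 \<Longrightarrow> wedge (mpow C n *v p) p \<noteq> 0" for C a b n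
    using that(3)[OF that(2)] unfolding wedge_mpow[OF that(1)] by auto
  have gl: "gl_in V C" if "subring_of_field R" "R \<subseteq> V" "{C$1$1, C$1$2, C$2$1, C$2$2, inverse (det C)} \<subseteq> R" "det C \<noteq> 0"
    for V R and C :: "'k^2^2"
    using that unfolding gl_in_def mat_in_2 by auto
  have GA: "Good A x y"
  proof -
    have h: "{A$1$1, A$1$2, A$2$1, A$2$2, inverse (det A)} \<subseteq> A1" "{A$1$1, A$1$2, A$2$1, A$2$2, inverse (det A)} \<subseteq> A2"
      using 1(5,6) 2(5,6) by (auto simp: S_def)
    have "gl_in V1 A" "gl_in V2 A" by (rule gl[OF 1(1,3) h(1) A], rule gl[OF 2(1,3) h(2) A])
    moreover have "x - y \<in> S" "wedge (A *v p) p \<in> S" by (auto simp: S_def)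
    ultimately show ?thesis unfolding Good_def
      using ea xyfgV hs[OF ea _ infA] unit1 xyfg xyfg0 R1 R2 div[OF 1(2) _ _ _ _ l(2) n0(2), of x y]
        div[OF 2(2) _ _ _ _ l2(2) n0(3), of x y] by auto
  qed
  have GB: "Good B f g"
  proof -
    have h: "{B$1$1, B$1$2, B$2$1, B$2$2, inverse (det B)} \<subseteq> A1" "{B$1$1, B$1$2, B$2$1, B$2$2, inverse (det B)} \<subseteq> A2"
      using 1(5,6) 2(5,6) by (auto simp: S_def)
    have "gl_in V1 B" "gl_in V2 B" by (rule gl[OF 1(1,3) h(1) B], rule gl[OF 2(1,3) h(2) B])
    moreover have "f - g \<in> S" "wedge (B *v p) p \<in> S" by (auto simp: S_def)
    ultimately show ?thesis unfolding Good_def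
      using eb xyfgV hs[OF eb _ infB] unit1 xyfg xyfg0 R1 R2 div[OF 1(2) _ _ _ _ l(2) n0(2), of f g]
        div[OF 2(2) _ _ _ _ l2(2) n0(3), of f g] by auto
  qed
  have pV: "vec_in V1 p" and EV: "\<And>e. e \<in> E \<Longrightarrow> vec_in V1 e \<and> wedge p e \<notin> max_ideal V1"
    using 1(3,5) unit1 E(2) unfolding vec_in_2 by (auto simp: S_def)
  have main: "\<exists>n m k. separating_word C D p E n m k"
    if C: "Good C a b" and D: "Good D c d" and quot: "homog_sum a b n0 / homog_sum c d n0 \<in> V1"
    for C D :: "'k^2^2" and a b c d
  proof -
    note s1 = vr_subring[OF 1(2)]
    \<comment> \<open>One more factor \<open>l\<close> in the exponent multiplies the displacement
      by \<open>u\<close> in the maximal ideal, which turns the divisibility \<open>quot\<close>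
      into the strict one required for \<open>z\<close>.\<close>
    define u where "u = homog_sum (a ^ n0) (b ^ n0) l"
    have ab: "a \<in> V1" "b \<in> V1" "b \<notin> max_ideal V1" "a ^ n0 - b ^ n0 \<in> max_ideal V1"
      using C unfolding Good_def by auto
    have abn: "a ^ n0 \<in> V1" "b ^ n0 \<in> V1" "b ^ n0 \<notin> max_ideal V1"
      using sr_power[OF s1 ab(1)] sr_power[OF s1 ab(2)] max_ideal_power[OF 1(2) ab(2)] ab(3) by auto
    have u: "u \<in> max_ideal V1"
      unfolding u_def using homog_sum_in_max_ideal_iff[OF 1(2) abn(1,2) ab(4) abn(3), of l] l(2) by blast
    have n: "homog_sum a b (n0 * l) = homog_sum a b n0 * u" unfolding u_def by (rule homog_sum_mult)
    have "homog_sum c d n0 \<noteq> 0" using D n0(1) unfolding Good_def by blast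
    then have z: "homog_sum a b (n0 * l) = homog_sum c d n0 * (homog_sum a b n0 / homog_sum c d n0 * u)"
      unfolding n by simp
    have zM: "homog_sum a b n0 / homog_sum c d n0 * u \<in> max_ideal V1" using max_ideal_mult(2)[OF 1(2) u quot] .
    have "a ^ (n0 * l) - b ^ (n0 * l) = (a ^ n0 - b ^ n0) * u" unfolding u_def homog_sum_diff by (simp add: power_mult)
    then have d: "a ^ (n0 * l) - b ^ (n0 * l) \<in> max_ideal V1"
      using max_ideal_mult(1)[OF 1(2) ab(4) max_ideal_subset[OF 1(2) u]] by simp
    have "homog_sum (a ^ n0) (b ^ n0) l \<in> V2"
      using C unfolding Good_def by (intro homog_sum_closed[OF vr_subring[OF 2(2)]] sr_power[OF vr_subring[OF 2(2)]]) auto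
    then have n2: "homog_sum a b (n0 * l) \<in> max_ideal V2"
      unfolding homog_sum_mult[of a b n0] using C max_ideal_mult(1)[OF 2(2)] unfolding Good_def by blast
    have "n0 * l > 0" using n0 l prime_gt_0_nat by auto
    have c: "eigen_pair C a b" "gl_in V1 C" "gl_in V2 C" "a \<notin> max_ideal V1" "a \<in> V2" "b \<in> V2"
      "a \<noteq> b \<Longrightarrow> a - b \<notin> max_ideal V1" "wedge (C *v p) p \<notin> max_ideal V1" "\<And>n. n > 0 \<Longrightarrow> homog_sum a b n \<noteq> 0"
      using C unfolding Good_def by auto
    have e: "eigen_pair D c d" "gl_in V1 D" "gl_in V2 D" "wedge (D *v p) p \<notin> max_ideal V1"
      "homog_sum c d n0 \<in> max_ideal V1" "homog_sum c d n0 \<in> max_ideal V2"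
      using D unfolding Good_def by auto
    have "\<exists>k. separating_word C D p E (n0 * l) n0 k"
      by (rule separating_word_exists_core[OF 1(2) 2(2) l q c(1) e(1) c(2) e(2) c(3) e(3) ab(1,2) c(4) ab(3) c(5,6,7)
        p pV EV c(8) e(4) c(9) \<open>n0 * l > 0\<close> d n2 e(6,5) z zM])
    then show ?thesis by blast
  qed
  have "homog_sum x y n0 \<noteq> 0" "homog_sum f g n0 \<noteq> 0" using GA GB n0(1) unfolding Good_def by blast+
  then have "homog_sum x y n0 / homog_sum f g n0 \<in> V1 \<or> homog_sum f g n0 / homog_sum x y n0 \<in> V1"
    using vr_total[OF 1(2), of "homog_sum x y n0 / homog_sum f g n0"] by auto
  then show ?thesis using main[OF GA GB] main[OF GB GA] by blast
qed

section \<open>Subgroups of finite index\<close>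

context group
begin

lemma mult_inv_cancel: "x \<in> carrier G \<Longrightarrow> y \<in> carrier G \<Longrightarrow> x \<otimes> inv y \<otimes> y = x"
  by (simp add: m_assoc)

text \<open>Finiteness of the index is expressed by a map \<open>f\<close> with finite image that separates the cosets.\<close>

lemma finite_index_transversal:
  assumes K: "subgroup K G" and f: "finite (f ` K)"
    and L: "\<And>x y. x \<in> K \<Longrightarrow> y \<in> K \<Longrightarrow> f x = f y \<Longrightarrow> x \<otimes> inv y \<in> L"
  obtains R where "finite R" "R \<subseteq> K" "\<one> \<in> R" "\<And>x. x \<in> K \<Longrightarrow> \<exists>r\<in>R. x \<otimes> inv r \<in> L"
proof -
  define R where "R = insert \<one> (inv_into K f ` f ` K)"
  have "\<exists>r\<in>R. x \<otimes> inv r \<in> L" if "x \<in> K" for x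
    using that L[OF that, of "inv_into K f (f x)"] inv_into_into[of "f x" f K] f_inv_into_f[of "f x" f K]
    by (auto simp: R_def)
  moreover have "R \<subseteq> K" using subgroup.one_closed[OF K] by (auto simp: R_def inv_into_into)
  moreover have "finite R" "\<one> \<in> R" using f by (auto simp: R_def)
  ultimately show thesis using that by blast
qed

text \<open>Schreier's lemma: a subgroup of finite index in a finitely generated group is finitely
  generated, by the elements \<open>r t inv r'\<close> that lie in \<open>L\<close>. The second
  decency condition speaks of finitely generated groups only, so passing to finite index needs
  this.\<close>

lemma schreier:
  assumes S: "finite S" "S \<subseteq> carrier G" and L: "subgroup L G" "L \<subseteq> generate G S"
    and f: "finite (f ` generate G S)"
    and cos: "\<And>x y. x \<in> generate G S \<Longrightarrow> y \<in> generate G S \<Longrightarrow> f x = f y \<Longrightarrow> x \<otimes> inv y \<in> L"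
  shows "\<exists>S'. finite S' \<and> S' \<subseteq> carrier G \<and> L = generate G S'"
proof -
  define K where "K = generate G S"
  have K: "subgroup K G" unfolding K_def by (rule generate_is_subgroup[OF S(2)])
  have KG: "K \<subseteq> carrier G" using subgroup.subset[OF K] .
  obtain R where R: "finite R" "R \<subseteq> K" "\<one> \<in> R" "\<And>x. x \<in> K \<Longrightarrow> \<exists>r\<in>R. x \<otimes> inv r \<in> L"
    by (rule finite_index_transversal[OF K, of f L]) (use f cos K_def in auto)
  \<comment> \<open>With \<open>\<one>\<close> in both \<open>T\<close> and \<open>R\<close>, an
    element of \<open>R\<close> that lies in \<open>L\<close> is itself one of the generators; this
    closes the argument at the end.\<close>
  define T where "T = insert \<one> (S \<union> (\<lambda>s. inv s) ` S)"
  have TK: "T \<subseteq> K" unfolding T_def K_def by (auto intro: generate.intros)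
  define S' where "S' = (\<lambda>(r, t, r'). r \<otimes> t \<otimes> inv r') ` (R \<times> T \<times> R) \<inter> L"
  have fin: "finite S'" unfolding S'_def T_def using R S by auto
  have S'L: "S' \<subseteq> L" and S'G: "S' \<subseteq> carrier G" using subgroup.subset[OF L(1)] by (auto simp: S'_def)
  have step: "\<exists>r'\<in>R. r \<otimes> t \<otimes> inv r' \<in> S'" if "r \<in> R" "t \<in> T" for r t
  proof -
    have "r \<otimes> t \<in> K" using subgroup.m_closed[OF K] that R TK by blast
    then obtain r' where "r' \<in> R" "r \<otimes> t \<otimes> inv r' \<in> L" using R(4) by blast
    then show ?thesis using that unfolding S'_def by force
  qed
  \<comment> \<open>\<open>C\<close> contains \<open>\<one>\<close> and is stable under right
    multiplication by \<open>T\<close>, hence contains all of \<open>K\<close>.\<close>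
  define C where "C = {u \<otimes> r |u r. u \<in> generate G S' \<and> r \<in> R}"
  have gS': "generate G S' \<subseteq> carrier G" using generate_incl[OF S'G] .
  have CG: "C \<subseteq> carrier G" unfolding C_def using gS' R(2) KG by auto
  have CT: "v \<otimes> t \<in> C" if v: "v \<in> C" and t: "t \<in> T" for v t
  proof -
    obtain u r where u: "v = u \<otimes> r" "u \<in> generate G S'" "r \<in> R" using v unfolding C_def by blast
    obtain r' where r': "r' \<in> R" "r \<otimes> t \<otimes> inv r' \<in> S'" using step[OF u(3) t] by blast
    have c: "u \<in> carrier G" "r \<in> carrier G" "t \<in> carrier G" "r' \<in> carrier G"
      using u r' t gS' R(2) KG TK by blast+
    have "v \<otimes> t = (u \<otimes> (r \<otimes> t \<otimes> inv r')) \<otimes> r'"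
      using c by (simp add: u(1) m_assoc)
    moreover have "u \<otimes> (r \<otimes> t \<otimes> inv r') \<in> generate G S'"
      using generate.eng[OF u(2) generate.incl[OF r'(2)]] .
    ultimately show ?thesis unfolding C_def using r'(1) by blast
  qed
  have CK: "\<forall>v\<in>C. v \<otimes> w \<in> C" if "w \<in> K" for w
    using that unfolding K_def
  proof (induction rule: generate.induct)
    case one then show ?case using CG by auto
  next
    case (incl h) then show ?case using CT[of _ h] by (auto simp: T_def)
  next
    case (inv h) then show ?case using CT[of _ "inv h"] by (auto simp: T_def)
  next
    case (eng h1 h2)
    have "h1 \<in> carrier G" "h2 \<in> carrier G" using eng generate_in_carrier[OF S(2)] by auto
    then show ?case using eng CG by (auto simp flip: m_assoc)
  qed
  have "L \<subseteq> generate G S'"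
  proof
    fix w assume w: "w \<in> L"
    then have "w \<in> K" using L(2) K_def by blast
    have "\<one> \<in> C" unfolding C_def using R(3) by (force intro: generate.one)
    then have "\<one> \<otimes> w \<in> C" using CK[OF \<open>w \<in> K\<close>] by blast
    then have "w \<in> C" using \<open>w \<in> K\<close> KG by auto
    then obtain u r where u: "w = u \<otimes> r" "u \<in> generate G S'" "r \<in> R" unfolding C_def by blast
    have uL: "u \<in> L" using generate_subgroup_incl[OF S'L L(1)] u(2) by blast
    have c: "u \<in> carrier G" "r \<in> carrier G" using u gS' R(2) KG by blast+
    have "r = inv u \<otimes> w" using c by (simp add: u(1) flip: m_assoc)
    then have "r \<in> L" using uL w subgroup.m_closed[OF L(1)] subgroup.m_inv_closed[OF L(1)] by blast
    moreover have "r = r \<otimes> \<one> \<otimes> inv \<one>" using c by simp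
    ultimately have "r \<in> S'" unfolding S'_def using u(3) R(3) by (force simp: T_def)
    then show "w \<in> generate G S'" unfolding u(1) using generate.eng[OF u(2) generate.incl] by blast
  qed
  moreover have "generate G S' \<subseteq> L" using generate_subgroup_incl[OF S'L L(1)] .
  ultimately show ?thesis using fin S'G by blast
qed

end

section \<open>Finitely generated torsion subgroups\<close>

lemma carrier_GL2: "carrier (GL2 :: ('k::field^2^2) monoid) = {A. det A \<noteq> 0}"
  by (simp add: GL2_def invertible_det_nz)

lemma GL2_simps: "A \<otimes>\<^bsub>GL2\<^esub> B = A ** B" "\<one>\<^bsub>GL2\<^esub> = mat 1"
  by (simp_all add: GL2_def)

lemma group_GL2: "group (GL2 :: ('k::field^2^2) monoid)"
proof (rule groupI)
  fix A :: "'k^2^2" assume "A \<in> carrier GL2"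
  then show "\<exists>B\<in>carrier GL2. B \<otimes>\<^bsub>GL2\<^esub> A = \<one>\<^bsub>GL2\<^esub>"
    by (intro bexI[of _ "minv A"]) (auto simp: GL2_simps carrier_GL2 minv_left det_minv)
qed (auto simp: carrier_GL2 GL2_simps det_mul matrix_mul_assoc)

lemma inv_GL2: "det A \<noteq> 0 \<Longrightarrow> inv\<^bsub>GL2\<^esub> A = minv (A :: 'k::field^2^2)"
  using group.inv_equality[OF group_GL2, of "minv A" A]
  by (auto simp: GL2_simps carrier_GL2 minv_left det_minv)

lemma pow_GL2: "A [^]\<^bsub>GL2\<^esub> (n::nat) = mpow (A :: 'k::field^2^2) n"
proof (induction n)
  case (Suc n)
  then show ?case using mpow_add[of A n 1] by (simp add: monoid.nat_pow_Suc group.is_monoid[OF group_GL2] GL2_simps nat_pow_def)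
qed (simp add: GL2_simps nat_pow_def)

text \<open>In positive characteristic a finitely generated additive group is finite, since
  multiples of each generator depend only on the residue of the coefficient.\<close>

lemma finite_additive_closure:
  assumes S: "finite (S :: ('k::field^2^2) set)" and c: "CHAR('k) > 0"
  shows "\<exists>F. finite F \<and> S \<subseteq> F \<and> 0 \<in> F \<and> (\<forall>a\<in>F. - a \<in> F) \<and> (\<forall>a\<in>F. \<forall>b\<in>F. a + b \<in> F)"
  using S
proof (induction S)
  case empty then show ?case by (intro exI[of _ "{0}"]) auto
next
  case (insert s S)
  then obtain F where F: "finite F" "S \<subseteq> F" "0 \<in> F" "\<And>a. a \<in> F \<Longrightarrow> - a \<in> F" "\<And>a b. a \<in> F \<Longrightarrow> b \<in> F \<Longrightarrow> a + b \<in> F"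
    by blast
  define t where "t n = (\<chi> i j. of_nat n * s$i$j)" for n
  let ?p = "CHAR('k)"
  have t: "t (m + n) = t m + t n" "t 0 = 0" "t 1 = s" for m n by (simp_all add: t_def vec_eq_iff algebra_simps)
  have tmod: "t (n mod ?p) = t n" for n
  proof -
    have "(of_nat n :: 'k) = of_nat (n div ?p * ?p) + of_nat (n mod ?p)"
      by (metis div_mult_mod_eq of_nat_add)
    then have "(of_nat n :: 'k) = of_nat (n mod ?p)" by simp
    then show ?thesis by (simp add: t_def)
  qed
  define F' where "F' = (\<lambda>(a, n). a + t n) ` (F \<times> UNIV)"
  have "F' \<subseteq> (\<lambda>(a, n). a + t n) ` (F \<times> {..<?p})"
  proof
    fix b assume "b \<in> F'"
    then obtain a n where "a \<in> F" "b = a + t (n mod ?p)" unfolding F'_def tmod by auto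
    then show "b \<in> (\<lambda>(a, n). a + t n) ` (F \<times> {..<?p})"
      using c by (intro image_eqI[of _ _ "(a, n mod ?p)"]) auto
  qed
  then have fin: "finite F'" by (rule finite_subset) (use F(1) in auto)
  have in': "a + t n \<in> F'" if "a \<in> F" for a n using that unfolding F'_def by auto
  have tneg: "- t n = t (n * (?p - 1))" for n
  proof -
    have "n + n * (?p - 1) = n * ?p" using c by (cases ?p) auto
    then have "t n + t (n * (?p - 1)) = t (n * ?p)" using t(1)[of n "n * (?p - 1)"] by simp
    also have "\<dots> = 0" using tmod[of "n * ?p"] t(2) by simp
    finally show ?thesis by (simp add: neg_eq_iff_add_eq_0)
  qed
  have "S \<subseteq> F'" "0 \<in> F'" using in'[of _ 0] F t(2) by (auto simp: subset_iff)
  moreover have "s \<in> F'" using in'[OF F(3), of 1] t(3) by simp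
  moreover have "- b \<in> F'" if b: "b \<in> F'" for b
  proof -
    obtain a n where "a \<in> F" "b = a + t n" using b unfolding F'_def by auto
    then show ?thesis using in'[OF F(4), of a "n * (?p - 1)"] tneg[of n] by (simp add: algebra_simps)
  qed
  moreover have "b + d \<in> F'" if b: "b \<in> F'" "d \<in> F'" for b d
  proof -
    obtain a n a' n' where "a \<in> F" "b = a + t n" "a' \<in> F" "d = a' + t n'" using b unfolding F'_def by auto
    then show ?thesis using in'[OF F(5), of a a' "n + n'"] t(1)[of n n'] by (simp add: algebra_simps)
  qed
  ultimately show ?case using fin by (intro exI[of _ F'] conjI ballI) simp_all
qed

text \<open>Trace and determinant are zero, equivalently the square of \<open>N\<close> is
  zero.\<close>

definition nilp :: "'k::field^2^2 \<Rightarrow> bool" where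
  "nilp N \<longleftrightarrow> N$2$2 = - N$1$1 \<and> N$1$2 * N$2$1 = - (N$1$1 * N$1$1)"

text \<open>Nonzero \<open>N\<close> and \<open>M\<close> then share kernel and image. In
  coordinates, the squares of three entries of the product are multiples of its trace, and the
  remaining diagonal entry follows from the trace.\<close>

lemma nilp_mult_zero:
  assumes N: "nilp N" and M: "nilp M" and tr: "(N ** M)$1$1 + (N ** M)$2$2 = 0"
  shows "N ** M = 0"
proof -
  obtain a b c where N': "N$1$1 = a" "N$1$2 = b" "N$2$1 = c" "N$2$2 = - a" "b * c = - (a * a)"
    using N by (simp add: nilp_def)
  obtain d e f where M': "M$1$1 = d" "M$1$2 = e" "M$2$1 = f" "M$2$2 = - d" "e * f = - (d * d)"
    using M by (simp add: nilp_def)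
  have t: "b * f + c * e + 2 * (a * d) = 0" using tr by (simp add: mat2_mult N' M' algebra_simps)
  have "(a * d + b * f)\<^sup>2 = a\<^sup>2 * d\<^sup>2 + 2 * a * d * b * f + (b * f)\<^sup>2"
    by (simp add: power2_eq_square algebra_simps)
  also have "a\<^sup>2 * d\<^sup>2 = (b * c) * (e * f)" unfolding N'(5) M'(5) by (simp add: power2_eq_square algebra_simps)
  also have "(b * c) * (e * f) + 2 * a * d * b * f + (b * f)\<^sup>2 = b * f * (b * f + c * e + 2 * (a * d))"
    by (simp add: power2_eq_square algebra_simps)
  finally have 11: "a * d + b * f = 0" using t by simp
  then have 22: "c * e + a * d = 0" using t by (simp add: algebra_simps add_eq_0_iff)
  have "(a * e - b * d)\<^sup>2 = (a * a) * e\<^sup>2 - 2 * a * b * d * e + b\<^sup>2 * (d * d)"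
    by (simp add: power2_eq_square algebra_simps)
  also have "a * a = - (b * c)" using N'(5) by simp
  also have "d * d = - (e * f)" using M'(5) by simp
  also have "- (b * c) * e\<^sup>2 - 2 * a * b * d * e + b\<^sup>2 * (- (e * f)) = - (b * e) * (b * f + c * e + 2 * (a * d))"
    by (simp add: power2_eq_square algebra_simps)
  finally have 12: "a * e - b * d = 0" using t by simp
  have "(c * d - a * f)\<^sup>2 = c\<^sup>2 * (d * d) - 2 * a * c * d * f + (a * a) * f\<^sup>2"
    by (simp add: power2_eq_square algebra_simps)
  also have "a * a = - (b * c)" using N'(5) by simp
  also have "d * d = - (e * f)" using M'(5) by simp
  also have "c\<^sup>2 * (- (e * f)) - 2 * a * c * d * f + - (b * c) * f\<^sup>2 = - (c * f) * (b * f + c * e + 2 * (a * d))"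
    by (simp add: power2_eq_square algebra_simps)
  finally have 21: "c * d - a * f = 0" using t by simp
  show ?thesis using 11 12 21 22 by (simp add: mat2_eq_iff mat2_mult N' M' algebra_simps)
qed

section \<open>Scalar multiples of unipotent matrices\<close>

definition scaled_unipotent :: "'k::field \<Rightarrow> 'k^2^2 \<Rightarrow> 'k^2^2" where
  "scaled_unipotent y N = mat y ** (mat 1 + N)"

lemma scaled_unipotent_entries:
  "scaled_unipotent y N$1$1 = y + y * N$1$1" "scaled_unipotent y N$2$2 = y + y * N$2$2"
  "scaled_unipotent y N$1$2 = y * N$1$2" "scaled_unipotent y N$2$1 = y * N$2$1"
  by (simp_all add: scaled_unipotent_def mat2_mult mat2_mat algebra_simps)

lemma eigen_pair_scaled_unipotent: "nilp N \<Longrightarrow> eigen_pair (scaled_unipotent y N) y y"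
  unfolding nilp_def eigen_pair_def det_2 scaled_unipotent_entries by (simp add: algebra_simps)

lemma scaled_unipotent_of_eigen_pair:
  assumes e: "eigen_pair A y y" and y: "y \<noteq> 0"
  obtains N where "nilp N" "A = scaled_unipotent y N"
proof
  define N where "N = mat (1 / y) ** A - mat 1"
  have N: "N$1$1 = A$1$1 / y - 1" "N$2$2 = A$2$2 / y - 1" "N$1$2 = A$1$2 / y" "N$2$1 = A$2$1 / y"
    by (simp_all add: N_def mat2_mult mat2_mat)
  show "A = scaled_unipotent y N" using y by (simp add: mat2_eq_iff scaled_unipotent_entries N algebra_simps)
  have t: "A$2$2 = 2 * y - A$1$1" and d: "A$1$2 * A$2$1 = A$1$1 * A$2$2 - y * y"
    using e by (simp_all add: eigen_pair_def det_2 algebra_simps)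
  show "nilp N" unfolding nilp_def N
  proof
    show "A$2$2 / y - 1 = - (A$1$1 / y - 1)" unfolding t using y by (simp add: field_simps)
    have "A$1$2 * A$2$1 = - ((A$1$1 - y) * (A$1$1 - y))" unfolding d t by (simp add: algebra_simps)
    then have "A$1$2 * A$2$1 / (y * y) = - ((A$1$1 - y) * (A$1$1 - y)) / (y * y)" by simp
    then show "A$1$2 / y * (A$2$1 / y) = - ((A$1$1 / y - 1) * (A$1$1 / y - 1))" using y by (simp add: field_simps)
  qed
qed

lemma scaled_unipotent_mult:
  assumes N: "nilp N" and M: "nilp M" and z: "N ** M = 0" "M ** N = 0"
  shows "scaled_unipotent y N ** scaled_unipotent x M = scaled_unipotent (y * x) (N + M)" "nilp (N + M)"
proof -
  have z': "N$1$1 * M$1$1 + N$1$2 * M$2$1 = 0" "N$1$1 * M$1$2 + N$1$2 * M$2$2 = 0"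
     "N$2$1 * M$1$1 + N$2$2 * M$2$1 = 0" "N$2$1 * M$1$2 + N$2$2 * M$2$2 = 0"
    using z(1) by (simp_all add: mat2_eq_iff mat2_mult)
  have "(y + y * N$1$1) * (x + x * M$1$1) + y * N$1$2 * (x * M$2$1)
      = y * x + y * x * (N$1$1 + M$1$1) + y * x * (N$1$1 * M$1$1 + N$1$2 * M$2$1)"
    "(y + y * N$1$1) * (x * M$1$2) + y * N$1$2 * (x + x * M$2$2)
      = y * x * (N$1$2 + M$1$2) + y * x * (N$1$1 * M$1$2 + N$1$2 * M$2$2)"
    "y * N$2$1 * (x + x * M$1$1) + (y + y * N$2$2) * (x * M$2$1)
      = y * x * (N$2$1 + M$2$1) + y * x * (N$2$1 * M$1$1 + N$2$2 * M$2$1)"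
    "y * N$2$1 * (x * M$1$2) + (y + y * N$2$2) * (x + x * M$2$2)
      = y * x + y * x * (N$2$2 + M$2$2) + y * x * (N$2$1 * M$1$2 + N$2$2 * M$2$2)"
    by (simp_all add: algebra_simps)
  then show "scaled_unipotent y N ** scaled_unipotent x M = scaled_unipotent (y * x) (N + M)"
    by (simp add: mat2_eq_iff mat2_mult scaled_unipotent_entries z')
  have y': "M$1$1 * N$1$1 + M$1$2 * N$2$1 = 0" using z(2) by (simp add: mat2_eq_iff mat2_mult)
  have "(N + M)$1$2 * (N + M)$2$1 = N$1$2 * N$2$1 + M$1$2 * M$2$1 + N$1$2 * M$2$1 + M$1$2 * N$2$1"
    by (simp add: algebra_simps)
  also have "N$1$2 * M$2$1 = - (N$1$1 * M$1$1)" using z'(1) by (simp add: eq_neg_iff_add_eq_0 add.commute)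
  also have "M$1$2 * N$2$1 = - (N$1$1 * M$1$1)" using y' by (simp add: eq_neg_iff_add_eq_0 add.commute mult.commute)
  finally show "nilp (N + M)" using N M unfolding nilp_def by (simp add: algebra_simps)
qed

lemma minv_scaled_unipotent:
  assumes N: "nilp N" and y: "y \<noteq> 0"
  shows "minv (scaled_unipotent y N) = scaled_unipotent (1 / y) (- N)" "nilp (- N)"
proof -
  have d: "det (scaled_unipotent y N) = y * y"
    using eigen_pair_scaled_unipotent[OF N, of y] by (simp add: eigen_pair_def)
  show "minv (scaled_unipotent y N) = scaled_unipotent (1 / y) (- N)"
    using N y unfolding mat2_eq_iff minv_entries d scaled_unipotent_entries nilp_def by (simp add: field_simps)
  show "nilp (- N)" using N by (simp add: nilp_def)
qed

text \<open>As the product is unipotent up to a scalar, the trace of \<open>N M\<close> is \<open>0\<close> or \<open>-4\<close>; since it lies in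
  the maximal ideal, it vanishes.\<close>

lemma congruent_unipotent_product:
  fixes N M :: "'k::field^2^2"
  assumes V: "valuation_ring V" and c: "CHAR('k) > 0" and N: "nilp N" and M: "nilp M" and xy: "x \<noteq> 0" "y \<noteq> 0"
    and A: "congruent_scalar V (max_ideal V) (scaled_unipotent x N)"
    and B: "congruent_scalar V (max_ideal V) (scaled_unipotent y M)"
    and AB: "eigen_pair (scaled_unipotent x N ** scaled_unipotent y M) w w"
  shows "N ** M = 0 \<and> M ** N = 0"
proof -
  note sV = vr_subring[OF V]
  define \<tau> where "\<tau> = (N ** M)$1$1 + (N ** M)$2$2"
  have ent: "N$i$j \<in> max_ideal V" if "nilp N" "congruent_scalar V (max_ideal V) (scaled_unipotent x N)" "x \<noteq> 0" for N x i j
  proof -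
    note e = congruent_scalar_eigen[OF V that(2) eigen_pair_scaled_unipotent[OF that(1)]]
    have x: "inverse x \<in> V" using vr_unit[OF V e(1,4)] .
    have "inverse x * (x * N$i$j) \<in> max_ideal V" for i j :: 2
    proof -
      have "x * N$i$j \<in> max_ideal V"
        using e(6,7) that(2) exhaust_2[of i] exhaust_2[of j]
        unfolding congruent_scalar_def scaled_unipotent_entries by auto
      then show ?thesis using max_ideal_mult(2)[OF V _ x] by blast
    qed
    then show ?thesis using that(3) by (simp flip: mult.assoc)
  qed
  have \<tau>M: "\<tau> \<in> max_ideal V" unfolding \<tau>_def mat2_mult
    using ent[OF N A xy(1)] ent[OF M B xy(2)] max_ideal_subset[OF V]
    by (intro max_ideal_add[OF V] max_ideal_mult(1)[OF V]) auto
  have "(scaled_unipotent x N ** scaled_unipotent y M)$1$1 + (scaled_unipotent x N ** scaled_unipotent y M)$2$2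
     = x * y * (2 + \<tau>)"
    using N M by (simp add: mat2_mult scaled_unipotent_entries \<tau>_def nilp_def algebra_simps)
  note tr = this
  have dt: "det (scaled_unipotent x N ** scaled_unipotent y M) = (x * y)\<^sup>2"
    using eigen_pair_scaled_unipotent[OF N, of x] eigen_pair_scaled_unipotent[OF M, of y]
    by (simp add: det_mul eigen_pair_def power2_eq_square mult_ac)
  have "(x * y * (2 + \<tau>))\<^sup>2 - 4 * (x * y)\<^sup>2 = 0"
    using eigen_pair_disc[OF AB] unfolding tr dt by simp
  then have "(x * y)\<^sup>2 * ((2 + \<tau>)\<^sup>2 - 4) = 0"
    unfolding power_mult_distrib by (simp only: right_diff_distrib mult.commute mult.left_commute)
  then have "(2 + \<tau>)\<^sup>2 - 4 = 0" using xy by simp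
  then have "\<tau> * (\<tau> + 4) = 0" by (simp add: power2_eq_square algebra_simps)
  \<comment> \<open>The value -4 can lie in the maximal ideal only if 2 does. Then the residue
    characteristic, which is that of the field, is 2, and -4 is zero.\<close>
  moreover have "\<tau> = 0" if "\<tau> + 4 = 0"
  proof -
    have "4 = - \<tau>" using that by (simp add: eq_neg_iff_add_eq_0 add.commute)
    then have "(2::'k) * 2 \<in> max_ideal V" using max_ideal_minus[OF V \<tau>M] by simp
    then have "of_nat 2 \<in> max_ideal V" using max_ideal_prime[OF V, of 2 2] sr_of_nat[OF sV, of 2] by auto
    moreover have "prime CHAR('k)" using c prime_CHAR_semidom by blast
    moreover have "of_nat CHAR('k) \<in> max_ideal V" using max_ideal_zero[OF V] by simp
    ultimately have "CHAR('k) = 2" using residue_prime_unique[OF V] two_is_prime_nat by blast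
    then have "(of_nat 2 :: 'k) = 0" by (metis of_nat_CHAR)
    then have "(2::'k) * 2 = 0" by simp
    then show ?thesis using \<open>4 = - \<tau>\<close> by simp
  qed
  ultimately have "\<tau> = 0" by auto
  moreover have "(M ** N)$1$1 + (M ** N)$2$2 = \<tau>" by (simp add: \<tau>_def mat2_mult algebra_simps)
  ultimately show ?thesis using nilp_mult_zero[OF N M] nilp_mult_zero[OF M N] unfolding \<tau>_def by simp
qed

lemma mpow_scalar_homog_sum:
  assumes "eigen_pair A x y" "mpow A n = mat c"
  shows "homog_sum x y n = 0 \<or> A$1$2 = 0 \<and> A$2$1 = 0 \<and> A$1$1 = A$2$2"
proof -
  have "homog_sum x y n * A$1$2 = 0" "homog_sum x y n * A$2$1 = 0"
    using assms(2) mpow_entries(3,4)[OF assms(1), of n] by (simp_all add: mat2_mat)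
  moreover have "mpow A n$1$1 - mpow A n$2$2 = homog_sum x y n * (A$1$1 - A$2$2)"
    by (simp add: mpow_entries[OF assms(1)] algebra_simps)
  then have "homog_sum x y n * (A$1$1 - A$2$2) = 0" using assms(2) by (simp add: mat2_mat)
  ultimately show ?thesis by auto
qed

text \<open>Finiteness is stated for lifts to GL2, up to scalars. The congruence subgroup
  \<open>L\<close> at both places has finite index. In characteristic zero it consists of scalars;
  otherwise its elements are scaled unipotents whose nilpotent parts add up under multiplication and
  stay in a finite additive group.\<close>

theorem finitely_generated_torsion_finite:
  fixes S :: "('k::alg_closed_field^2^2) set"
  assumes S: "finite S" "S \<subseteq> carrier GL2"
    and tors: "\<And>A. A \<in> generate GL2 S \<Longrightarrow> \<exists>n>0. \<exists>c. mpow A n = mat c"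
  shows "\<exists>F. finite F \<and> (\<forall>A\<in>generate GL2 S. \<exists>B\<in>F. \<exists>c. c \<noteq> 0 \<and> A = mat c ** B)"
proof -
  interpret GL: group "GL2 :: ('k^2^2) monoid" by (rule group_GL2)
  define K where "K = generate GL2 S"
  have K: "subgroup K GL2" unfolding K_def by (rule GL.generate_is_subgroup[OF S(2)])
  have KD: "det A \<noteq> 0" if "A \<in> K" for A using subgroup.subset[OF K] that by (auto simp: carrier_GL2)
  define T where "T = (\<Union>A\<in>S. {A$1$1, A$1$2, A$2$1, A$2$2, det A})"
  have "finite T" unfolding T_def using S(1) by auto
  from two_places[OF this] obtain A1 V1 l A2 V2 where
    1: "subring_of_field A1" "valuation_ring V1" "A1 \<subseteq> V1" "finite_residue A1 V1" "T \<subseteq> A1" "inverse ` T \<subseteq> A1"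
    and l: "prime (l::nat)" "of_nat l \<in> max_ideal V1"
    and 2: "subring_of_field A2" "valuation_ring V2" "A2 \<subseteq> V2" "finite_residue A2 V2" "T \<subseteq> A2" "inverse ` T \<subseteq> A2"
    and q: "\<And>q::nat. prime q \<Longrightarrow> of_nat q \<noteq> (0::'k) \<Longrightarrow> of_nat q \<notin> max_ideal V1 \<or> of_nat q \<notin> max_ideal V2"
    by metis
  have gl: "gl_in R A" if R: "subring_of_field R" "T \<subseteq> R" "inverse ` T \<subseteq> R" and A: "A \<in> K" for R A
    using A unfolding K_def
  proof (induction rule: generate.induct)
    case one then show ?case using gl_in_one[OF R(1)] by (simp add: GL2_simps)
  next
    case (incl A)
    then have "{A$1$1, A$1$2, A$2$1, A$2$2, det A} \<subseteq> T" unfolding T_def by blast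
    moreover have "inverse (det A) \<in> R" using calculation R(3) by auto
    ultimately show ?case unfolding gl_in_def mat_in_2 using R(2) incl S(2) by (auto simp: carrier_GL2)
  next
    case (inv A)
    then have "{A$1$1, A$1$2, A$2$1, A$2$2, det A} \<subseteq> T" unfolding T_def by blast
    moreover have "inverse (det A) \<in> R" using calculation R(3) by auto
    ultimately have "gl_in R A" unfolding gl_in_def mat_in_2 using R(2) inv S(2) by (auto simp: carrier_GL2)
    then show ?case using gl_in_minv[OF R(1)] inv S(2) by (auto simp: inv_GL2 gl_in_def)
  next
    case (eng A B) then show ?case using gl_in_mult[OF R(1)] by (simp add: GL2_simps)
  qed
  define L where "L = {A \<in> K. congruent_scalar V1 (max_ideal V1) A \<and> congruent_scalar V2 (max_ideal V2) A}"
  note M1 = vr_ideal_max[OF 1(2)] and M2 = vr_ideal_max[OF 2(2)]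
  have L: "subgroup L GL2"
  proof (rule GL.subgroupI)
    show "L \<subseteq> carrier GL2" using subgroup.subset[OF K] unfolding L_def by blast
    show "L \<noteq> {}"
      using subgroup.one_closed[OF K] congruent_scalar_one[OF 1(2) M1] congruent_scalar_one[OF 2(2) M2]
      unfolding L_def GL2_simps by blast
    fix A B assume AB: "A \<in> L"
    then have "minv A \<in> K" using subgroup.m_inv_closed[OF K, of A] KD[of A] by (auto simp: L_def inv_GL2)
    then show "inv\<^bsub>GL2\<^esub> A \<in> L"
      using AB congruent_scalar_minv[OF 1(2) M1] congruent_scalar_minv[OF 2(2) M2] KD[of A]
      by (auto simp: L_def inv_GL2)
    assume "B \<in> L"
    then show "A \<otimes>\<^bsub>GL2\<^esub> B \<in> L"
      using AB subgroup.m_closed[OF K] congruent_scalar_mult[OF 1(2) M1] congruent_scalar_mult[OF 2(2) M2]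
      by (auto simp: L_def GL2_simps)
  qed
  \<comment> \<open>\<open>f\<close> lists the residue representatives of the four entries. Matrices
    with equal lists are congruent, so their quotient is congruent to 1 and finitely many values
    separate the cosets.\<close>
  have "\<exists>f :: 'k^2^2 \<Rightarrow> 'k list. finite (f ` K) \<and>
      (\<forall>A\<in>K. \<forall>B\<in>K. f A = f B \<longrightarrow> congruent_scalar V (max_ideal V) (A ** minv B))"
    if R: "subring_of_field R" "valuation_ring V" "R \<subseteq> V" "finite_residue R V" "T \<subseteq> R" "inverse ` T \<subseteq> R" for R V
  proof -
    note sV = vr_subring[OF R(2)]
    obtain F where F: "finite F" "\<And>a. a \<in> R \<Longrightarrow> \<exists>f\<in>F. a - f \<in> max_ideal V"
      using R(4) unfolding finite_residue_def by blast
    obtain r where r: "\<And>a. a \<in> R \<Longrightarrow> r a \<in> F \<and> a - r a \<in> max_ideal V" using F(2) by metis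
    define f where "f A = [r (A$1$1), r (A$1$2), r (A$2$1), r (A$2$2)]" for A :: "'k^2^2"
    have "f ` K \<subseteq> {xs. set xs \<subseteq> F \<and> length xs = 4}"
      using gl[OF R(1,5,6)] r unfolding gl_in_def mat_in_2 f_def by auto
    then have fin: "finite (f ` K)" using finite_lists_length_eq[OF F(1)] finite_subset by blast
    have "congruent_scalar V (max_ideal V) (A ** minv B)" if AB: "A \<in> K" "B \<in> K" "f A = f B" for A B
    proof -
      have g: "gl_in R A" "gl_in R B" using gl[OF R(1,5,6)] AB by auto
      have gV: "gl_in V C" if "gl_in R C" for C using that R(3) unfolding gl_in_def mat_in_def by blast
      have sub: "a - b \<in> max_ideal V" if "a \<in> R" "b \<in> R" "r a = r b" for a b
        using max_ideal_diff[OF R(2), of "a - r a" "b - r b"] r[OF that(1)] r[OF that(2)] that(3) by simp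
      have d: "A$i$j - B$i$j \<in> max_ideal V" for i j
        using g AB(3) exhaust_2[of i] exhaust_2[of j] unfolding gl_in_def mat_in_2 f_def by (auto intro: sub)
      have m: "mat_in V (minv B)" using gl_in_minv[OF sV gV[OF g(2)]] unfolding gl_in_def by blast
      have e: "(A ** minv B)$i$j - (mat 1 :: 'k^2^2)$i$j \<in> max_ideal V" for i j
      proof -
        have "(A ** minv B)$i$j - (mat 1 :: 'k^2^2)$i$j = (A ** minv B)$i$j - (B ** minv B)$i$j"
          using g(2) by (simp add: gl_in_def minv_right)
        also have "\<dots> = (A$i$1 - B$i$1) * minv B$1$j + (A$i$2 - B$i$2) * minv B$2$j"
          by (simp add: mat2_mult algebra_simps)
        also have "\<dots> \<in> max_ideal V" using d m unfolding mat_in_def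
          by (intro max_ideal_add[OF R(2)] max_ideal_mult(1)[OF R(2)]) auto
        finally show ?thesis .
      qed
      have "gl_in V (A ** minv B)" using gV g gl_in_minv[OF sV] gl_in_mult[OF sV] by blast
      moreover have "(A ** minv B)$1$1 - (A ** minv B)$2$2 \<in> max_ideal V"
        using max_ideal_diff[OF R(2) e[of 1 1] e[of 2 2]] by (simp add: mat2_mat)
      ultimately show ?thesis using e[of 1 2] e[of 2 1] unfolding congruent_scalar_def by (simp add: mat2_mat)
    qed
    with fin show ?thesis by blast
  qed
  from this[OF 1] this[OF 2] obtain f1 f2 :: "'k^2^2 \<Rightarrow> 'k list" where
    f: "finite (f1 ` K)" "finite (f2 ` K)"
      "\<And>A B. A \<in> K \<Longrightarrow> B \<in> K \<Longrightarrow> f1 A = f1 B \<Longrightarrow> congruent_scalar V1 (max_ideal V1) (A ** minv B)"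
      "\<And>A B. A \<in> K \<Longrightarrow> B \<in> K \<Longrightarrow> f2 A = f2 B \<Longrightarrow> congruent_scalar V2 (max_ideal V2) (A ** minv B)" by metis
  have ff: "finite ((\<lambda>A. (f1 A, f2 A)) ` K)"
    by (rule finite_subset[OF _ finite_cartesian_product[OF f(1,2)]]) auto
  have cos: "A \<otimes>\<^bsub>GL2\<^esub> inv\<^bsub>GL2\<^esub> B \<in> L" if "A \<in> K" "B \<in> K" "(f1 A, f2 A) = (f1 B, f2 B)" for A B
    using that f(3,4)[OF that(1,2)] subgroup.m_closed[OF K that(1) subgroup.m_inv_closed[OF K that(2)]] KD
    unfolding L_def by (simp add: GL2_simps inv_GL2)
  obtain S' where S': "finite S'" "S' \<subseteq> carrier GL2" "L = generate GL2 S'"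
    using GL.schreier[OF S L _ ff[unfolded K_def] cos[unfolded K_def]] unfolding L_def K_def by blast
  obtain R where R: "finite R" "R \<subseteq> K" "\<And>A. A \<in> K \<Longrightarrow> \<exists>r\<in>R. A \<otimes>\<^bsub>GL2\<^esub> inv\<^bsub>GL2\<^esub> r \<in> L"
    by (rule GL.finite_index_transversal[OF K ff cos]) auto
  \<comment> \<open>Torsion modulo scalars leaves either a vanishing \<open>homog_sum\<close>,
    treated by \<open>congruence_torsion\<close>, or a matrix that was scalar from the
    beginning.\<close>
  have Lel: "(CHAR('k) > 0 \<and> eigen_pair A y y) \<or> A = mat y" if A: "A \<in> L" and e: "eigen_pair A x y" for A x y
  proof -
    obtain n c where n: "n > 0" "mpow A n = mat c" using tors A unfolding L_def K_def by blast
    from mpow_scalar_homog_sum[OF e n(2)] show ?thesis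
    proof
      assume "homog_sum x y n = 0"
      then show ?thesis using congruence_torsion[OF 1(2) _ 2(2) _ q e n(1)] A e unfolding L_def by auto
    next
      assume s: "A$1$2 = 0 \<and> A$2$1 = 0 \<and> A$1$1 = A$2$2"
      then have "(A$2$2 - y) * (A$2$2 - y) = y * y - (A$1$1 + A$2$2) * y + det A" by (simp add: det_2 algebra_simps)
      also have "\<dots> = y * y - (x + y) * y + x * y" using e by (simp add: eigen_pair_def)
      also have "\<dots> = 0" by (simp add: algebra_simps)
      finally show ?thesis using s by (simp add: mat2_eq_iff mat2_mat)
    qed
  qed
  have "\<exists>F. finite F \<and> (\<forall>A\<in>L. \<exists>B\<in>F. \<exists>c. c \<noteq> 0 \<and> A = mat c ** B)"
  proof (cases "CHAR('k) > 0")
    case False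
    have "\<exists>c. c \<noteq> 0 \<and> A = mat c ** mat 1" if A: "A \<in> L" for A
    proof -
      obtain x y where e: "eigen_pair A x y" using eigen_pair_exists by blast
      have "A = mat y" using Lel[OF A e] False by simp
      moreover have "y \<noteq> 0" using KD[of A] A calculation by (auto simp: L_def det_2 mat2_mat)
      ultimately show ?thesis by auto
    qed
    then show ?thesis by (intro exI[of _ "{mat 1}"]) auto
  next
    case True
    have Lu: "\<exists>y N. y \<noteq> 0 \<and> nilp N \<and> A = scaled_unipotent y N" if A: "A \<in> L" for A
    proof -
      obtain x y where e: "eigen_pair A x y" using eigen_pair_exists by blast
      have "y \<noteq> 0" using KD[of A] A e by (auto simp: L_def eigen_pair_def)
      moreover have "eigen_pair A y y" using Lel[OF A e] by (auto simp: eigen_pair_def det_2 mat2_mat)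
      ultimately show ?thesis using scaled_unipotent_of_eigen_pair by metis
    qed
    then obtain N0 where N0: "\<And>A. A \<in> L \<Longrightarrow> \<exists>y. y \<noteq> 0 \<and> nilp (N0 A) \<and> A = scaled_unipotent y (N0 A)" by metis
    obtain F where F: "finite F" "N0 ` S' \<subseteq> F" "0 \<in> F" "\<forall>a\<in>F. - a \<in> F" "\<forall>a\<in>F. \<forall>b\<in>F. a + b \<in> F"
      using finite_additive_closure[of "N0 ` S'"] S'(1) True by blast
    have gen: "\<exists>y N. y \<noteq> 0 \<and> nilp N \<and> N \<in> F \<and> A = scaled_unipotent y N" if "A \<in> generate GL2 S'" for A
      using that
    proof (induction rule: generate.induct)
      case one
      show ?case by (intro exI[of _ 1] exI[of _ 0]) (use F in \<open>auto simp: nilp_def GL2_simps mat2_eq_iff mat2_mat scaled_unipotent_entries\<close>)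
    next
      case (incl h)
      then have "h \<in> L" unfolding S'(3) by (rule generate.incl)
      then show ?case using N0[of h] F(2) incl by blast
    next
      case (inv h)
      then have "h \<in> L" unfolding S'(3) by (rule generate.incl)
      then obtain y where y: "y \<noteq> 0" "nilp (N0 h)" "h = scaled_unipotent y (N0 h)" using N0 by blast
      have "inv\<^bsub>GL2\<^esub> h = scaled_unipotent (1 / y) (- N0 h)"
        using minv_scaled_unipotent(1)[OF y(2,1)] inv S'(2) y(3) by (auto simp: carrier_GL2 inv_GL2)
      moreover have "- N0 h \<in> F" using F inv by blast
      ultimately show ?case using minv_scaled_unipotent(2)[OF y(2,1)] y(1)
        by (intro exI[of _ "1 / y"] exI[of _ "- N0 h"]) simp
    next
      case (eng A B)
      obtain x N where A: "x \<noteq> 0" "nilp N" "N \<in> F" "A = scaled_unipotent x N" using eng.IH by blast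
      obtain y M where B: "y \<noteq> 0" "nilp M" "M \<in> F" "B = scaled_unipotent y M" using eng.IH by blast
      have AL: "A \<in> L" "B \<in> L" "A ** B \<in> L"
        using eng subgroup.m_closed[OF L] unfolding S'(3)[symmetric] by (auto simp: GL2_simps)
      \<comment> \<open>The product again lies in \<open>L\<close> and so has a double eigenvalue;
        this is what forces the nilpotent parts to annihilate each other.\<close>
      obtain w where w: "eigen_pair (A ** B) w w"
        using Lu[OF AL(3)] eigen_pair_scaled_unipotent by metis
      have z: "N ** M = 0 \<and> M ** N = 0"
        using congruent_unipotent_product[OF 1(2) True A(2) B(2) A(1) B(1)] AL w A(4) B(4) unfolding L_def by blast
      have "A ** B = scaled_unipotent (x * y) (N + M)" "nilp (N + M)"
        using scaled_unipotent_mult[OF A(2) B(2)] z A(4) B(4) by auto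
      then show ?case using A(1,3) B(1,3) F(5)
        by (intro exI[of _ "x * y"] exI[of _ "N + M"]) (simp add: GL2_simps)
    qed
    show ?thesis
    proof (intro exI conjI ballI)
      show "finite ((\<lambda>N. mat 1 + N) ` F)" using F(1) by simp
      fix A assume "A \<in> L"
      then show "\<exists>B\<in>(\<lambda>N. mat 1 + N) ` F. \<exists>c. c \<noteq> 0 \<and> A = mat c ** B"
        using gen[of A] unfolding S'(3) scaled_unipotent_def by blast
    qed
  qed
  then obtain F where F: "finite F" "\<forall>A\<in>L. \<exists>B\<in>F. \<exists>c. c \<noteq> 0 \<and> A = mat c ** B" by blast
  show ?thesis
  proof (intro exI conjI ballI)
    show "finite ((\<lambda>(B, r). B ** r) ` (F \<times> R))" using F(1) R(1) by simp
    fix A assume "A \<in> generate GL2 S"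
    then have A: "A \<in> K" unfolding K_def .
    then obtain r where r: "r \<in> R" "A \<otimes>\<^bsub>GL2\<^esub> inv\<^bsub>GL2\<^esub> r \<in> L" using R(3) by blast
    then obtain B c where B: "B \<in> F" "c \<noteq> 0" "A \<otimes>\<^bsub>GL2\<^esub> inv\<^bsub>GL2\<^esub> r = mat c ** B" using F(2) by blast
    have "A \<in> carrier GL2" "r \<in> carrier GL2" using A r(1) R(2) subgroup.subset[OF K] by auto
    then have "A = (A \<otimes>\<^bsub>GL2\<^esub> inv\<^bsub>GL2\<^esub> r) \<otimes>\<^bsub>GL2\<^esub> r" by (simp add: GL.mult_inv_cancel)
    also have "\<dots> = mat c ** (B ** r)" unfolding B(3) by (simp add: GL2_simps matrix_mul_assoc)
    finally show "\<exists>B\<in>(\<lambda>(B, r). B ** r) ` (F \<times> R). \<exists>c. c \<noteq> 0 \<and> A = mat c ** B" using B r(1) by blast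
  qed
qed

section \<open>Group actions on restricted products\<close>

lemma (in group) inv_mult_cancel: "x \<in> carrier G \<Longrightarrow> y \<in> carrier G \<Longrightarrow> inv x \<otimes> (x \<otimes> y) = y"
  by (simp flip: m_assoc)

lemma (in group) subgroup_nat_pow_closed: "subgroup N G \<Longrightarrow> x \<in> N \<Longrightarrow> x [^] (n::nat) \<in> N"
  by (induction n) (auto intro: subgroup.one_closed subgroup.m_closed)

text \<open>A group acting on the trivial bundle \<open>P \<times> X \<rightarrow> P\<close>: \<open>\<pi>\<close> is the action on the base and \<open>t g p\<close>
  the map from the fibre over \<open>p\<close> to the fibre over \<open>\<pi> g p\<close>. The last two assumptions
  express that the stabilizer of a point acts decently on its fibre.\<close>

locale bundle_action = group G for G (structure) +
  fixes P :: "'p set" and X :: "'x set" and x0 :: 'x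
    and \<pi> :: "'a \<Rightarrow> 'p \<Rightarrow> 'p" and t :: "'a \<Rightarrow> 'p \<Rightarrow> 'x \<Rightarrow> 'x"
  assumes x0: "x0 \<in> X"
    and base_closed: "g \<in> carrier G \<Longrightarrow> p \<in> P \<Longrightarrow> \<pi> g p \<in> P"
    and base_one: "p \<in> P \<Longrightarrow> \<pi> \<one> p = p"
    and base_mult: "g \<in> carrier G \<Longrightarrow> h \<in> carrier G \<Longrightarrow> p \<in> P \<Longrightarrow> \<pi> (g \<otimes> h) p = \<pi> g (\<pi> h p)"
    and fibre_closed: "g \<in> carrier G \<Longrightarrow> p \<in> P \<Longrightarrow> x \<in> X \<Longrightarrow> t g p x \<in> X"
    and fibre_one: "p \<in> P \<Longrightarrow> x \<in> X \<Longrightarrow> t \<one> p x = x"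
    and fibre_mult: "g \<in> carrier G \<Longrightarrow> h \<in> carrier G \<Longrightarrow> p \<in> P \<Longrightarrow> x \<in> X \<Longrightarrow>
      t (g \<otimes> h) p x = t g (\<pi> h p) (t h p x)"
    and base_point: "g \<in> carrier G \<Longrightarrow> finite {p \<in> P. t g p x0 \<noteq> x0}"
    and stabilizer_finite_orbit: "p \<in> P \<Longrightarrow> subgroup L G \<Longrightarrow> (\<And>g. g \<in> L \<Longrightarrow> \<pi> g p = p) \<Longrightarrow> x \<in> X \<Longrightarrow>
      finite ((\<lambda>g. t g p x) ` L) \<Longrightarrow> \<exists>x\<in>X. \<forall>g\<in>L. t g p x = x"
    and stabilizer_elliptic: "p \<in> P \<Longrightarrow> finite S \<Longrightarrow> S \<subseteq> carrier G \<Longrightarrow>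
      (\<And>g. g \<in> generate G S \<Longrightarrow> \<pi> g p = p \<and> (\<exists>x\<in>X. t g p x = x)) \<Longrightarrow>
      \<exists>x\<in>X. \<forall>g\<in>generate G S. t g p x = x"
begin

section \<open>Sections and their transport\<close>

definition sections :: "('p \<Rightarrow> 'x) set" where
  "sections = restricted_product P (\<lambda>_. X) (\<lambda>_. x0)"

definition act :: "'a \<Rightarrow> ('p \<Rightarrow> 'x) \<Rightarrow> 'p \<Rightarrow> 'x" where
  "act g y = (\<lambda>q\<in>P. t g (\<pi> (inv g) q) (y (\<pi> (inv g) q)))"

definition fixes_section :: "'a \<Rightarrow> ('p \<Rightarrow> 'x) \<Rightarrow> bool" where
  "fixes_section g y \<longleftrightarrow> (\<forall>p\<in>P. t g p (y p) = y (\<pi> g p))"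

lemma base_inv [simp]: "g \<in> carrier G \<Longrightarrow> p \<in> P \<Longrightarrow> \<pi> (inv g) (\<pi> g p) = p"
  "g \<in> carrier G \<Longrightarrow> p \<in> P \<Longrightarrow> \<pi> g (\<pi> (inv g) p) = p"
  using base_mult[of "inv g" g p] base_mult[of g "inv g" p] base_one by auto

lemma base_inj: "g \<in> carrier G \<Longrightarrow> p \<in> P \<Longrightarrow> q \<in> P \<Longrightarrow> \<pi> g p = \<pi> g q \<Longrightarrow> p = q"
  using base_inv(1) by metis

lemma base_fixed_inv: "g \<in> carrier G \<Longrightarrow> p \<in> P \<Longrightarrow> \<pi> g p = p \<Longrightarrow> \<pi> (inv g) p = p"
  using base_inv(1) by metis

lemma fibre_inv: "g \<in> carrier G \<Longrightarrow> p \<in> P \<Longrightarrow> x \<in> X \<Longrightarrow> t (inv g) (\<pi> g p) (t g p x) = x"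
  using fibre_mult[of "inv g" g p x] fibre_one by simp

lemma fibre_inj: "g \<in> carrier G \<Longrightarrow> p \<in> P \<Longrightarrow> x \<in> X \<Longrightarrow> x' \<in> X \<Longrightarrow> t g p x = t g p x' \<Longrightarrow> x = x'"
  using fibre_inv by metis

lemma section_in: "y \<in> sections \<Longrightarrow> p \<in> P \<Longrightarrow> y p \<in> X"
  by (auto simp: sections_def restricted_product_def)

lemma section_support: "y \<in> sections \<Longrightarrow> finite {p \<in> P. y p \<noteq> x0}"
  by (simp add: sections_def restricted_product_def)

lemma sectionI: "(\<And>p. p \<in> P \<Longrightarrow> y p \<in> X) \<Longrightarrow> finite {p \<in> P. y p \<noteq> x0} \<Longrightarrow> restrict y P \<in> sections"
  by (auto simp: sections_def restricted_product_def elim!: rev_finite_subset)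

lemma section_eqI: "y \<in> sections \<Longrightarrow> z \<in> sections \<Longrightarrow> (\<And>p. p \<in> P \<Longrightarrow> y p = z p) \<Longrightarrow> y = z"
  unfolding sections_def restricted_product_def by (auto intro: PiE_ext)

lemma act_apply: "g \<in> carrier G \<Longrightarrow> p \<in> P \<Longrightarrow> act g y (\<pi> g p) = t g p (y p)"
  by (simp add: act_def base_closed)

lemma act_closed: assumes g: "g \<in> carrier G" and y: "y \<in> sections" shows "act g y \<in> sections"
  unfolding act_def
proof (rule sectionI)
  fix p assume "p \<in> P"
  then show "t g (\<pi> (inv g) p) (y (\<pi> (inv g) p)) \<in> X"
    using g y by (intro fibre_closed section_in base_closed) auto
next
  have "{p \<in> P. t g (\<pi> (inv g) p) (y (\<pi> (inv g) p)) \<noteq> x0} \<subseteq>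
    \<pi> g ` ({p \<in> P. y p \<noteq> x0} \<union> {p \<in> P. t g p x0 \<noteq> x0})"
  proof
    fix p assume p: "p \<in> {p \<in> P. t g (\<pi> (inv g) p) (y (\<pi> (inv g) p)) \<noteq> x0}"
    then have "\<pi> (inv g) p \<in> {p \<in> P. y p \<noteq> x0} \<union> {p \<in> P. t g p x0 \<noteq> x0}" using g base_closed by auto
    then have "\<pi> g (\<pi> (inv g) p) \<in> \<pi> g ` ({p \<in> P. y p \<noteq> x0} \<union> {p \<in> P. t g p x0 \<noteq> x0})" by (rule imageI)
    then show "p \<in> \<pi> g ` ({p \<in> P. y p \<noteq> x0} \<union> {p \<in> P. t g p x0 \<noteq> x0})" using p g by simp
  qed
  then show "finite {p \<in> P. t g (\<pi> (inv g) p) (y (\<pi> (inv g) p)) \<noteq> x0}"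
    by (rule finite_subset) (use section_support[OF y] base_point[OF g] in auto)
qed

lemma act_fixed_iff: assumes g: "g \<in> carrier G" and y: "y \<in> sections"
  shows "act g y = y \<longleftrightarrow> fixes_section g y"
proof
  assume "act g y = y"
  then show "fixes_section g y" using act_apply[OF g] unfolding fixes_section_def by metis
next
  assume f: "fixes_section g y"
  show "act g y = y"
  proof (rule section_eqI[OF act_closed[OF g y] y])
    fix p assume p: "p \<in> P"
    have "act g y (\<pi> g (\<pi> (inv g) p)) = y (\<pi> g (\<pi> (inv g) p))"
      using act_apply[OF g base_closed[of "inv g" p]] f g p base_closed[of "inv g" p] unfolding fixes_section_def by auto
    then show "act g y p = y p" using g p by simp
  qed
qed

lemma act_mult: assumes "g \<in> carrier G" "h \<in> carrier G" "y \<in> sections"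
  shows "act (g \<otimes> h) y = act g (act h y)"
proof (rule section_eqI)
  show "act (g \<otimes> h) y \<in> sections" "act g (act h y) \<in> sections" using assms act_closed by auto
  fix p assume p: "p \<in> P"
  define q where "q = \<pi> (inv (g \<otimes> h)) p"
  have q: "q \<in> P" "p = \<pi> (g \<otimes> h) q" using assms p base_closed by (auto simp: q_def)
  then show "act (g \<otimes> h) y p = act g (act h y) p"
    using assms act_apply[of "g \<otimes> h" q y] act_apply[of g "\<pi> h q" "act h y"] act_apply[of h q y]
    by (simp add: base_mult fibre_mult section_in base_closed)
qed

lemma fixes_section_mult:
  assumes "g \<in> carrier G" "h \<in> carrier G" "y \<in> sections" "fixes_section g y" "fixes_section h y"
  shows "fixes_section (g \<otimes> h) y"
  using assms unfolding fixes_section_def by (auto simp: fibre_mult base_mult base_closed section_in)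

lemma fixes_section_inv:
  assumes "g \<in> carrier G" "y \<in> sections" "fixes_section g y" shows "fixes_section (inv g) y"
  unfolding fixes_section_def
proof
  fix p assume p: "p \<in> P"
  define q where "q = \<pi> (inv g) p"
  have q: "q \<in> P" "p = \<pi> g q" using assms p base_closed by (auto simp: q_def)
  then show "t (inv g) p (y p) = y (\<pi> (inv g) p)"
    using assms fibre_inv[of g q "y q"] section_in unfolding fixes_section_def by auto
qed

lemma fixes_section_one: "y \<in> sections \<Longrightarrow> fixes_section \<one> y"
  unfolding fixes_section_def by (simp add: fibre_one base_one section_in)

lemma fixes_section_pow: "g \<in> carrier G \<Longrightarrow> y \<in> sections \<Longrightarrow> fixes_section g y \<Longrightarrow> fixes_section (g [^] (n::nat)) y"
  by (induction n) (auto intro: fixes_section_one fixes_section_mult)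

text \<open>A stabilizer-fixed value is chosen over one representative of each orbit and transported
  along the orbit. Nothing is claimed about the support; the lemma is meant for a finite set
  \<open>B\<close>.\<close>

lemma equivariant_section:
  assumes K: "subgroup K G" and B: "B \<subseteq> P" "\<And>g p. g \<in> K \<Longrightarrow> p \<in> B \<Longrightarrow> \<pi> g p \<in> B"
    and st: "\<And>p. p \<in> B \<Longrightarrow> \<exists>x\<in>X. \<forall>g\<in>K. \<pi> g p = p \<longrightarrow> t g p x = x"
  shows "\<exists>z. \<forall>p\<in>B. z p \<in> X \<and> (\<forall>g\<in>K. t g p (z p) = z (\<pi> g p))"
proof -
  have KG: "g \<in> carrier G" if "g \<in> K" for g using subgroup.subset[OF K] that by blast
  obtain c where c: "\<And>p. p \<in> B \<Longrightarrow> c p \<in> X \<and> (\<forall>g\<in>K. \<pi> g p = p \<longrightarrow> t g p (c p) = c p)" using st by metis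
  define O' where "O' p = {\<pi> g p |g. g \<in> K}" for p
  \<comment> \<open>The choice depends on the orbit as a set, so \<open>r\<close> is constant on
    orbits.\<close>
  define r where "r p = (SOME q. q \<in> O' p)" for p
  have rO: "r p \<in> O' p" if "p \<in> B" for p
  proof -
    have "p \<in> O' p" unfolding O'_def using subgroup.one_closed[OF K] base_one that B(1) by force
    then show ?thesis unfolding r_def by (rule someI)
  qed
  have O_inv: "O' (\<pi> g p) = O' p" if g: "g \<in> K" and p: "p \<in> B" for g p
  proof -
    have pP: "p \<in> P" using p B(1) by blast
    have "\<pi> h (\<pi> g p) = \<pi> (h \<otimes> g) p" "h \<otimes> g \<in> K" if "h \<in> K" for h
      using base_mult KG g that pP subgroup.m_closed[OF K] by auto
    moreover have "\<pi> h p = \<pi> (h \<otimes> inv g) (\<pi> g p)" "h \<otimes> inv g \<in> K" if "h \<in> K" for h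
      using KG g that pP subgroup.m_closed[OF K] subgroup.m_inv_closed[OF K] base_closed
      by (auto simp: base_mult)
    ultimately show ?thesis unfolding O'_def by (auto; metis)
  qed
  have "\<exists>g\<in>K. \<pi> g (r p) = p" if p: "p \<in> B" for p
  proof -
    obtain g where "g \<in> K" "r p = \<pi> g p" using rO[OF p] unfolding O'_def by blast
    then show ?thesis using KG subgroup.m_inv_closed[OF K] p B(1) by (intro bexI[of _ "inv g"]) auto
  qed
  then obtain w where w: "\<And>p. p \<in> B \<Longrightarrow> w p \<in> K \<and> \<pi> (w p) (r p) = p" by metis
  define z where "z p = t (w p) (r p) (c (r p))" for p
  have "z p \<in> X \<and> (\<forall>g\<in>K. t g p (z p) = z (\<pi> g p))" if p: "p \<in> B" for p
  proof (intro conjI ballI)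
    obtain g0 where "g0 \<in> K" "r p = \<pi> g0 p" using rO[OF p] unfolding O'_def by blast
    then have rB: "r p \<in> B" using B(2)[OF _ p] by simp
    then have rP: "r p \<in> P" using B(1) by blast
    have wp: "w p \<in> carrier G" "w p \<in> K" "\<pi> (w p) (r p) = p" using w[OF p] KG by auto
    have cX: "c (r p) \<in> X" using c[OF rB] by blast
    show "z p \<in> X" unfolding z_def using fibre_closed[OF wp(1) rP cX] .
    fix g assume g: "g \<in> K"
    define q where "q = \<pi> g p"
    have q: "q \<in> B" "r q = r p" unfolding q_def r_def using B(2)[OF g p] O_inv[OF g p] by auto
    have wq: "w q \<in> carrier G" "w q \<in> K" "\<pi> (w q) (r p) = q" using w[OF q(1)] KG q(2) by auto
    \<comment> \<open>Two transports to the same point differ by \<open>k\<close>, which stabilizes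
      the representative and hence fixes the chosen value there.\<close>
    define k where "k = inv (w q) \<otimes> (g \<otimes> w p)"
    have gG: "g \<in> carrier G" using KG[OF g] .
    have k: "k \<in> K" "w q \<otimes> k = g \<otimes> w p"
      unfolding k_def using subgroup.m_closed[OF K] subgroup.m_inv_closed[OF K] g wp wq gG
      by (auto simp flip: m_assoc)
    have "\<pi> k (r p) = \<pi> (inv (w q)) (\<pi> g (\<pi> (w p) (r p)))"
      unfolding k_def using wp(1) wq(1) gG rP by (simp add: base_mult base_closed)
    also have "\<dots> = \<pi> (inv (w q)) (\<pi> (w q) (r p))" unfolding wp(3) wq(3) q_def[symmetric] ..
    also have "\<dots> = r p" using wq(1) rP by simp
    finally have kr: "\<pi> k (r p) = r p" .
    then have ck: "t k (r p) (c (r p)) = c (r p)" using c[OF rB] k(1) by blast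
    have "t g p (z p) = t (g \<otimes> w p) (r p) (c (r p))"
      unfolding z_def using fibre_mult[OF gG wp(1) rP cX] wp(3) by simp
    also have "\<dots> = t (w q) (\<pi> k (r p)) (t k (r p) (c (r p)))"
      unfolding k(2)[symmetric] using fibre_mult[OF wq(1) KG[OF k(1)] rP cX] .
    also have "\<dots> = z q" unfolding z_def kr ck q(2) ..
    finally show "t g p (z p) = z (\<pi> g p)" unfolding q_def .
  qed
  then show ?thesis by blast
qed

text \<open>The values of the finite orbit at \<open>p\<close> form a finite set \<open>A p\<close>, invariant under the stabilizer.
  Where it is a singleton, the fixed section takes this value; elsewhere there are only finitely
  many points, so the support is not an issue.\<close>

theorem finite_orbit_fixed_section:
  assumes K: "subgroup K G" and y: "y \<in> sections" and fin: "finite ((\<lambda>g. act g y) ` K)"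
  shows "\<exists>z\<in>sections. \<forall>g\<in>K. fixes_section g z"
proof -
  have KG: "g \<in> carrier G" if "g \<in> K" for g using subgroup.subset[OF K] that by blast
  define A where "A p = (\<lambda>g. act g y p) ` K" for p
  \<comment> \<open>The union of the supports of all sections in the orbit, finite because the orbit
    is. Outside \<open>D\<close> the set \<open>A p\<close> is \<open>{x0}\<close>, so every point
    of \<open>B\<close> lies in \<open>D\<close>.\<close>
  define D where "D = {p \<in> P. \<exists>g\<in>K. act g y p \<noteq> x0}"
  have "D \<subseteq> (\<Union>f\<in>(\<lambda>g. act g y) ` K. {p \<in> P. f p \<noteq> x0})" unfolding D_def by blast
  moreover have "finite (\<Union>f\<in>(\<lambda>g. act g y) ` K. {p \<in> P. f p \<noteq> x0})"
    by (rule finite_UN_I[OF fin]) (use section_support act_closed[OF KG y] in auto)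
  ultimately have finD: "finite D" using finite_subset by blast
  have A_fin: "finite (A p)" for p
  proof -
    have "A p = (\<lambda>f. f p) ` (\<lambda>g. act g y) ` K" unfolding A_def by (simp add: image_image)
    then show ?thesis using fin by simp
  qed
  have A_ne: "A p \<noteq> {}" for p unfolding A_def using subgroup.one_closed[OF K] by blast
  have A_X: "A p \<subseteq> X" if "p \<in> P" for p
    unfolding A_def using section_in[OF act_closed[OF KG y] that] by auto
  have A_map: "A (\<pi> g p) = t g p ` A p" if g: "g \<in> K" and p: "p \<in> P" for g p
  proof -
    have e: "act (g \<otimes> h) y (\<pi> g p) = t g p (act h y p)" "g \<otimes> h \<in> K" if "h \<in> K" for h
      using act_mult[OF KG[OF g] KG[OF that] y] act_apply[OF KG[OF g] p] subgroup.m_closed[OF K g that] by auto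
    have i: "h = g \<otimes> (inv g \<otimes> h)" "inv g \<otimes> h \<in> K" if "h \<in> K" for h
      using KG g that subgroup.m_closed[OF K] subgroup.m_inv_closed[OF K] by (auto simp flip: m_assoc)
    show ?thesis
    proof
      show "A (\<pi> g p) \<subseteq> t g p ` A p"
      proof
        fix x assume "x \<in> A (\<pi> g p)"
        then obtain h where h: "h \<in> K" "x = act h y (\<pi> g p)" unfolding A_def by blast
        have "x = t g p (act (inv g \<otimes> h) y p)" using e(1)[OF i(2)[OF h(1)]] i(1)[OF h(1)] h(2) by simp
        then show "x \<in> t g p ` A p" unfolding A_def using i(2)[OF h(1)] by blast
      qed
      show "t g p ` A p \<subseteq> A (\<pi> g p)"
      proof
        fix x assume "x \<in> t g p ` A p"
        then obtain h where h: "h \<in> K" "x = t g p (act h y p)" unfolding A_def by blast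
        then show "x \<in> A (\<pi> g p)" unfolding A_def using e[OF h(1)] by (intro image_eqI[of _ _ "g \<otimes> h"]) auto
      qed
    qed
  qed
  define B where "B = {p \<in> P. \<nexists>a. A p = {a}}"
  have "p \<in> D" if p: "p \<in> B" for p
  proof (rule ccontr)
    assume "p \<notin> D"
    then have "A p \<subseteq> {x0}" using p unfolding D_def B_def A_def by auto
    then have "A p = {x0}" using A_ne by blast
    then show False using p unfolding B_def by blast
  qed
  then have "B \<subseteq> D" by (rule subsetI)
  then have finB: "finite B" by (rule finite_subset) (rule finD)
  have sing: "A (\<pi> g p) = {t g p a}" if "g \<in> K" "p \<in> P" "A p = {a}" for g p a
    using A_map[OF that(1,2)] that(3) by simp
  have Binv: "\<pi> g p \<in> B" if g: "g \<in> K" and p: "p \<in> B" for g p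
  proof (rule ccontr)
    have pP: "p \<in> P" using p B_def by blast
    have qP: "\<pi> g p \<in> P" using base_closed[OF KG[OF g] pP] .
    assume "\<pi> g p \<notin> B"
    then obtain a where "A (\<pi> g p) = {a}" using qP unfolding B_def by blast
    from sing[OF subgroup.m_inv_closed[OF K g] qP this] KG[OF g] pP
    have "A p = {t (inv g) (\<pi> g p) a}" by simp
    then show False using p unfolding B_def by blast
  qed
  have stab: "\<exists>x\<in>X. \<forall>g\<in>K. \<pi> g p = p \<longrightarrow> t g p x = x" if p: "p \<in> B" for p
  proof -
    have pP: "p \<in> P" using p B_def by blast
    define L where "L = {g \<in> K. \<pi> g p = p}"
    have L: "subgroup L G"
    proof (rule subgroupI)
      show "L \<subseteq> carrier G" using KG unfolding L_def by blast
      show "L \<noteq> {}" using subgroup.one_closed[OF K] base_one[OF pP] unfolding L_def by blast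
      fix a b assume a: "a \<in> L"
      then show "inv a \<in> L" using subgroup.m_inv_closed[OF K] base_fixed_inv KG pP unfolding L_def by blast
      assume "b \<in> L"
      then show "a \<otimes> b \<in> L" using a subgroup.m_closed[OF K] KG pP unfolding L_def by (auto simp: base_mult)
    qed
    \<comment> \<open>The stabilizer has a finite orbit in the fibre, which is where the first
      decency condition for the fibre enters.\<close>
    have "(\<lambda>g. t g p (y p)) ` L \<subseteq> A p"
      using act_apply[OF KG pP, of _ y] unfolding L_def A_def by (auto; metis image_eqI)
    then have "finite ((\<lambda>g. t g p (y p)) ` L)" using A_fin finite_subset by blast
    from stabilizer_finite_orbit[OF pP L _ section_in[OF y pP] this] show ?thesis unfolding L_def by blast
  qed
  obtain z where z: "\<And>p. p \<in> B \<Longrightarrow> z p \<in> X \<and> (\<forall>g\<in>K. t g p (z p) = z (\<pi> g p))"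
    using equivariant_section[OF K _ Binv stab] unfolding B_def by blast
  define z' where "z' p = (if p \<in> B then z p else the_elem (A p))" for p
  have z'A: "A p = {z' p}" if H: "p \<in> P" "p \<notin> B" for p
  proof -
    obtain a where "A p = {a}" using H unfolding B_def by blast
    then show ?thesis using H(2) by (simp add: z'_def)
  qed
  have "restrict z' P \<in> sections"
  proof (rule sectionI)
    fix p assume p: "p \<in> P"
    show "z' p \<in> X"
    proof (cases "p \<in> B")
      case True then show ?thesis using z by (simp add: z'_def)
    next
      case False then show ?thesis using z'A[OF p] A_X[OF p] by blast
    qed
  next
    have "{p \<in> P. z' p \<noteq> x0} \<subseteq> B \<union> D"
    proof
      fix p assume p: "p \<in> {p \<in> P. z' p \<noteq> x0}"
      show "p \<in> B \<union> D"
      proof (cases "p \<in> B")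
        case False
        then have "z' p \<in> A p" using z'A p by blast
        then show ?thesis using p unfolding A_def D_def by auto
      qed simp
    qed
    then show "finite {p \<in> P. z' p \<noteq> x0}" by (rule finite_subset) (use finB finD in simp)
  qed
  moreover have "fixes_section g (restrict z' P)" if g: "g \<in> K" for g
    unfolding fixes_section_def
  proof
    fix p assume p: "p \<in> P"
    have qP: "\<pi> g p \<in> P" using base_closed[OF KG[OF g] p] .
    have "t g p (z' p) = z' (\<pi> g p)"
    proof (cases "p \<in> B")
      case True
      then show ?thesis using z[OF True] Binv[OF g True] g by (simp add: z'_def)
    next
      case False
      have "A (\<pi> g p) = {t g p (z' p)}" using sing[OF g p z'A[OF p False]] .
      moreover have "\<pi> g p \<notin> B" using calculation unfolding B_def by blast
      ultimately show ?thesis using z'A[OF qP] by simp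
    qed
    then show "t g p (restrict z' P p) = restrict z' P (\<pi> g p)" using p qP by simp
  qed
  ultimately show ?thesis by blast
qed

text \<open>A section fixed by \<open>L\<close> has a finite orbit under \<open>K\<close>, so the
  finite-orbit case applies. The transversal is applied to \<open>inv g\<close> because the cosets
  are of the form \<open>L r\<close> while \<open>L\<close> has to act on \<open>z\<close>
  first.\<close>

lemma finite_index_fixed_section:
  assumes K: "subgroup K G" and f: "finite (f ` K)"
    and cos: "\<And>x y. x \<in> K \<Longrightarrow> y \<in> K \<Longrightarrow> f x = f y \<Longrightarrow> x \<otimes> inv y \<in> L"
    and L: "subgroup L G" and z: "z \<in> sections" "\<And>g. g \<in> L \<Longrightarrow> fixes_section g z"
  shows "\<exists>z\<in>sections. \<forall>g\<in>K. fixes_section g z"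
proof -
  have KG: "g \<in> carrier G" if "g \<in> K" for g using subgroup.subset[OF K] that by blast
  obtain R where R: "finite R" "R \<subseteq> K" "\<And>x. x \<in> K \<Longrightarrow> \<exists>r\<in>R. x \<otimes> inv r \<in> L"
    by (rule finite_index_transversal[OF K f cos]) auto
  have "(\<lambda>g. act g z) ` K \<subseteq> (\<lambda>r. act (inv r) z) ` R"
  proof
    fix a assume "a \<in> (\<lambda>g. act g z) ` K"
    then obtain g where g: "g \<in> K" "a = act g z" by blast
    obtain r where r: "r \<in> R" "inv g \<otimes> inv r \<in> L" using R(3)[OF subgroup.m_inv_closed[OF K g(1)]] by blast
    have G: "g \<in> carrier G" "r \<in> carrier G" using KG g r R(2) by auto
    define l where "l = r \<otimes> g"
    have "inv (inv g \<otimes> inv r) \<in> L" using subgroup.m_inv_closed[OF L r(2)] .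
    then have l: "l \<in> L" using G by (simp add: l_def inv_mult_group)
    have lG: "l \<in> carrier G" using G l_def by auto
    have "g = inv r \<otimes> l" using G by (simp add: l_def flip: m_assoc)
    then have "act g z = act (inv r) (act l z)" using act_mult[OF _ lG z(1), of "inv r"] G by simp
    also have "act l z = z" using act_fixed_iff[OF lG z(1)] z(2)[OF l] by blast
    finally show "a \<in> (\<lambda>r. act (inv r) z) ` R" using g r by blast
  qed
  then have "finite ((\<lambda>g. act g z) ` K)" using R(1) finite_subset by blast
  from finite_orbit_fixed_section[OF K z(1) this] show ?thesis .
qed

end

text \<open>Along the word \<open>v = b\<^sup>-\<^sup>m a\<^sup>-\<^sup>n b\<^sup>m a\<^sup>k\<close> in \<open>N\<close>, the walk \<open>\<dots>, p, a\<^sup>k p, b\<^sup>m a\<^sup>k p, a\<^sup>-\<^sup>n b\<^sup>m a\<^sup>k p, v p, \<dots>\<close> meets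
  \<open>insert p E\<close> only in its starting point.\<close>

definition (in monoid) separates :: "('a \<Rightarrow> 'p \<Rightarrow> 'p) \<Rightarrow> 'a \<Rightarrow> 'a \<Rightarrow> 'p \<Rightarrow> 'p set \<Rightarrow> nat \<Rightarrow> nat \<Rightarrow> nat \<Rightarrow> bool" where
  "separates \<psi> a b p E n m k \<longleftrightarrow>
    (\<exists>N. subgroup N G \<and> inv (b [^] m) \<otimes> (inv (a [^] n) \<otimes> (b [^] m \<otimes> a [^] k)) \<in> N \<and>
      (\<forall>c\<in>N. \<psi> c p \<notin> E \<and> \<psi> (a [^] k) (\<psi> c p) \<notin> insert p E \<and>
        \<psi> (b [^] m) (\<psi> (a [^] k) (\<psi> c p)) \<notin> insert p E \<and>
        \<psi> (inv (a [^] n)) (\<psi> (b [^] m) (\<psi> (a [^] k) (\<psi> c p))) \<notin> insert p E)) \<and>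
    (\<forall>j>0. \<psi> ((inv (b [^] m) \<otimes> (inv (a [^] n) \<otimes> (b [^] m \<otimes> a [^] k))) [^] (j::nat)) p \<noteq> p)"

text \<open>The facts about the projective group that the fixed-section argument consumes: finitely
  generated torsion subgroups are finite, an element of infinite order has finitely many fixed
  points and no further periodic ones, and separating words exist.\<close>

locale tame_bundle_action = bundle_action G P X x0 \<pi> t + H: group H
  for G (structure) and P :: "'p set" and X :: "'x set" and x0 \<pi> t and H :: "('h, 's) monoid_scheme" +
  fixes \<sigma> :: "'a \<Rightarrow> 'h" and \<psi> :: "'h \<Rightarrow> 'p \<Rightarrow> 'p"
  assumes \<sigma>: "\<sigma> \<in> hom G H" and \<pi>: "g \<in> carrier G \<Longrightarrow> p \<in> P \<Longrightarrow> \<pi> g p = \<psi> (\<sigma> g) p"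
    and torsion_finite: "finite S \<Longrightarrow> S \<subseteq> carrier H \<Longrightarrow>
      (\<And>h. h \<in> generate H S \<Longrightarrow> \<exists>n>0. h [^]\<^bsub>H\<^esub> (n::nat) = \<one>\<^bsub>H\<^esub>) \<Longrightarrow> finite (generate H S)"
    and fixed_points: "h \<in> carrier H \<Longrightarrow> (\<And>n. n > 0 \<Longrightarrow> h [^]\<^bsub>H\<^esub> (n::nat) \<noteq> \<one>\<^bsub>H\<^esub>) \<Longrightarrow>
      finite {p \<in> P. \<psi> h p = p} \<and> (\<forall>n::nat. n > 0 \<longrightarrow> (\<forall>p\<in>P. \<psi> (h [^]\<^bsub>H\<^esub> n) p = p \<longrightarrow> \<psi> h p = p))"
    and separates: "a \<in> carrier H \<Longrightarrow> b \<in> carrier H \<Longrightarrow> p \<in> P \<Longrightarrow>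
      (\<And>n. n > 0 \<Longrightarrow> \<psi> (a [^]\<^bsub>H\<^esub> (n::nat)) p \<noteq> p) \<Longrightarrow> (\<And>n. n > 0 \<Longrightarrow> \<psi> (b [^]\<^bsub>H\<^esub> (n::nat)) p \<noteq> p) \<Longrightarrow>
      finite E \<Longrightarrow> E \<subseteq> P \<Longrightarrow> p \<notin> E \<Longrightarrow>
      \<exists>n m k. H.separates \<psi> a b p E n m k \<or> H.separates \<psi> b a p E n m k"
begin

sublocale hom: group_hom G H \<sigma>
  using \<sigma> by unfold_locales

lemma iterate_base_inj:
  assumes v: "v \<in> carrier G" and p: "p \<in> P" and np: "\<And>j. j > 0 \<Longrightarrow> \<pi> (v [^] (j::nat)) p \<noteq> p"
  shows "inj (\<lambda>i::nat. \<pi> (v [^] i) p)"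
proof (rule linorder_injI)
  fix i j :: nat assume "i < j"
  then obtain k where k: "i + k = j" "k > 0" using less_imp_add_positive by blast
  show "\<pi> (v [^] i) p \<noteq> \<pi> (v [^] j) p"
  proof
    assume "\<pi> (v [^] i) p = \<pi> (v [^] j) p"
    then have "\<pi> (v [^] i) p = \<pi> (v [^] i) (\<pi> (v [^] k) p)"
      using v p by (simp add: k(1)[symmetric] base_mult flip: nat_pow_mult)
    then show False using base_inj[of "v [^] i" p "\<pi> (v [^] k) p"] v p base_closed np[OF k(2)] by auto
  qed
qed

text \<open>The transport along the word \<open>v\<close> turns \<open>y\<close> into \<open>y'\<close>, because \<open>y\<close> and \<open>y'\<close> agree at all
  intermediate points. Walking along the orbit of \<open>p\<close> from infinity in either direction, a fixed
  section of \<open>v\<close> must agree at \<open>p\<close> both with \<open>y\<close> and with \<open>y'\<close>.\<close>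

lemma separated_sections_agree:
  assumes ab: "a \<in> carrier G" "b \<in> carrier G" and y: "y \<in> sections" "y' \<in> sections"
    and fy: "fixes_section a y" and fy': "fixes_section b y'" and p: "p \<in> P"
    and sep: "H.separates \<psi> (\<sigma> a) (\<sigma> b) p ({q \<in> P. y q \<noteq> y' q} - {p}) n m k"
    and ell: "\<exists>z\<in>sections. fixes_section (inv (b [^] m) \<otimes> (inv (a [^] n) \<otimes> (b [^] m \<otimes> a [^] k))) z"
  shows "y p = y' p"
proof -
  define E where "E = {q \<in> P. y q \<noteq> y' q} - {p}"
  define v where "v = inv (b [^] m) \<otimes> (inv (a [^] n) \<otimes> (b [^] m \<otimes> a [^] k))"
  have vG: "v \<in> carrier G" unfolding v_def using ab by simp
  have \<sigma>v: "\<sigma> v = inv\<^bsub>H\<^esub> (\<sigma> b [^]\<^bsub>H\<^esub> m) \<otimes>\<^bsub>H\<^esub> (inv\<^bsub>H\<^esub> (\<sigma> a [^]\<^bsub>H\<^esub> n) \<otimes>\<^bsub>H\<^esub> (\<sigma> b [^]\<^bsub>H\<^esub> m \<otimes>\<^bsub>H\<^esub> \<sigma> a [^]\<^bsub>H\<^esub> k))"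
    unfolding v_def using ab by (simp add: hom.hom_nat_pow)
  obtain N where N: "subgroup N H" "\<sigma> v \<in> N"
    and path: "\<And>c. c \<in> N \<Longrightarrow> \<psi> c p \<notin> E \<and> \<psi> (\<sigma> a [^]\<^bsub>H\<^esub> k) (\<psi> c p) \<notin> insert p E \<and>
        \<psi> (\<sigma> b [^]\<^bsub>H\<^esub> m) (\<psi> (\<sigma> a [^]\<^bsub>H\<^esub> k) (\<psi> c p)) \<notin> insert p E \<and>
        \<psi> (inv\<^bsub>H\<^esub> (\<sigma> a [^]\<^bsub>H\<^esub> n)) (\<psi> (\<sigma> b [^]\<^bsub>H\<^esub> m) (\<psi> (\<sigma> a [^]\<^bsub>H\<^esub> k) (\<psi> c p))) \<notin> insert p E"
    and np: "\<And>j::nat. j > 0 \<Longrightarrow> \<psi> (\<sigma> v [^]\<^bsub>H\<^esub> j) p \<noteq> p"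
    using sep unfolding H.separates_def E_def[symmetric] \<sigma>v[symmetric] by blast
  obtain z where z: "z \<in> sections" "fixes_section v z" using ell unfolding v_def by blast
  define u1 u2 u3 u4 where "u1 = a [^] k" and "u2 = b [^] m" and "u3 = inv (a [^] n)" and "u4 = inv (b [^] m)"
  have uG: "u1 \<in> carrier G" "u2 \<in> carrier G" "u3 \<in> carrier G" "u4 \<in> carrier G"
    using ab by (auto simp: u1_def u2_def u3_def u4_def)
  have uf: "fixes_section u1 y" "fixes_section u2 y'" "fixes_section u3 y" "fixes_section u4 y'"
    unfolding u1_def u2_def u3_def u4_def
    using ab y fy fy' by (auto intro: fixes_section_pow fixes_section_inv)
  have v: "v = u4 \<otimes> (u3 \<otimes> (u2 \<otimes> u1))" by (simp add: v_def u1_def u2_def u3_def u4_def)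
  have step: "t v r (y r) = y' (\<pi> v r)" if c: "c \<in> carrier G" "\<sigma> c \<in> N" and r: "r = \<pi> c p" for c r
  proof -
    have rP: "r \<in> P" using r base_closed[OF c(1) p] by simp
    define r1 r2 r3 where "r1 = \<pi> u1 r" and "r2 = \<pi> u2 r1" and "r3 = \<pi> u3 r2"
    have rsP: "r1 \<in> P" "r2 \<in> P" "r3 \<in> P" using rP uG base_closed by (auto simp: r1_def r2_def r3_def)
    have "r1 \<notin> insert p E" "r2 \<notin> insert p E" "r3 \<notin> insert p E"
      using path[OF c(2)] \<pi>[OF c(1) p] \<pi>[OF uG(1) rP] \<pi>[OF uG(2) rsP(1)] \<pi>[OF uG(3) rsP(2)] ab
      by (auto simp: r1_def r2_def r3_def r u1_def u2_def u3_def hom.hom_nat_pow)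
    then have eq: "y r1 = y' r1" "y r2 = y' r2" "y r3 = y' r3" using rsP unfolding E_def by auto
    have X: "y r \<in> X" "y r1 \<in> X" "y' r2 \<in> X" "y r3 \<in> X" using section_in y rP rsP by auto
    have e1: "t u1 r (y r) = y r1" "t u2 r1 (y' r1) = y' r2" "t u3 r2 (y r2) = y r3" "t u4 r3 (y' r3) = y' (\<pi> u4 r3)"
      using uf rP rsP unfolding fixes_section_def by (auto simp: r1_def r2_def r3_def)
    have "t v r (y r) = t u4 (\<pi> (u3 \<otimes> (u2 \<otimes> u1)) r) (t (u3 \<otimes> (u2 \<otimes> u1)) r (y r))"
      unfolding v using uG rP X by (intro fibre_mult) auto
    also have "\<pi> (u3 \<otimes> (u2 \<otimes> u1)) r = r3" using uG rP rsP by (simp add: base_mult r1_def r2_def r3_def)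
    also have "t (u3 \<otimes> (u2 \<otimes> u1)) r (y r) = t u3 (\<pi> (u2 \<otimes> u1) r) (t (u2 \<otimes> u1) r (y r))"
      using uG rP X by (intro fibre_mult) auto
    also have "\<pi> (u2 \<otimes> u1) r = r2" using uG rP by (simp add: base_mult r1_def r2_def)
    also have "t (u2 \<otimes> u1) r (y r) = t u2 r1 (t u1 r (y r))"
      unfolding r1_def using uG rP X by (intro fibre_mult) auto
    also have "t u4 r3 (t u3 r2 (t u2 r1 (t u1 r (y r)))) = y' (\<pi> u4 r3)"
      using e1 eq by simp
    also have "\<pi> u4 r3 = \<pi> v r" unfolding v using uG rP by (simp add: base_mult base_closed r1_def r2_def r3_def)
    finally show ?thesis .
  qed
  have pv: "\<pi> (v [^] j) p \<noteq> p" if "j > 0" for j :: nat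
    using np[OF that] \<pi>[of "v [^] j" p] vG p by (simp add: hom.hom_nat_pow)
  define W where "W = {q \<in> P. y q \<noteq> x0} \<union> {q \<in> P. y' q \<noteq> x0} \<union> {q \<in> P. z q \<noteq> x0}"
  have finW: "finite W" unfolding W_def using section_support y z by auto
  \<comment> \<open>Outside \<open>W\<close> all three sections equal \<open>x0\<close>. An infinite
    orbit leaves the finite set \<open>W\<close>, and this provides the starting point of both
    walks.\<close>
  have far: "\<exists>i. r (Suc i) \<notin> W" if "inj r" for r :: "nat \<Rightarrow> 'p"
  proof (rule ccontr)
    assume "\<not> ?thesis"
    then have "(\<lambda>i. r (Suc i)) ` UNIV \<subseteq> W" by blast
    then have "finite (range (\<lambda>i. r (Suc i)))" using finW finite_subset by blast
    moreover have "inj (\<lambda>i. r (Suc i))" using that unfolding inj_def by blast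
    ultimately show False using finite_imageD infinite_UNIV_nat by blast
  qed
  have Wz: "z q = y q \<and> z q = y' q" if "q \<in> P" "q \<notin> W" for q using that unfolding W_def by auto
  have agree: "y q = y' q" if c: "c \<in> carrier G" "\<sigma> c \<in> N" and q: "q = \<pi> c p" "q \<noteq> p" for c q
    using path[OF c(2)] \<pi>[OF c(1) p] base_closed[OF c(1) p] q unfolding E_def by auto
  have vz: "z (\<pi> v r) = t v r (z r)" if "r \<in> P" for r using z(2) that unfolding fixes_section_def by simp
  have "z p = y p"
  proof -
    define r where "r i = \<pi> (v [^] i) p" for i :: nat
    have pw: "v [^] i \<in> carrier G" "\<sigma> (v [^] i) \<in> N" for i :: nat
      using vG N by (auto simp: hom.hom_nat_pow intro: H.subgroup_nat_pow_closed)
    have rP: "r i \<in> P" for i unfolding r_def using base_closed[OF pw(1) p] .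
    have rS: "r (Suc i) = \<pi> v (r i)" for i
    proof -
      have "v [^] Suc i = v \<otimes> v [^] i" using vG nat_pow_Suc2 by simp
      then show ?thesis unfolding r_def using base_mult[OF vG pw(1) p] by simp
    qed
    \<comment> \<open>By injectivity of the transport, agreement with \<open>y'\<close> after
      \<open>v\<close> gives agreement with \<open>y\<close> before. At orbit points other than
      \<open>p\<close> the sections \<open>y\<close> and \<open>y'\<close> coincide, so the step can
      be repeated down to \<open>p\<close>.\<close>
    have bwd: "z (r i) = y (r i)" if "z (r (Suc i)) = y' (r (Suc i))" for i
    proof -
      have "t v (r i) (z (r i)) = t v (r i) (y (r i))"
        using that step[OF pw r_def] vz[OF rP] unfolding rS by simp
      then show ?thesis using fibre_inj[OF vG rP section_in[OF z(1) rP] section_in[OF y(1) rP]] by blast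
    qed
    obtain i where i: "r (Suc i) \<notin> W" using far[of r] iterate_base_inj[OF vG p pv] unfolding r_def by blast
    have "z (r j) = y (r j)" if "z (r (Suc i)) = y' (r (Suc i))" "j \<le> i" for i j
      using that
    proof (induction i)
      case 0 then show ?case using bwd by simp
    next
      case (Suc i)
      have "z (r (Suc i)) = y (r (Suc i))" using bwd Suc.prems(1) by blast
      also have "\<dots> = y' (r (Suc i))" using agree[OF pw, of "r (Suc i)" "Suc i"] pv unfolding r_def by blast
      finally have *: "z (r (Suc i)) = y' (r (Suc i))" .
      show ?case
      proof (cases "j = Suc i")
        case True then show ?thesis using bwd Suc.prems(1) by blast
      next
        case False then show ?thesis using Suc.IH[OF *] Suc.prems(2) by simp
      qed
    qed
    moreover have "z (r (Suc i)) = y' (r (Suc i))" using Wz[OF rP i] by blast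
    ultimately have "z (r 0) = y (r 0)" by blast
    then show ?thesis using base_one[OF p] by (simp add: r_def)
  qed
  moreover have "z p = y' p"
  proof -
    \<comment> \<open>The other half of the orbit: here \<open>v\<close> leads towards
      \<open>p\<close>, and transport forwards turns agreement with \<open>y\<close> into agreement
      with \<open>y'\<close>.\<close>
    define w where "w = inv v"
    have wG: "w \<in> carrier G" using vG w_def by simp
    define r where "r i = \<pi> (w [^] i) p" for i :: nat
    have wN: "\<sigma> w \<in> N" unfolding w_def using vG subgroup.m_inv_closed[OF N] by simp
    have pw: "w [^] i \<in> carrier G" "\<sigma> (w [^] i) \<in> N" for i :: nat
      using wG N(1) wN by (auto simp: hom.hom_nat_pow intro: H.subgroup_nat_pow_closed)
    have rP: "r i \<in> P" for i unfolding r_def using base_closed[OF pw(1) p] .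
    have rS: "\<pi> v (r (Suc i)) = r i" for i
    proof -
      have "w [^] Suc i = w \<otimes> w [^] i" using wG nat_pow_Suc2 by simp
      then have "r (Suc i) = \<pi> w (r i)" unfolding r_def using base_mult[OF wG pw(1) p] by simp
      then show ?thesis using vG rP by (simp add: w_def)
    qed
    have fwd: "z (r i) = y' (r i)" if "z (r (Suc i)) = y (r (Suc i))" for i
      using vz[OF rP, of "Suc i"] step[OF pw r_def, of "Suc i"] that unfolding rS by simp
    have pw': "\<pi> (w [^] j) p \<noteq> p" if "j > 0" for j :: nat
    proof
      assume "\<pi> (w [^] j) p = p"
      then have "\<pi> (inv (w [^] j)) p = p" using base_fixed_inv[OF pw(1) p] by blast
      moreover have "inv (w [^] j) = v [^] j" unfolding w_def using vG by (simp add: nat_pow_inv)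
      ultimately show False using pv[OF that] by simp
    qed
    obtain i where i: "r (Suc i) \<notin> W" using far[of r] iterate_base_inj[OF wG p pw'] unfolding r_def by blast
    have "z (r j) = y' (r j)" if "z (r (Suc i)) = y (r (Suc i))" "j \<le> i" for i j
      using that
    proof (induction i)
      case 0 then show ?case using fwd by simp
    next
      case (Suc i)
      have "z (r (Suc i)) = y' (r (Suc i))" using fwd Suc.prems(1) by blast
      also have "\<dots> = y (r (Suc i))"
        using agree[OF pw, of "r (Suc i)" "Suc i"] pw'[of "Suc i"] unfolding r_def by (metis zero_less_Suc)
      finally have *: "z (r (Suc i)) = y (r (Suc i))" .
      show ?case
      proof (cases "j = Suc i")
        case True then show ?thesis using fwd Suc.prems(1) by blast
      next
        case False then show ?thesis using Suc.IH[OF *] Suc.prems(2) by simp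
      qed
    qed
    moreover have "z (r (Suc i)) = y (r (Suc i))" using Wz[OF rP i] by blast
    ultimately have "z (r 0) = y' (r 0)" by blast
    then show ?thesis using base_one[OF p] by (simp add: r_def)
  qed
  ultimately show ?thesis by simp
qed

text \<open>A point moved by an element of infinite order is moved by all its positive powers, and
  finite support makes the disagreement set finite, so a separating word exists. It lies in
  \<open>K\<close> and thus has a fixed section; the two possible orders of \<open>a\<close> and
  \<open>b\<close> are symmetric.\<close>

lemma infinite_order_sections_agree:
  assumes K: "subgroup K G" and ab: "a \<in> K" "b \<in> K" and y: "y \<in> sections" "y' \<in> sections"
    and f: "fixes_section a y" "fixes_section b y'" and p: "p \<in> P"
    and inf: "\<And>n. n > 0 \<Longrightarrow> \<sigma> a [^]\<^bsub>H\<^esub> (n::nat) \<noteq> \<one>\<^bsub>H\<^esub>" "\<And>n. n > 0 \<Longrightarrow> \<sigma> b [^]\<^bsub>H\<^esub> (n::nat) \<noteq> \<one>\<^bsub>H\<^esub>"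
    and np: "\<pi> a p \<noteq> p" "\<pi> b p \<noteq> p"
    and ell: "\<And>g. g \<in> K \<Longrightarrow> \<exists>z\<in>sections. fixes_section g z"
  shows "y p = y' p"
proof -
  have abG: "a \<in> carrier G" "b \<in> carrier G" using ab subgroup.subset[OF K] by auto
  have "\<psi> (\<sigma> a) p \<noteq> p" "\<psi> (\<sigma> b) p \<noteq> p" using np \<pi>[OF abG(1) p] \<pi>[OF abG(2) p] by auto
  moreover have "\<forall>n::nat. n > 0 \<longrightarrow> (\<forall>p\<in>P. \<psi> (\<sigma> a [^]\<^bsub>H\<^esub> n) p = p \<longrightarrow> \<psi> (\<sigma> a) p = p)"
    by (rule fixed_points[THEN conjunct2]) (use abG inf in auto)
  moreover have "\<forall>n::nat. n > 0 \<longrightarrow> (\<forall>p\<in>P. \<psi> (\<sigma> b [^]\<^bsub>H\<^esub> n) p = p \<longrightarrow> \<psi> (\<sigma> b) p = p)"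
    by (rule fixed_points[THEN conjunct2]) (use abG inf in auto)
  ultimately have ap: "\<psi> (\<sigma> a [^]\<^bsub>H\<^esub> n) p \<noteq> p" "\<psi> (\<sigma> b [^]\<^bsub>H\<^esub> n) p \<noteq> p" if "n > 0" for n :: nat
    using p that by blast+
  define E where "E = {q \<in> P. y q \<noteq> y' q} - {p}"
  have "E \<subseteq> {q \<in> P. y q \<noteq> x0} \<union> {q \<in> P. y' q \<noteq> x0}" unfolding E_def by auto
  then have "finite E" using section_support y finite_subset by blast
  moreover have "E \<subseteq> P" "p \<notin> E" unfolding E_def by auto
  ultimately obtain n m k where
    "H.separates \<psi> (\<sigma> a) (\<sigma> b) p E n m k \<or> H.separates \<psi> (\<sigma> b) (\<sigma> a) p E n m k"
    using separates[of "\<sigma> a" "\<sigma> b" p E] abG p ap by auto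
  then show ?thesis
  proof
    assume "H.separates \<psi> (\<sigma> a) (\<sigma> b) p E n m k"
    moreover have "inv (b [^] m) \<otimes> (inv (a [^] n) \<otimes> (b [^] m \<otimes> a [^] k)) \<in> K"
      using ab by (auto intro!: subgroup.m_closed[OF K] subgroup.m_inv_closed[OF K] subgroup_nat_pow_closed[OF K])
    ultimately show ?thesis
      using separated_sections_agree[OF abG y f p _ ell] unfolding E_def by blast
  next
    assume "H.separates \<psi> (\<sigma> b) (\<sigma> a) p E n m k"
    moreover have "inv (a [^] m) \<otimes> (inv (b [^] n) \<otimes> (a [^] m \<otimes> b [^] k)) \<in> K"
      using ab by (auto intro!: subgroup.m_closed[OF K] subgroup.m_inv_closed[OF K] subgroup_nat_pow_closed[OF K])
    moreover have "E = {q \<in> P. y' q \<noteq> y q} - {p}" unfolding E_def by auto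
    ultimately have "y' p = y p"
      using separated_sections_agree[OF abG(2,1) y(2,1) f(2,1) p _ ell] by blast
    then show ?thesis ..
  qed
qed

theorem elliptic_fixed_section:
  assumes S: "finite S" "S \<subseteq> carrier G"
    and ell: "\<And>g. g \<in> generate G S \<Longrightarrow> \<exists>z\<in>sections. fixes_section g z"
  shows "\<exists>z\<in>sections. \<forall>g\<in>generate G S. fixes_section g z"
proof -
  define K where "K = generate G S"
  have K: "subgroup K G" unfolding K_def by (rule generate_is_subgroup[OF S(2)])
  have KG: "g \<in> carrier G" if "g \<in> K" for g using subgroup.subset[OF K] that by blast
  show ?thesis
  proof (cases "\<forall>w\<in>K. \<exists>n>0. \<sigma> w [^]\<^bsub>H\<^esub> (n::nat) = \<one>\<^bsub>H\<^esub>")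
    case True
    have gen: "generate H (\<sigma> ` S) = \<sigma> ` K" unfolding K_def by (rule hom.generate_img[OF S(2)])
    have "\<sigma> ` S \<subseteq> carrier H" using S(2) by auto
    then have fin: "finite (\<sigma> ` K)" unfolding gen[symmetric]
      using torsion_finite[of "\<sigma> ` S"] S(1) True unfolding gen by blast
    define L where "L = {w \<in> K. \<sigma> w = \<one>\<^bsub>H\<^esub>}"
    have L: "subgroup L G"
      using subgroup.one_closed[OF K] subgroup.m_closed[OF K] subgroup.m_inv_closed[OF K] KG
      by (intro subgroupI) (auto simp: L_def)
    have cos: "x \<otimes> inv y \<in> L" if "x \<in> K" "y \<in> K" "\<sigma> x = \<sigma> y" for x y
      using that KG subgroup.m_closed[OF K] subgroup.m_inv_closed[OF K] unfolding L_def by auto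
    obtain S' where S': "finite S'" "S' \<subseteq> carrier G" "L = generate G S'"
      using schreier[OF S L _ fin[unfolded K_def] cos[unfolded K_def]] unfolding L_def K_def by blast
    have Lp: "\<pi> w p = p" if "w \<in> L" "p \<in> P" for w p
    proof -
      have "\<pi> w p = \<psi> (\<sigma> \<one>) p" using \<pi>[of w p] that KG unfolding L_def by auto
      also have "\<dots> = p" using \<pi>[of \<one> p] base_one that by auto
      finally show ?thesis .
    qed
    \<comment> \<open>Over each point a fixed value exists, but arbitrary choices need not have
      finite support. Taking \<open>x0\<close> wherever the generators \<open>S'\<close> fix it
      leaves only finitely many exceptional points, by \<open>base_point\<close>.\<close>
    have "\<exists>x\<in>X. (\<forall>w\<in>L. t w p x = x) \<and> ((\<forall>s\<in>S'. t s p x0 = x0) \<longrightarrow> x = x0)" if p: "p \<in> P" for p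
    proof (cases "\<forall>s\<in>S'. t s p x0 = x0")
      case True
      have "t w p x0 = x0" if "w \<in> generate G S'" for w
        using that
      proof (induction rule: generate.induct)
        case one then show ?case using fibre_one p x0 by blast
      next
        case (incl h) then show ?case using True by blast
      next
        case (inv h)
        then have "h \<in> L" unfolding S'(3) by (rule generate.incl)
        then show ?case using fibre_inv[of h p x0] Lp p x0 True inv S'(2) by auto
      next
        case (eng g h)
        then have "g \<in> L" "h \<in> L" unfolding S'(3) by auto
        then show ?case using eng fibre_mult[of g h p x0] Lp p x0 KG unfolding L_def by auto
      qed
      then show ?thesis using x0 S'(3) by blast
    next
      case False
      have "\<exists>x\<in>X. \<forall>w\<in>generate G S'. t w p x = x"
      proof (rule stabilizer_elliptic[OF p S'(1,2)])
        fix w assume "w \<in> generate G S'"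
        then have w: "w \<in> L" using S'(3) by blast
        then obtain z where "z \<in> sections" "fixes_section w z" using ell[of w] unfolding L_def K_def by blast
        then have "z p \<in> X" "t w p (z p) = z p"
          using Lp[OF w p] section_in[of z p] p unfolding fixes_section_def by auto
        then show "\<pi> w p = p \<and> (\<exists>x\<in>X. t w p x = x)" using Lp[OF w p] by blast
      qed
      then show ?thesis using False S'(3) by blast
    qed
    then obtain z where z: "\<And>p. p \<in> P \<Longrightarrow> z p \<in> X" "\<And>p w. p \<in> P \<Longrightarrow> w \<in> L \<Longrightarrow> t w p (z p) = z p"
      "\<And>p. p \<in> P \<Longrightarrow> \<forall>s\<in>S'. t s p x0 = x0 \<Longrightarrow> z p = x0" by metis
    have "{p \<in> P. z p \<noteq> x0} \<subseteq> (\<Union>s\<in>S'. {p \<in> P. t s p x0 \<noteq> x0})" using z(3) by auto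
    then have "finite {p \<in> P. z p \<noteq> x0}" by (rule finite_subset) (use S' base_point in auto)
    then have zs: "restrict z P \<in> sections" using sectionI z(1) by blast
    have "fixes_section w (restrict z P)" if "w \<in> L" for w
      using z(2)[OF _ that] Lp[OF that] unfolding fixes_section_def by auto
    from finite_index_fixed_section[OF K fin cos L zs this] show ?thesis unfolding K_def .
  next
    case False
    then obtain a where a: "a \<in> K" "\<And>n. n > 0 \<Longrightarrow> \<sigma> a [^]\<^bsub>H\<^esub> (n::nat) \<noteq> \<one>\<^bsub>H\<^esub>" by blast
    have aG: "a \<in> carrier G" using KG a by blast
    obtain y where y: "y \<in> sections" "fixes_section a y" using ell a unfolding K_def by blast
    \<comment> \<open>Conjugates of \<open>a\<close> have infinite order in \<open>H\<close> as
      well, and \<open>act u y\<close> is fixed by \<open>c u\<close>. Their fixed sections are to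
      be compared.\<close>
    define c where "c u = u \<otimes> (a \<otimes> inv u)" for u
    have cK: "c u \<in> K" if "u \<in> K" for u
      unfolding c_def using that a subgroup.m_closed[OF K] subgroup.m_inv_closed[OF K] by auto
    have c_inf: "\<sigma> (c u) [^]\<^bsub>H\<^esub> n \<noteq> \<one>\<^bsub>H\<^esub>" if u: "u \<in> K" and n: "n > 0" for u and n :: nat
    proof
      have uG: "u \<in> carrier G" using KG u by blast
      have cp: "c u [^] i = u \<otimes> (a [^] i \<otimes> inv u)" for i :: nat
      proof (induction i)
        case (Suc i)
        have "c u [^] Suc i = u \<otimes> (a [^] i \<otimes> inv u) \<otimes> (u \<otimes> (a \<otimes> inv u))" using Suc by (simp add: c_def)
        also have "\<dots> = u \<otimes> (a [^] Suc i \<otimes> inv u)" using uG aG by (simp add: m_assoc inv_mult_cancel)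
        finally show ?case .
      qed (use uG in simp)
      assume "\<sigma> (c u) [^]\<^bsub>H\<^esub> n = \<one>\<^bsub>H\<^esub>"
      then have "\<sigma> (c u [^] n) = \<one>\<^bsub>H\<^esub>" using cK[OF u] KG by (simp add: hom.hom_nat_pow)
      then have "\<sigma> u \<otimes>\<^bsub>H\<^esub> (\<sigma> (a [^] n) \<otimes>\<^bsub>H\<^esub> inv\<^bsub>H\<^esub> \<sigma> u) = \<one>\<^bsub>H\<^esub>" unfolding cp using uG aG by simp
      moreover have "\<sigma> (a [^] n) = inv\<^bsub>H\<^esub> \<sigma> u \<otimes>\<^bsub>H\<^esub> (\<sigma> u \<otimes>\<^bsub>H\<^esub> (\<sigma> (a [^] n) \<otimes>\<^bsub>H\<^esub> inv\<^bsub>H\<^esub> \<sigma> u)) \<otimes>\<^bsub>H\<^esub> \<sigma> u"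
        using uG aG by (simp add: H.m_assoc flip: H.m_assoc[of "inv\<^bsub>H\<^esub> \<sigma> u" "\<sigma> u"])
      ultimately have "\<sigma> (a [^] n) = \<one>\<^bsub>H\<^esub>" using uG by simp
      then show False using a(2)[OF n] aG by (simp add: hom.hom_nat_pow)
    qed
    have c_fix: "fixes_section (c u) (act u y)" "act u y \<in> sections" if u: "u \<in> K" for u
    proof -
      have uG: "u \<in> carrier G" using KG u by blast
      show s: "act u y \<in> sections" using act_closed[OF uG y(1)] .
      have "act (c u) (act u y) = act (c u \<otimes> u) y" using act_mult[OF _ uG y(1), of "c u"] KG cK[OF u] by simp
      also have "c u \<otimes> u = u \<otimes> a" using uG aG by (simp add: c_def m_assoc)
      also have "act (u \<otimes> a) y = act u (act a y)" using act_mult[OF uG aG y(1)] .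
      also have "act a y = y" using act_fixed_iff[OF aG y(1)] y(2) by blast
      finally show "fixes_section (c u) (act u y)" using act_fixed_iff[OF KG[OF cK[OF u]] s] by blast
    qed
    have consistent: "act u y p = act u' y p"
      if "u \<in> K" "u' \<in> K" "p \<in> P" "\<pi> (c u) p \<noteq> p" "\<pi> (c u') p \<noteq> p" for u u' p
      using infinite_order_sections_agree[OF K cK[OF that(1)] cK[OF that(2)] c_fix(2)[OF that(1)] c_fix(2)[OF that(2)]
        c_fix(1)[OF that(1)] c_fix(1)[OF that(2)] that(3) c_inf[OF that(1)] c_inf[OF that(2)] that(4,5)] ell
      unfolding K_def by blast
    have c_conj: "\<pi> (c (w \<otimes> u)) (\<pi> w p) = \<pi> w (\<pi> (c u) p)" if "w \<in> K" "u \<in> K" "p \<in> P" for w u p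
    proof -
      have G: "w \<in> carrier G" "u \<in> carrier G" using KG that by auto
      have "c (w \<otimes> u) \<otimes> w = w \<otimes> c u"
        unfolding c_def using G aG by (simp add: m_assoc inv_mult_group)
      then show ?thesis
        using base_mult[of "c (w \<otimes> u)" w p] base_mult[of w "c u" p] that G KG cK subgroup.m_closed[OF K] by auto
    qed
    \<comment> \<open>The points at which no conjugate gives any information. \<open>Z\<close> is
      finite and invariant, so its pointwise stabilizer \<open>L\<close> has finite index in
      \<open>K\<close>; over \<open>Z\<close> the decency of the fibres is used instead.\<close>
    define Z where "Z = {p \<in> P. \<forall>u\<in>K. \<pi> (c u) p = p}"
    have c1: "c \<one> = a" unfolding c_def using aG by simp
    define Fa where "Fa = {p \<in> P. \<pi> a p = p}"
    have "finite {p \<in> P. \<psi> (\<sigma> a) p = p}" using fixed_points[of "\<sigma> a"] a(2) aG by auto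
    moreover have "Fa = {p \<in> P. \<psi> (\<sigma> a) p = p}" unfolding Fa_def using \<pi>[OF aG] by auto
    ultimately have finFa: "finite Fa" by simp
    have ZFa: "Z \<subseteq> Fa" unfolding Z_def Fa_def using c1 subgroup.one_closed[OF K] by force
    have finZ: "finite Z" using finFa ZFa finite_subset by blast
    have Zinv: "\<pi> w p \<in> Z" if w: "w \<in> K" and p: "p \<in> Z" for w p
    proof -
      have wG: "w \<in> carrier G" using KG w by blast
      have pP: "p \<in> P" using p Z_def by blast
      have "\<pi> (c u) (\<pi> w p) = \<pi> w p" if u: "u \<in> K" for u
      proof -
        have uG: "u \<in> carrier G" using KG u by blast
        have iu: "inv w \<otimes> u \<in> K" using w u subgroup.m_closed[OF K] subgroup.m_inv_closed[OF K] by blast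
        have "w \<otimes> (inv w \<otimes> u) = u" using wG uG by (simp flip: m_assoc)
        then have "\<pi> (c u) (\<pi> w p) = \<pi> w (\<pi> (c (inv w \<otimes> u)) p)" using c_conj[OF w iu pP] by simp
        also have "\<dots> = \<pi> w p" using p iu unfolding Z_def by simp
        finally show ?thesis .
      qed
      then show ?thesis unfolding Z_def using base_closed[OF wG pP] by blast
    qed
    define L where "L = {w \<in> K. \<forall>p\<in>Z. \<pi> w p = p}"
    have ZP: "p \<in> P" if "p \<in> Z" for p using that Z_def by blast
    have L: "subgroup L G"
    proof (rule subgroupI)
      show "L \<subseteq> carrier G" using KG unfolding L_def by blast
      show "L \<noteq> {}" using subgroup.one_closed[OF K] base_one ZP unfolding L_def by blast
      fix g h assume g: "g \<in> L"
      then show "inv g \<in> L" using subgroup.m_inv_closed[OF K] base_fixed_inv KG ZP unfolding L_def by blast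
      assume "h \<in> L"
      then show "g \<otimes> h \<in> L" using g subgroup.m_closed[OF K] KG ZP unfolding L_def by (auto simp: base_mult)
    qed
    define f where "f w = restrict (\<pi> w) Z" for w
    have "f ` K \<subseteq> Z \<rightarrow>\<^sub>E Z" unfolding f_def using Zinv by auto
    then have fin: "finite (f ` K)" using finite_PiE[OF finZ, of "\<lambda>_. Z"] finZ finite_subset by blast
    have cos: "g \<otimes> inv h \<in> L" if gh: "g \<in> K" "h \<in> K" "f g = f h" for g h
    proof -
      have "\<pi> (g \<otimes> inv h) p = p" if p: "p \<in> Z" for p
      proof -
        have q: "\<pi> (inv h) p \<in> Z" using Zinv[OF subgroup.m_inv_closed[OF K gh(2)] p] .
        have "\<pi> g (\<pi> (inv h) p) = \<pi> h (\<pi> (inv h) p)" using gh(3) q unfolding f_def by (metis restrict_apply')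
        then show ?thesis using KG gh ZP[OF p] by (simp add: base_mult)
      qed
      then show ?thesis unfolding L_def
        using subgroup.m_closed[OF K gh(1) subgroup.m_inv_closed[OF K gh(2)]] by blast
    qed
    obtain S' where S': "finite S'" "S' \<subseteq> carrier G" "L = generate G S'"
      using schreier[OF S L _ fin[unfolded K_def] cos[unfolded K_def]] unfolding L_def K_def by blast
    have "\<exists>x\<in>X. \<forall>w\<in>L. t w p x = x" if p: "p \<in> Z" for p
      unfolding S'(3)
    proof (rule stabilizer_elliptic[OF ZP[OF p] S'(1,2)])
      fix w assume "w \<in> generate G S'"
      then have w: "w \<in> K" "\<pi> w p = p" using p S'(3) unfolding L_def by auto
      then obtain z where "z \<in> sections" "fixes_section w z" using ell unfolding K_def by blast
      then have "z p \<in> X" "t w p (z p) = z p"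
        using w section_in[of z p] ZP[OF p] unfolding fixes_section_def by auto
      then show "\<pi> w p = p \<and> (\<exists>x\<in>X. t w p x = x)" using w by blast
    qed
    then obtain \<xi> where \<xi>: "\<And>p. p \<in> Z \<Longrightarrow> \<xi> p \<in> X \<and> (\<forall>w\<in>L. t w p (\<xi> p) = \<xi> p)" by metis
    have "\<exists>x. \<forall>u\<in>K. \<pi> (c u) p \<noteq> p \<longrightarrow> act u y p = x" if p: "p \<in> P" for p
      using consistent[OF _ _ p] by metis
    then obtain \<zeta> where \<zeta>: "\<And>p u. p \<in> P \<Longrightarrow> u \<in> K \<Longrightarrow> \<pi> (c u) p \<noteq> p \<Longrightarrow> act u y p = \<zeta> p" by metis
    define z where "z p = (if p \<in> Z then \<xi> p else \<zeta> p)" for p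
    have zu: "z p = act u y p \<and> p \<notin> Z" if "p \<in> P" "u \<in> K" "\<pi> (c u) p \<noteq> p" for p u
      using \<zeta>[OF that] that unfolding z_def Z_def by auto
    have zs: "restrict z P \<in> sections"
    proof (rule sectionI)
      fix p assume p: "p \<in> P"
      show "z p \<in> X"
      proof (cases "p \<in> Z")
        case True then show ?thesis using \<xi> by (simp add: z_def)
      next
        case False
        then obtain u where u: "u \<in> K" "\<pi> (c u) p \<noteq> p" using p unfolding Z_def by blast
        then show ?thesis using zu[OF p u] section_in[OF c_fix(2)[OF u(1)] p] by simp
      qed
    next
      \<comment> \<open>The value for \<open>u = \<one>\<close> shows that the glued section equals
        \<open>y\<close> off the finite fixed set of \<open>a\<close>, whence its finite
        support.\<close>
      have "act \<one> y = y" using act_fixed_iff[OF one_closed y(1)] fixes_section_one[OF y(1)] by blast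
      then have "z p = y p" if "p \<in> P" "p \<notin> Fa" for p
        using zu[OF that(1) subgroup.one_closed[OF K]] that unfolding Fa_def c1 by simp
      then have "{p \<in> P. z p \<noteq> x0} \<subseteq> Fa \<union> {p \<in> P. y p \<noteq> x0}" by auto
      then show "finite {p \<in> P. z p \<noteq> x0}" by (rule finite_subset) (use finFa section_support[OF y(1)] in simp)
    qed
    have "fixes_section w (restrict z P)" if w: "w \<in> L" for w
      unfolding fixes_section_def
    proof
      fix p assume p: "p \<in> P"
      have wK: "w \<in> K" using w L_def by blast
      have qP: "\<pi> w p \<in> P" using base_closed[OF KG[OF wK] p] .
      have "t w p (z p) = z (\<pi> w p)"
      proof (cases "p \<in> Z")
        case True
        then have "\<pi> w p = p" using w unfolding L_def by blast
        then show ?thesis using True \<xi>[OF True] w by (simp add: z_def)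
      next
        case False
        then obtain u where u: "u \<in> K" "\<pi> (c u) p \<noteq> p" using p unfolding Z_def by blast
        have wu: "w \<otimes> u \<in> K" using subgroup.m_closed[OF K wK u(1)] .
        \<comment> \<open>If \<open>c u\<close> moves \<open>p\<close>, then its conjugate by
          \<open>w\<close> moves the image of \<open>p\<close>, so the values at both points come
          from the related sections \<open>act u y\<close> and
          \<open>act (w \<otimes> u) y\<close>.\<close>
        have "\<pi> (c (w \<otimes> u)) (\<pi> w p) \<noteq> \<pi> w p"
          unfolding c_conj[OF wK u(1) p]
          using base_inj[OF KG[OF wK] _ p, of "\<pi> (c u) p"] base_closed[OF KG[OF cK[OF u(1)]] p] u(2) by blast
        then have "z (\<pi> w p) = act (w \<otimes> u) y (\<pi> w p)" using zu[OF qP wu] by simp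
        also have "\<dots> = act w (act u y) (\<pi> w p)" using act_mult[OF KG[OF wK] KG[OF u(1)] y(1)] by simp
        also have "\<dots> = t w p (act u y p)" using act_apply[OF KG[OF wK] p] .
        also have "act u y p = z p" using zu[OF p u] by simp
        finally show ?thesis ..
      qed
      then show "t w p (restrict z P p) = restrict z P (\<pi> w p)" using p qP by simp
    qed
    from finite_index_fixed_section[OF K fin cos L zs this] show ?thesis unfolding K_def .
  qed
qed

end

section \<open>The wreath product as a bundle action\<close>

locale wreath_setup = G0: group_action G0 X0 \<phi> + H: group H
  for G0 :: "('g, 'r) monoid_scheme" and X0 :: "'x set" and \<phi> and H :: "('h, 's) monoid_scheme" +
  fixes P :: "'p set" and \<psi> :: "'h \<Rightarrow> 'p \<Rightarrow> 'p" and x0 :: 'x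
  assumes decent: "decent_action G0 X0 \<phi>" and x0: "x0 \<in> X0"
    and psi_closed: "h \<in> carrier H \<Longrightarrow> p \<in> P \<Longrightarrow> \<psi> h p \<in> P"
    and psi_one: "p \<in> P \<Longrightarrow> \<psi> \<one>\<^bsub>H\<^esub> p = p"
    and psi_mult: "h \<in> carrier H \<Longrightarrow> k \<in> carrier H \<Longrightarrow> p \<in> P \<Longrightarrow> \<psi> (h \<otimes>\<^bsub>H\<^esub> k) p = \<psi> h (\<psi> k p)"
begin

sublocale G0: group G0 using G0.group_hom group_hom.axioms(1) by blast

abbreviation "WP \<equiv> wreath_product G0 H P \<psi>"
abbreviation "Y \<equiv> restricted_product P (\<lambda>_. X0) (\<lambda>_. x0)"
abbreviation "W \<equiv> wreath_oplus G0 H P \<psi> X0 \<phi> x0"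
abbreviation "wa \<equiv> wreath_action H P \<psi> X0 \<phi>"

lemma psi_inv [simp]: "h \<in> carrier H \<Longrightarrow> p \<in> P \<Longrightarrow> \<psi> (inv\<^bsub>H\<^esub> h) (\<psi> h p) = p"
  "h \<in> carrier H \<Longrightarrow> p \<in> P \<Longrightarrow> \<psi> h (\<psi> (inv\<^bsub>H\<^esub> h) p) = p"
  using psi_mult[of "inv\<^bsub>H\<^esub> h" h p] psi_mult[of h "inv\<^bsub>H\<^esub> h" p] psi_one by auto

lemma phi_mult: "g \<in> carrier G0 \<Longrightarrow> g' \<in> carrier G0 \<Longrightarrow> x \<in> X0 \<Longrightarrow> \<phi> (g \<otimes>\<^bsub>G0\<^esub> g') x = \<phi> g (\<phi> g' x)"
  using G0.composition_rule by blast

lemma phi_closed: "g \<in> carrier G0 \<Longrightarrow> x \<in> X0 \<Longrightarrow> \<phi> g x \<in> X0"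
  using G0.element_image by blast

lemma phi_one: "x \<in> X0 \<Longrightarrow> \<phi> \<one>\<^bsub>G0\<^esub> x = x"
  using G0.id_eq_one by (metis restrict_apply')

lemma carrier_WP: "carrier WP = (\<Pi>\<^sub>E p\<in>P. carrier G0) \<times> carrier H"
  by (simp add: wreath_product_def semidirect_product_def product_group_def)

lemma mult_WP: "(g, h) \<otimes>\<^bsub>WP\<^esub> (g', h') =
    ((\<lambda>p\<in>P. g p \<otimes>\<^bsub>G0\<^esub> (\<lambda>p\<in>P. g' (\<psi> (inv\<^bsub>H\<^esub> h) p)) p), h \<otimes>\<^bsub>H\<^esub> h')"
  by (simp add: wreath_product_def semidirect_product_def product_group_def)

lemma mult_WP': "w \<otimes>\<^bsub>WP\<^esub> w' =
    ((\<lambda>p\<in>P. fst w p \<otimes>\<^bsub>G0\<^esub> fst w' (\<psi> (inv\<^bsub>H\<^esub> snd w) p)), snd w \<otimes>\<^bsub>H\<^esub> snd w')"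
  using mult_WP[of "fst w" "snd w" "fst w'" "snd w'"] by (auto intro!: restrict_ext)

lemma one_WP: "\<one>\<^bsub>WP\<^esub> = ((\<lambda>p\<in>P. \<one>\<^bsub>G0\<^esub>), \<one>\<^bsub>H\<^esub>)"
  by (simp add: wreath_product_def semidirect_product_def product_group_def)

lemma WP_fst: "w \<in> carrier WP \<Longrightarrow> p \<in> P \<Longrightarrow> fst w p \<in> carrier G0"
  and WP_snd: "w \<in> carrier WP \<Longrightarrow> snd w \<in> carrier H"
  by (auto simp: carrier_WP)

lemma group_WP: "group WP"
proof (rule groupI)
  show "\<one>\<^bsub>WP\<^esub> \<in> carrier WP" by (auto simp: one_WP carrier_WP)
  fix w assume w: "w \<in> carrier WP"
  show "\<one>\<^bsub>WP\<^esub> \<otimes>\<^bsub>WP\<^esub> w = w"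
  proof (rule prod_eqI)
    have "fst (\<one>\<^bsub>WP\<^esub> \<otimes>\<^bsub>WP\<^esub> w) p = fst w p" for p
      using w by (cases "p \<in> P") (auto simp: mult_WP' one_WP psi_one WP_fst carrier_WP)
    then show "fst (\<one>\<^bsub>WP\<^esub> \<otimes>\<^bsub>WP\<^esub> w) = fst w" by blast
    show "snd (\<one>\<^bsub>WP\<^esub> \<otimes>\<^bsub>WP\<^esub> w) = snd w" using w by (simp add: mult_WP' one_WP WP_snd)
  qed
  define v where "v = ((\<lambda>p\<in>P. inv\<^bsub>G0\<^esub> fst w (\<psi> (snd w) p)), inv\<^bsub>H\<^esub> snd w)"
  have "v \<in> carrier WP" using w WP_fst[OF w psi_closed] WP_snd[OF w] by (auto simp: v_def carrier_WP)
  moreover have "v \<otimes>\<^bsub>WP\<^esub> w = \<one>\<^bsub>WP\<^esub>"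
  proof (rule prod_eqI)
    have "fst (v \<otimes>\<^bsub>WP\<^esub> w) p = fst \<one>\<^bsub>WP\<^esub> p" for p
      using w WP_fst[OF w psi_closed] WP_snd[OF w] by (cases "p \<in> P") (auto simp: mult_WP' one_WP v_def)
    then show "fst (v \<otimes>\<^bsub>WP\<^esub> w) = fst \<one>\<^bsub>WP\<^esub>" by blast
    show "snd (v \<otimes>\<^bsub>WP\<^esub> w) = snd \<one>\<^bsub>WP\<^esub>" using w by (simp add: mult_WP' one_WP v_def WP_snd)
  qed
  ultimately show "\<exists>v\<in>carrier WP. v \<otimes>\<^bsub>WP\<^esub> w = \<one>\<^bsub>WP\<^esub>" by blast
  fix w' assume w': "w' \<in> carrier WP"
  show "w \<otimes>\<^bsub>WP\<^esub> w' \<in> carrier WP"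
    using w w' WP_fst[OF w] WP_fst[OF w' psi_closed] WP_snd[OF w] WP_snd[OF w'] by (auto simp: mult_WP' carrier_WP)
  fix w'' assume w'': "w'' \<in> carrier WP"
  show "w \<otimes>\<^bsub>WP\<^esub> w' \<otimes>\<^bsub>WP\<^esub> w'' = w \<otimes>\<^bsub>WP\<^esub> (w' \<otimes>\<^bsub>WP\<^esub> w'')"
  proof (rule prod_eqI)
    have "fst (w \<otimes>\<^bsub>WP\<^esub> w' \<otimes>\<^bsub>WP\<^esub> w'') p = fst (w \<otimes>\<^bsub>WP\<^esub> (w' \<otimes>\<^bsub>WP\<^esub> w'')) p" for p
    proof (cases "p \<in> P")
      case True
      have h: "snd w \<in> carrier H" "snd w' \<in> carrier H" using WP_snd w w' by auto
      have q: "\<psi> (inv\<^bsub>H\<^esub> snd w) p \<in> P" using psi_closed True h by auto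
      have "\<psi> (inv\<^bsub>H\<^esub> (snd w \<otimes>\<^bsub>H\<^esub> snd w')) p = \<psi> (inv\<^bsub>H\<^esub> snd w') (\<psi> (inv\<^bsub>H\<^esub> snd w) p)"
        using h True by (simp add: H.inv_mult_group psi_mult)
      moreover have "\<psi> (inv\<^bsub>H\<^esub> snd w') (\<psi> (inv\<^bsub>H\<^esub> snd w) p) \<in> P" using psi_closed q h by auto
      ultimately show ?thesis using True q WP_fst[OF w True] WP_fst[OF w' q] WP_fst[OF w'']
        by (simp add: mult_WP' G0.m_assoc)
    qed (simp add: mult_WP')
    then show "fst (w \<otimes>\<^bsub>WP\<^esub> w' \<otimes>\<^bsub>WP\<^esub> w'') = fst (w \<otimes>\<^bsub>WP\<^esub> (w' \<otimes>\<^bsub>WP\<^esub> w''))" by blast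
    show "snd (w \<otimes>\<^bsub>WP\<^esub> w' \<otimes>\<^bsub>WP\<^esub> w'') = snd (w \<otimes>\<^bsub>WP\<^esub> (w' \<otimes>\<^bsub>WP\<^esub> w''))"
      using WP_snd w w' w'' by (simp add: mult_WP' H.m_assoc)
  qed
qed

section \<open>The action on the restricted product and the subgroup preserving it\<close>

lemma Y_PiE: "y \<in> Y \<Longrightarrow> y \<in> (\<Pi>\<^sub>E p\<in>P. X0)" by (simp add: restricted_product_def)

lemma wa_apply: "y \<in> (\<Pi>\<^sub>E p\<in>P. X0) \<Longrightarrow> wa w y = (\<lambda>p\<in>P. \<phi> (fst w p) (y (\<psi> (inv\<^bsub>H\<^esub> snd w) p)))"
  by (cases w) (simp add: wreath_action_def)

lemma wa_closed: assumes w: "w \<in> carrier WP" and y: "y \<in> (\<Pi>\<^sub>E p\<in>P. X0)" shows "wa w y \<in> (\<Pi>\<^sub>E p\<in>P. X0)"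
proof -
  have "\<phi> (fst w p) (y (\<psi> (inv\<^bsub>H\<^esub> snd w) p)) \<in> X0" if p: "p \<in> P" for p
    using phi_closed[OF WP_fst[OF w p]] PiE_mem[OF y psi_closed[OF _ p]] WP_snd[OF w] by auto
  then show ?thesis unfolding wa_apply[OF y] by auto
qed

lemma wa_mult:
  assumes w: "w \<in> carrier WP" and w': "w' \<in> carrier WP" and y: "y \<in> (\<Pi>\<^sub>E p\<in>P. X0)"
  shows "wa (w \<otimes>\<^bsub>WP\<^esub> w') y = wa w (wa w' y)"
proof -
  have key: "\<phi> (fst (w \<otimes>\<^bsub>WP\<^esub> w') p) (y (\<psi> (inv\<^bsub>H\<^esub> snd (w \<otimes>\<^bsub>WP\<^esub> w')) p)) =
    \<phi> (fst w p) (wa w' y (\<psi> (inv\<^bsub>H\<^esub> snd w) p))" if p: "p \<in> P" for p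
  proof -
    have h: "snd w \<in> carrier H" "snd w' \<in> carrier H" using WP_snd w w' by auto
    have q: "\<psi> (inv\<^bsub>H\<^esub> snd w) p \<in> P" using psi_closed p h by auto
    have "\<psi> (inv\<^bsub>H\<^esub> (snd w \<otimes>\<^bsub>H\<^esub> snd w')) p = \<psi> (inv\<^bsub>H\<^esub> snd w') (\<psi> (inv\<^bsub>H\<^esub> snd w) p)"
      using h p by (simp add: H.inv_mult_group psi_mult)
    moreover have "y (\<psi> (inv\<^bsub>H\<^esub> snd w') (\<psi> (inv\<^bsub>H\<^esub> snd w) p)) \<in> X0"
      using PiE_mem[OF y psi_closed[OF _ q]] h by auto
    ultimately show ?thesis using p q WP_fst[OF w p] WP_fst[OF w' q]
      by (simp add: wa_apply[OF y] mult_WP' phi_mult)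
  qed
  show ?thesis
    unfolding wa_apply[OF y, of "w \<otimes>\<^bsub>WP\<^esub> w'"] wa_apply[OF wa_closed[OF w' y], of w]
    by (intro restrict_ext key)
qed

lemma wa_one: assumes y: "y \<in> (\<Pi>\<^sub>E p\<in>P. X0)" shows "wa \<one>\<^bsub>WP\<^esub> y = y"
proof (rule PiE_ext[OF _ y])
  interpret WP: group WP by (rule group_WP)
  show "wa \<one>\<^bsub>WP\<^esub> y \<in> (\<Pi>\<^sub>E p\<in>P. X0)" using wa_closed[OF WP.one_closed y] .
  fix p assume "p \<in> P"
  then show "wa \<one>\<^bsub>WP\<^esub> y p = y p" using PiE_mem[OF y] by (simp add: wa_apply[OF y] one_WP psi_one phi_one)
qed

lemma carrier_W: "carrier W = {w \<in> carrier WP. wa w ` Y = Y}"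
  by (simp add: wreath_oplus_def)

lemma W_simps: "w \<otimes>\<^bsub>W\<^esub> w' = w \<otimes>\<^bsub>WP\<^esub> w'" "\<one>\<^bsub>W\<^esub> = \<one>\<^bsub>WP\<^esub>"
  by (simp_all add: wreath_oplus_def)

lemma subgroup_W: "subgroup (carrier W) WP"
proof -
  interpret WP: group WP by (rule group_WP)
  show ?thesis
  proof (rule WP.subgroupI)
    show "carrier W \<subseteq> carrier WP" by (auto simp: carrier_W)
    have "wa \<one>\<^bsub>WP\<^esub> ` Y = Y" using wa_one Y_PiE by (auto simp: image_iff)
    then show "carrier W \<noteq> {}" unfolding carrier_W using WP.one_closed by blast
    fix w assume "w \<in> carrier W"
    then have w: "w \<in> carrier WP" "wa w ` Y = Y" by (auto simp: carrier_W)
    have "wa (inv\<^bsub>WP\<^esub> w) ` Y = wa (inv\<^bsub>WP\<^esub> w) ` wa w ` Y" using w by simp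
    also have "\<dots> = (\<lambda>y. wa (inv\<^bsub>WP\<^esub> w) (wa w y)) ` Y" by (simp add: image_image)
    also have "\<dots> = (\<lambda>y. y) ` Y"
      using wa_mult[of "inv\<^bsub>WP\<^esub> w" w] wa_one Y_PiE w by (intro image_cong) auto
    finally show "inv\<^bsub>WP\<^esub> w \<in> carrier W" using w by (auto simp: carrier_W)
    fix w' assume "w' \<in> carrier W"
    then have w': "w' \<in> carrier WP" "wa w' ` Y = Y" by (auto simp: carrier_W)
    have "wa (w \<otimes>\<^bsub>WP\<^esub> w') ` Y = (\<lambda>y. wa w (wa w' y)) ` Y"
      using wa_mult[OF w(1) w'(1)] Y_PiE by (intro image_cong) auto
    also have "\<dots> = wa w ` wa w' ` Y" by (simp add: image_image)
    finally show "w \<otimes>\<^bsub>WP\<^esub> w' \<in> carrier W" using w w' by (auto simp: carrier_W)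
  qed
qed

lemma group_W: "group W"
  using group.subgroup_imp_group[OF group_WP subgroup_W] by (simp add: wreath_oplus_def)

sublocale W: group W by (rule group_W)

lemma W_WP: "w \<in> carrier W \<Longrightarrow> w \<in> carrier WP" by (simp add: carrier_W)

lemma snd_hom: "snd \<in> hom W H"
  by (rule homI) (auto simp: W_simps mult_WP' dest!: W_WP intro: WP_snd)

lemma snd_inv: "w \<in> carrier W \<Longrightarrow> snd (inv\<^bsub>W\<^esub> w) = inv\<^bsub>H\<^esub> snd w"
proof -
  interpret group_hom W H snd using snd_hom by unfold_locales
  show "w \<in> carrier W \<Longrightarrow> snd (inv\<^bsub>W\<^esub> w) = inv\<^bsub>H\<^esub> snd w" by (rule hom_inv)
qed

definition base :: "('p \<Rightarrow> 'g) \<times> 'h \<Rightarrow> 'p \<Rightarrow> 'p" where "base w p = \<psi> (snd w) p"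
text \<open>The group component is evaluated at the target point, because \<open>snd w\<close> moves
  the base before \<open>fst w\<close> acts.\<close>

definition fibre :: "('p \<Rightarrow> 'g) \<times> 'h \<Rightarrow> 'p \<Rightarrow> 'x \<Rightarrow> 'x" where "fibre w p = \<phi> (fst w (\<psi> (snd w) p))"

text \<open>On the stabilizer of \<open>p\<close> the twist in the semidirect product fixes
  \<open>p\<close>, so evaluation at \<open>p\<close> is multiplicative. This transfers decency from
  \<open>G0\<close> to the fibres.\<close>

lemma stabilizer_mult:
  assumes "w \<in> carrier W" "w' \<in> carrier W" "p \<in> P" "base w p = p" "base w' p = p"
  shows "fst (w \<otimes>\<^bsub>W\<^esub> w') p = fst w p \<otimes>\<^bsub>G0\<^esub> fst w' p" 
proof -
  have "\<psi> (inv\<^bsub>H\<^esub> snd w) p = p"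
    using psi_inv(1)[OF WP_snd[OF W_WP[OF assms(1)]] assms(3)] assms(4) by (simp add: base_def)
  then show ?thesis using assms by (simp add: W_simps mult_WP')
qed

lemma stabilizer_inv:
  assumes "w \<in> carrier W" "p \<in> P" "base w p = p"
  shows "fst (inv\<^bsub>W\<^esub> w) p = inv\<^bsub>G0\<^esub> fst w p" "base (inv\<^bsub>W\<^esub> w) p = p"
proof -
  show b: "base (inv\<^bsub>W\<^esub> w) p = p"
    using psi_inv(1)[OF WP_snd[OF W_WP[OF assms(1)]] assms(2)] assms by (simp add: base_def snd_inv)
  have "fst (inv\<^bsub>W\<^esub> w) p \<otimes>\<^bsub>G0\<^esub> fst w p = fst \<one>\<^bsub>W\<^esub> p"
    using stabilizer_mult[of "inv\<^bsub>W\<^esub> w" w p] assms b by simp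
  also have "\<dots> = \<one>\<^bsub>G0\<^esub>" using assms by (simp add: W_simps one_WP)
  finally show "fst (inv\<^bsub>W\<^esub> w) p = inv\<^bsub>G0\<^esub> fst w p"
    using assms WP_fst[OF W_WP] by (intro G0.inv_equality[symmetric]) auto
qed

lemma bundle_action_W: "bundle_action W P X0 x0 base fibre"
proof unfold_locales
  show "x0 \<in> X0" by (rule x0)
next
  fix w p assume "w \<in> carrier W" "p \<in> P"
  then show "base w p \<in> P" unfolding base_def using psi_closed WP_snd[OF W_WP] by blast
next
  fix p assume "p \<in> P"
  then show "base \<one>\<^bsub>W\<^esub> p = p" by (simp add: base_def W_simps one_WP psi_one)
next
  fix w w' p assume "w \<in> carrier W" "w' \<in> carrier W" "p \<in> P"
  then show "base (w \<otimes>\<^bsub>W\<^esub> w') p = base w (base w' p)"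
    using WP_snd[OF W_WP] by (simp add: base_def W_simps mult_WP' psi_mult)
next
  fix w p x assume "w \<in> carrier W" "p \<in> P" "x \<in> X0"
  then show "fibre w p x \<in> X0" unfolding fibre_def
    using psi_closed[of "snd w" p] WP_snd[OF W_WP] WP_fst[OF W_WP] phi_closed by blast
next
  fix p x assume "p \<in> P" "x \<in> X0"
  then show "fibre \<one>\<^bsub>W\<^esub> p x = x" by (simp add: fibre_def W_simps one_WP psi_one phi_one)
next
  fix w w' p x assume a: "w \<in> carrier W" "w' \<in> carrier W" "p \<in> P" "x \<in> X0"
  have h: "snd w \<in> carrier H" "snd w' \<in> carrier H" using a WP_snd[OF W_WP] by auto
  define q where "q = \<psi> (snd w') p"
  have q: "q \<in> P" "\<psi> (snd w) q \<in> P" using psi_closed h a(3) by (auto simp: q_def)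
  show "fibre (w \<otimes>\<^bsub>W\<^esub> w') p x = fibre w (base w' p) (fibre w' p x)"
    using h q a phi_mult[OF WP_fst[OF W_WP[OF a(1)] q(2)] WP_fst[OF W_WP[OF a(2)] q(1)] a(4)]
    by (simp add: fibre_def base_def W_simps mult_WP' psi_mult flip: q_def)
next
  fix w assume w: "w \<in> carrier W"
  \<comment> \<open>The constant section with value \<open>x0\<close>. Its image under
    \<open>w\<close> is again in the restricted product, and its support is the translate of the set
    where \<open>w\<close> fails to preserve the base point.\<close>
  define s where "s = (\<lambda>p\<in>P. x0)"
  have s: "s \<in> Y" using x0 by (simp add: s_def restricted_product_def)
  then have "wa w s \<in> Y" using w by (auto simp: carrier_W)
  then have fin: "finite {p \<in> P. wa w s p \<noteq> x0}" by (simp add: restricted_product_def)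
  have h: "snd w \<in> carrier H" using WP_snd[OF W_WP[OF w]] .
  have "{p \<in> P. fibre w p x0 \<noteq> x0} \<subseteq> \<psi> (inv\<^bsub>H\<^esub> snd w) ` {p \<in> P. wa w s p \<noteq> x0}"
  proof
    fix p assume p: "p \<in> {p \<in> P. fibre w p x0 \<noteq> x0}"
    then have "\<psi> (snd w) p \<in> {p \<in> P. wa w s p \<noteq> x0}"
      using psi_closed[OF h, of p] h wa_apply[OF Y_PiE[OF s], of w] by (simp add: fibre_def) (simp add: s_def)
    then have "\<psi> (inv\<^bsub>H\<^esub> snd w) (\<psi> (snd w) p) \<in> \<psi> (inv\<^bsub>H\<^esub> snd w) ` {p \<in> P. wa w s p \<noteq> x0}" by (rule imageI)
    then show "p \<in> \<psi> (inv\<^bsub>H\<^esub> snd w) ` {p \<in> P. wa w s p \<noteq> x0}" using p h by simp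
  qed
  then show "finite {p \<in> P. fibre w p x0 \<noteq> x0}" using fin finite_surj by blast
next
  fix p L x assume p: "p \<in> P" and L: "subgroup L W" and st: "\<And>g. g \<in> L \<Longrightarrow> base g p = p"
    and x: "x \<in> X0" and fin: "finite ((\<lambda>g. fibre g p x) ` L)"
  have LW: "w \<in> carrier W" if "w \<in> L" for w using subgroup.subset[OF L] that by blast
  define \<gamma> where "\<gamma> w = fst w p" for w :: "('p \<Rightarrow> 'g) \<times> 'h"
  have fg: "fibre w p = \<phi> (\<gamma> w)" if "w \<in> L" for w using st[OF that] by (simp add: fibre_def \<gamma>_def base_def)
  \<comment> \<open>Evaluation at \<open>p\<close> maps \<open>L\<close> to a subgroup of
    \<open>G0\<close> with the same orbit of \<open>x\<close> as in the fibre.\<close>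
  have "subgroup (\<gamma> ` L) G0"
  proof (rule G0.subgroupI)
    show "\<gamma> ` L \<subseteq> carrier G0" using WP_fst[OF W_WP[OF LW] p] by (auto simp: \<gamma>_def)
    show "\<gamma> ` L \<noteq> {}" using subgroup.one_closed[OF L] by blast
    fix a assume "a \<in> \<gamma> ` L"
    then obtain w where w: "w \<in> L" "a = \<gamma> w" by blast
    then show "inv\<^bsub>G0\<^esub> a \<in> \<gamma> ` L"
      using stabilizer_inv(1)[OF LW[OF w(1)] p st[OF w(1)]] subgroup.m_inv_closed[OF L w(1)]
      by (intro image_eqI[of _ _ "inv\<^bsub>W\<^esub> w"]) (auto simp: \<gamma>_def)
    fix b assume "b \<in> \<gamma> ` L"
    then obtain w' where w': "w' \<in> L" "b = \<gamma> w'" by blast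
    then show "a \<otimes>\<^bsub>G0\<^esub> b \<in> \<gamma> ` L"
      using stabilizer_mult[OF LW[OF w(1)] LW[OF w'(1)] p st[OF w(1)] st[OF w'(1)]] subgroup.m_closed[OF L w(1) w'(1)] w(2)
      by (intro image_eqI[of _ _ "w \<otimes>\<^bsub>W\<^esub> w'"]) (auto simp: \<gamma>_def)
  qed
  moreover have "orbit (G0\<lparr>carrier := \<gamma> ` L\<rparr>) \<phi> x = (\<lambda>g. fibre g p x) ` L"
    using fg by (auto simp: orbit_def image_iff)
  then have "\<exists>x\<in>X0. finite (orbit (G0\<lparr>carrier := \<gamma> ` L\<rparr>) \<phi> x)" using fin x by (intro bexI[of _ x]) simp_all
  ultimately have "fixes_point \<phi> X0 (\<gamma> ` L)" using decent unfolding decent_action_def by blast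
  then show "\<exists>x\<in>X0. \<forall>g\<in>L. fibre g p x = x" unfolding fixes_point_def using fg by auto
next
  fix p S assume p: "p \<in> P" and S: "finite S" "S \<subseteq> carrier W"
    and st: "\<And>g. g \<in> generate W S \<Longrightarrow> base g p = p \<and> (\<exists>x\<in>X0. fibre g p x = x)"
  have gW: "w \<in> carrier W" if "w \<in> generate W S" for w using W.generate_in_carrier[OF S(2) that] .
  define \<gamma> where "\<gamma> w = fst w p" for w :: "('p \<Rightarrow> 'g) \<times> 'h"
  have fg: "fibre w p = \<phi> (\<gamma> w)" if "w \<in> generate W S" for w using st[OF that] by (simp add: fibre_def \<gamma>_def base_def)
  have inc: "s \<in> generate W S" if "s \<in> S" for s using that by (rule generate.incl)
  have 1: "\<gamma> w \<in> generate G0 (\<gamma> ` S)" if "w \<in> generate W S" for w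
    using that
  proof (induction rule: generate.induct)
    case one then show ?case using p generate.one by (simp add: \<gamma>_def W_simps one_WP)
  next
    case (incl h) then show ?case by (intro generate.incl imageI)
  next
    case (inv h)
    have "h \<in> carrier W" "base h p = p" using inv S(2) st[OF inc[OF inv]] by blast+
    then have eq: "\<gamma> (inv\<^bsub>W\<^esub> h) = inv\<^bsub>G0\<^esub> \<gamma> h" unfolding \<gamma>_def using stabilizer_inv(1)[OF _ p] by blast
    show ?case unfolding eq by (intro generate.inv imageI inv)
  next
    case (eng h1 h2)
    have "\<gamma> (h1 \<otimes>\<^bsub>W\<^esub> h2) = \<gamma> h1 \<otimes>\<^bsub>G0\<^esub> \<gamma> h2"
      unfolding \<gamma>_def using stabilizer_mult[OF gW gW p] st eng.hyps by blast
    then show ?case using generate.eng[OF eng.IH] by simp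
  qed
  \<comment> \<open>Surjectivity of the evaluation on generated subgroups makes the generated
    subgroup of \<open>G0\<close> purely elliptic; inclusion in the other direction carries its
    fixed point back.\<close>
  have 2: "\<exists>w\<in>generate W S. \<gamma> w = g" if "g \<in> generate G0 (\<gamma> ` S)" for g
    using that
  proof (induction rule: generate.induct)
    case one
    have "\<gamma> \<one>\<^bsub>W\<^esub> = \<one>\<^bsub>G0\<^esub>" using p by (simp add: \<gamma>_def W_simps one_WP)
    then show ?case using generate.one by blast
  next
    case (incl h) then show ?case using inc by blast
  next
    case (inv h)
    then obtain s where s: "s \<in> S" "h = \<gamma> s" by blast
    then have "s \<in> carrier W" "base s p = p" using S(2) st[OF inc[OF s(1)]] by blast+
    then have "\<gamma> (inv\<^bsub>W\<^esub> s) = inv\<^bsub>G0\<^esub> h"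
      unfolding s(2) \<gamma>_def using stabilizer_inv(1)[OF _ p] by blast
    then show ?case using generate.inv[OF s(1)] by blast
  next
    case (eng h1 h2)
    then obtain w1 w2 where w: "w1 \<in> generate W S" "\<gamma> w1 = h1" "w2 \<in> generate W S" "\<gamma> w2 = h2" by blast
    then have "\<gamma> (w1 \<otimes>\<^bsub>W\<^esub> w2) = h1 \<otimes>\<^bsub>G0\<^esub> h2"
      using stabilizer_mult[OF gW[OF w(1)] gW[OF w(3)] p] st[OF w(1)] st[OF w(3)] by (simp add: \<gamma>_def)
    then show ?case using generate.eng[OF w(1,3)] by blast
  qed
  have "purely_elliptic \<phi> X0 (generate G0 (\<gamma> ` S))"
    unfolding purely_elliptic_def
  proof
    fix g assume "g \<in> generate G0 (\<gamma> ` S)"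
    then obtain w where w: "w \<in> generate W S" "\<gamma> w = g" using 2 by blast
    then show "\<exists>x\<in>X0. \<phi> g x = x" using st[OF w(1)] fg[OF w(1)] by auto
  qed
  moreover have "finite (\<gamma> ` S)" "\<gamma> ` S \<subseteq> carrier G0" using S WP_fst[OF W_WP _ ] p by (auto simp: \<gamma>_def)
  ultimately have "fixes_point \<phi> X0 (generate G0 (\<gamma> ` S))" using decent unfolding decent_action_def by blast
  then obtain x where "x \<in> X0" "\<And>g. g \<in> generate G0 (\<gamma> ` S) \<Longrightarrow> \<phi> g x = x" unfolding fixes_point_def by blast
  then show "\<exists>x\<in>X0. \<forall>g\<in>generate W S. fibre g p x = x" using 1 fg by (intro bexI[of _ x]) auto
qed

sublocale BA: bundle_action W P X0 x0 base fibre by (rule bundle_action_W)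

lemma sections_eq: "BA.sections = Y" by (simp add: BA.sections_def)

abbreviation "oa \<equiv> oplus_action H P \<psi> X0 \<phi> x0"

lemma oa_act: assumes w: "w \<in> carrier W" and y: "y \<in> Y" shows "oa w y = BA.act w y"
proof -
  have "\<psi> (snd w) (\<psi> (inv\<^bsub>H\<^esub> snd w) p) = p" if "p \<in> P" for p using WP_snd[OF W_WP[OF w]] that by simp
  then show ?thesis using y
    by (auto simp: oplus_action_def wa_apply[OF Y_PiE] BA.act_def base_def fibre_def snd_inv[OF w] intro!: restrict_ext)
qed

lemma oa_fixed_iff: "w \<in> carrier W \<Longrightarrow> y \<in> Y \<Longrightarrow> oa w y = y \<longleftrightarrow> BA.fixes_section w y"
  using oa_act BA.act_fixed_iff sections_eq by simp

lemma group_action_W: "group_action W Y oa"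
proof -
  have closed: "oa w y \<in> Y" if "w \<in> carrier W" "y \<in> Y" for w y
    using BA.act_closed[of w y] that by (simp add: oa_act sections_eq)
  have mult: "oa (w \<otimes>\<^bsub>W\<^esub> w') y = oa w (oa w' y)" if "w \<in> carrier W" "w' \<in> carrier W" "y \<in> Y" for w w' y
    using BA.act_mult[of w w' y] that closed[OF that(2,3)] by (simp add: oa_act sections_eq)
  have one: "oa \<one>\<^bsub>W\<^esub> y = y" if "y \<in> Y" for y
    using oa_fixed_iff[OF W.one_closed that] BA.fixes_section_one[of y] that by (simp add: sections_eq)
  have Bij: "oa w \<in> Bij Y" if w: "w \<in> carrier W" for w
  proof -
    have "bij_betw (oa w) Y Y"
    proof (rule bij_betw_byWitness[where f' = "oa (inv\<^bsub>W\<^esub> w)"])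
      show "\<forall>a\<in>Y. oa (inv\<^bsub>W\<^esub> w) (oa w a) = a" using mult[of "inv\<^bsub>W\<^esub> w" w] one w by auto
      show "\<forall>a\<in>Y. oa w (oa (inv\<^bsub>W\<^esub> w) a) = a" using mult[of w "inv\<^bsub>W\<^esub> w"] one w by auto
    qed (use closed[OF w] closed[OF W.inv_closed[OF w]] in blast)+
    then show ?thesis by (simp add: Bij_def oplus_action_def)
  qed
  have "oa \<in> hom W (BijGroup Y)"
  proof (rule homI)
    fix w w' assume w: "w \<in> carrier W" "w' \<in> carrier W"
    then have "oa (w \<otimes>\<^bsub>W\<^esub> w') = compose Y (oa w) (oa w')"
      using Bij[of "w \<otimes>\<^bsub>W\<^esub> w'"] mult
      by (intro extensionalityI[of _ Y]) (auto simp: Bij_def compose_eq)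
    then show "oa (w \<otimes>\<^bsub>W\<^esub> w') = oa w \<otimes>\<^bsub>BijGroup Y\<^esub> oa w'" using Bij w by (simp add: BijGroup_def)
  qed (use Bij in \<open>simp add: BijGroup_def\<close>)
  then show ?thesis
    unfolding group_action_def using group_hom.intro[OF group_W group_BijGroup] by (simp add: group_hom_axioms_def)
qed

theorem decent_wreath_oplus:
  assumes tame: "tame_bundle_action W P X0 x0 base fibre H snd \<psi>"
  shows "decent_action W Y oa"
  unfolding decent_action_def
proof (intro conjI allI impI)
  show "group_action W Y oa" by (rule group_action_W)
next
  fix K assume K: "subgroup K W" and "\<exists>y\<in>Y. finite (orbit (W\<lparr>carrier := K\<rparr>) oa y)"
  then obtain y where y: "y \<in> Y" "finite (orbit (W\<lparr>carrier := K\<rparr>) oa y)" by blast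
  have KW: "w \<in> carrier W" if "w \<in> K" for w using subgroup.subset[OF K] that by blast
  have "orbit (W\<lparr>carrier := K\<rparr>) oa y = (\<lambda>w. oa w y) ` K"
  proof -
    have "carrier (W\<lparr>carrier := K\<rparr>) = K" by simp
    then show ?thesis unfolding orbit_def by blast
  qed
  also have "\<dots> = (\<lambda>w. BA.act w y) ` K" by (intro image_cong refl oa_act[OF KW y(1)])
  finally have "finite ((\<lambda>w. BA.act w y) ` K)" using y(2) by simp
  then obtain z where "z \<in> Y" "\<forall>w\<in>K. BA.fixes_section w z"
    using BA.finite_orbit_fixed_section[OF K] y(1) unfolding sections_eq by blast
  then show "fixes_point oa Y K" unfolding fixes_point_def using oa_fixed_iff KW by blast
next
  fix S assume S: "finite S" "S \<subseteq> carrier W" and "purely_elliptic oa Y (generate W S)"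
  moreover have gW: "w \<in> carrier W" if "w \<in> generate W S" for w using W.generate_in_carrier[OF S(2) that] .
  ultimately have "\<exists>z\<in>BA.sections. BA.fixes_section w z" if "w \<in> generate W S" for w
    unfolding sections_eq purely_elliptic_def using oa_fixed_iff that by blast
  then obtain z where "z \<in> Y" "\<forall>w\<in>generate W S. BA.fixes_section w z"
    using tame_bundle_action.elliptic_fixed_section[OF tame S] unfolding sections_eq by blast
  then show "fixes_point oa Y (generate W S)" unfolding fixes_point_def using oa_fixed_iff gW by blast
qed

end

section \<open>The action of \<open>PGL\<^sub>2\<close> on the projective line\<close>

definition scalars :: "('k::field^2^2) set" where "scalars = {mat c |c. c \<noteq> 0}"

definition pgl :: "'k::field^2^2 \<Rightarrow> ('k^2^2) set" where "pgl A = scalars #>\<^bsub>GL2\<^esub> A"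

definition line :: "'k::field^2 \<Rightarrow> ('k^2) set" where "line x = range (\<lambda>c. c *s x)"

lemma mat_mult_entries: "(mat c ** A)$i$j = c * A$i$j" for A :: "'k::field^2^2"
  using exhaust_2[of i] exhaust_2[of j] by (auto simp: mat2_mult mat2_mat)

lemma mat_mult_vec: "(mat c ** A) *v x = c *s (A *v x)" for A :: "'k::field^2^2"
  by (simp add: vec_eq_iff mat2_vec mat_mult_entries algebra_simps)

lemma det_mat2: "det (mat c :: 'k::field^2^2) = c * c"
  by (simp add: det_2 mat2_mat)

lemma normal_scalars: "scalars \<lhd> (GL2 :: ('k::field^2^2) monoid)"
proof -
  interpret group "GL2 :: ('k^2^2) monoid" by (rule group_GL2)
  have comm: "A ** mat c = mat c ** A" for A :: "'k^2^2" and c by (simp add: mat2_eq_iff mat2_mult mat2_mat)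
  have "subgroup scalars (GL2 :: ('k^2^2) monoid)"
  proof (rule subgroupI)
    fix a b :: "'k^2^2" assume a: "a \<in> scalars"
    then obtain c where c: "c \<noteq> 0" "a = mat c" unfolding scalars_def by blast
    have "minv a = mat (1 / c)" unfolding c(2) mat2_eq_iff minv_entries mat2_mat det_mat2 using c(1) by simp
    then show "inv\<^bsub>GL2\<^esub> a \<in> scalars" using c by (auto simp: inv_GL2 det_mat2 scalars_def)
    assume "b \<in> scalars"
    then obtain d where d: "d \<noteq> 0" "b = mat d" unfolding scalars_def by blast
    have "a ** b = mat (c * d)" unfolding c d by (simp add: mat2_eq_iff mat_mult_entries mat2_mat)
    then show "a \<otimes>\<^bsub>GL2\<^esub> b \<in> scalars" using c d by (auto simp: GL2_simps scalars_def)
  qed (auto simp: scalars_def carrier_GL2 det_mat2 intro: exI[of _ 1])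
  then show ?thesis
  proof (rule normal_invI)
    fix A h :: "'k^2^2" assume A: "A \<in> carrier GL2" and h: "h \<in> scalars"
    then obtain c where "h = mat c" unfolding scalars_def by blast
    moreover have dA: "det A \<noteq> 0" using A by (simp add: carrier_GL2)
    ultimately have "A \<otimes>\<^bsub>GL2\<^esub> h \<otimes>\<^bsub>GL2\<^esub> inv\<^bsub>GL2\<^esub> A = h ** (A ** minv A)"
      by (simp add: inv_GL2 GL2_simps comm[of A c] matrix_mul_assoc)
    then have "A \<otimes>\<^bsub>GL2\<^esub> h \<otimes>\<^bsub>GL2\<^esub> inv\<^bsub>GL2\<^esub> A = h" using dA by (simp add: minv_right)
    then show "A \<otimes>\<^bsub>GL2\<^esub> h \<otimes>\<^bsub>GL2\<^esub> inv\<^bsub>GL2\<^esub> A \<in> scalars" using h by simp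
  qed
qed

lemma PGL2_eq: "PGL2 = GL2 Mod scalars" by (simp add: PGL2_def scalars_def)

lemma group_PGL2: "group (PGL2 :: ('k::field^2^2) set monoid)"
  unfolding PGL2_eq by (rule normal.factorgroup_is_group[OF normal_scalars])

lemma pgl_hom: "pgl \<in> hom GL2 (PGL2 :: ('k::field^2^2) set monoid)"
  using normal.r_coset_hom_Mod[OF normal_scalars] unfolding PGL2_eq pgl_def .

lemma carrier_PGL2: "carrier (PGL2 :: ('k::field^2^2) set monoid) = pgl ` carrier GL2"
  by (auto simp: PGL2_eq FactGroup_def RCOSETS_def pgl_def)

lemma pgl_group_hom: "group_hom GL2 (PGL2 :: ('k::field^2^2) set monoid) pgl"
  using pgl_hom group_GL2 group_PGL2 by (simp add: group_hom_def group_hom_axioms_def)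

lemma pgl_def': "pgl A = {mat c ** A |c. c \<noteq> 0}"
  by (auto simp: pgl_def r_coset_def scalars_def GL2_simps)

lemma one_PGL2: "\<one>\<^bsub>PGL2\<^esub> = (scalars :: ('k::field^2^2) set)" by (simp add: PGL2_eq)

lemma pgl_scale: assumes c: "c \<noteq> 0" shows "pgl (mat c ** A) = pgl (A :: 'k::field^2^2)"
proof -
  have 1: "mat d ** (mat c ** A) = mat (d * c) ** A" for d by (simp add: mat2_eq_iff mat_mult_entries)
  have 2: "mat d ** A = mat (d / c) ** (mat c ** A)" for d
    using c by (simp add: mat2_eq_iff mat_mult_entries)
  show ?thesis
  proof
    show "pgl (mat c ** A) \<subseteq> pgl A"
    proof
      fix B assume "B \<in> pgl (mat c ** A)"
      then obtain d where "d \<noteq> 0" "B = mat (d * c) ** A" unfolding pgl_def' 1 by blast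
      moreover have "d * c \<noteq> 0" using c calculation(1) by simp
      ultimately show "B \<in> pgl A" unfolding pgl_def' by blast
    qed
    show "pgl A \<subseteq> pgl (mat c ** A)"
    proof
      fix B assume "B \<in> pgl A"
      then obtain d where "d \<noteq> 0" "B = mat (d / c) ** (mat c ** A)" using 2 unfolding pgl_def' by blast
      moreover have "d / c \<noteq> 0" using c calculation(1) by simp
      ultimately show "B \<in> pgl (mat c ** A)" unfolding pgl_def' by blast
    qed
  qed
qed

lemma pgl_one_iff: "pgl A = \<one>\<^bsub>PGL2\<^esub> \<longleftrightarrow> A \<in> scalars" for A :: "'k::field^2^2"
proof
  assume "pgl A = \<one>\<^bsub>PGL2\<^esub>"
  moreover have "A \<in> pgl A" unfolding pgl_def' by (intro CollectI exI[of _ 1]) simp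
  ultimately show "A \<in> scalars" by (simp add: one_PGL2)
next
  assume "A \<in> scalars"
  then obtain c where "c \<noteq> 0" "A = mat c ** mat 1" by (auto simp: scalars_def)
  then have "pgl A = pgl (mat 1)" using pgl_scale by metis
  also have "\<dots> = \<one>\<^bsub>PGL2\<^esub>" using group_hom.hom_one[OF pgl_group_hom] by (simp add: GL2_simps)
  finally show "pgl A = \<one>\<^bsub>PGL2\<^esub>" .
qed

lemma pgl_pow: "det A \<noteq> 0 \<Longrightarrow> pgl A [^]\<^bsub>PGL2\<^esub> (n::nat) = pgl (mpow A n)" for A :: "'k::field^2^2"
  using group_hom.hom_nat_pow[OF pgl_group_hom, of A n] by (simp add: carrier_GL2 pow_GL2)

lemma pgl_mult: "det A \<noteq> 0 \<Longrightarrow> det B \<noteq> 0 \<Longrightarrow> pgl A \<otimes>\<^bsub>PGL2\<^esub> pgl B = pgl (A ** B)" for A B :: "'k::field^2^2"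
  using group_hom.hom_mult[OF pgl_group_hom, of A B] by (simp add: carrier_GL2 GL2_simps)

lemma pgl_inv: "det A \<noteq> 0 \<Longrightarrow> inv\<^bsub>PGL2\<^esub> pgl A = pgl (minv A)" for A :: "'k::field^2^2"
  using group_hom.hom_inv[OF pgl_group_hom, of A] by (simp add: carrier_GL2 inv_GL2)

section \<open>Points of the projective line and matrices acting on them\<close>

lemma line_span: "line x = vec.span {x}"
  by (simp add: line_def vec.span_singleton)

lemma projective_line_eq: "projective_line = line ` {x :: 'k::field^2. x \<noteq> 0}"
proof
  show "line ` {x :: 'k^2. x \<noteq> 0} \<subseteq> projective_line"
    by (auto simp: projective_line_def line_span vec.subspace_span vec.dim_span vec.dim_singleton)
  show "projective_line \<subseteq> line ` {x :: 'k^2. x \<noteq> 0}"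
  proof
    fix L :: "('k^2) set" assume "L \<in> projective_line"
    then have L: "vec.subspace L" "vec.dim L = 1" by (auto simp: projective_line_def)
    obtain B where B: "B \<subseteq> L" "vec.independent B" "L \<subseteq> vec.span B" "card B = vec.dim L"
      using vec.basis_exists[of L] by blast
    then obtain x where x: "B = {x}" using L(2) by (auto simp: card_1_singleton_iff)
    have "vec.span {x} \<subseteq> L" by (rule vec.span_minimal) (use B(1) x L(1) in auto)
    then have "L = line x" using B(3) x by (simp add: line_span subset_antisym)
    moreover have "x \<noteq> 0" using B(2) x by (simp add: vec.dependent_single)
    ultimately show "L \<in> line ` {x. x \<noteq> 0}" by blast
  qed
qed

lemma line_eq_iff:
  fixes x y :: "'k::field^2"
  assumes "x \<noteq> 0" "y \<noteq> 0" shows "line x = line y \<longleftrightarrow> wedge x y = 0"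
proof
  have "x \<in> line x" by (auto simp: line_def intro: range_eqI[of _ _ 1])
  moreover assume "line x = line y"
  ultimately show "wedge x y = 0" using wedge_zero_iff[OF assms(2)] by (auto simp: line_def)
next
  assume "wedge x y = 0"
  then obtain c where c: "x = c *s y" using wedge_zero_iff[OF assms(2)] by blast
  then have c0: "c \<noteq> 0" using assms by auto
  have "d *s x = (d * c) *s y" "d *s y = (d / c) *s x" for d
    using c0 by (auto simp: c vec_eq_iff)
  then have "d *s x \<in> line y" "d *s y \<in> line x" for d unfolding line_def by (metis rangeI)+
  then show "line x = line y" unfolding line_def[of x] line_def[of y] using line_def[of x] line_def[of y] by blast
qed

lemma mat_vec_nonzero:
  fixes A :: "'k::field^2^2"
  assumes "det A \<noteq> 0" "x \<noteq> 0" shows "A *v x \<noteq> 0"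
proof
  assume "A *v x = 0"
  then have "minv A *v (A *v x) = 0" by (simp add: vec_eq_iff mat2_vec)
  then show False using assms by (simp add: matrix_vector_mul_assoc minv_left)
qed

lemma PGL2_action_line:
  fixes A :: "'k::field^2^2"
  assumes "x \<noteq> 0" shows "PGL2_action (pgl A) (line x) = line (A *v x)"
proof -
  have "(mat c ** A) *v (d *s x) = (c * d) *s (A *v x)" for c d
    unfolding mat_mult_vec by (simp add: vec_eq_iff mat2_vec algebra_simps)
  then have act: "(mat c ** A) *v (d *s x) = (c * d) *s (A *v x)" for c d .
  have "(\<Union>B\<in>pgl A. (\<lambda>v. B *v v) ` line x) = line (A *v x)"
  proof (intro subset_antisym subsetI)
    fix y assume "y \<in> (\<Union>B\<in>pgl A. (\<lambda>v. B *v v) ` line x)"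
    then obtain c d where "y = (mat c ** A) *v (d *s x)" unfolding pgl_def' line_def by blast
    then show "y \<in> line (A *v x)" unfolding act line_def by blast
  next
    fix y assume "y \<in> line (A *v x)"
    then obtain d where "y = (1 * d) *s (A *v x)" unfolding line_def by auto
    then have "y = (mat 1 ** A) *v (d *s x)" unfolding act .
    moreover have "mat 1 ** A \<in> pgl A" unfolding pgl_def' by (intro CollectI exI[of _ 1]) simp
    ultimately show "y \<in> (\<Union>B\<in>pgl A. (\<lambda>v. B *v v) ` line x)" unfolding line_def by blast
  qed
  then show ?thesis unfolding PGL2_action_def using assms projective_line_eq by auto
qed

lemma mpow_eq_scalar:
  assumes e: "eigen_pair A x y" and A: "det A \<noteq> 0" and u: "homog_sum x y n = 0"
  shows "mpow A n \<in> scalars"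
proof -
  have "mpow A n = mat (y ^ n)" by (simp add: mat2_eq_iff mat2_mat mpow_entries[OF e] u)
  moreover have "y ^ n \<noteq> 0" using e A by (auto simp: eigen_pair_def)
  ultimately show ?thesis unfolding scalars_def by blast
qed

lemma PGL2_torsion_finite:
  fixes S :: "('k::alg_closed_field^2^2) set set"
  assumes S: "finite S" "S \<subseteq> carrier PGL2"
    and t: "\<And>h. h \<in> generate PGL2 S \<Longrightarrow> \<exists>n>0. h [^]\<^bsub>PGL2\<^esub> (n::nat) = \<one>\<^bsub>PGL2\<^esub>"
  shows "finite (generate PGL2 S)"
proof -
  obtain S0 where S0: "S0 \<subseteq> carrier GL2" "finite S0" "S = pgl ` S0"
    using finite_subset_image[OF S(1)] S(2) unfolding carrier_PGL2 by metis
  have gen: "generate PGL2 S = pgl ` generate GL2 S0"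
    unfolding S0(3) by (rule group_hom.generate_img[OF pgl_group_hom S0(1)])
  have D: "det A \<noteq> 0" if "A \<in> generate GL2 S0" for A
    using group.generate_in_carrier[OF group_GL2 S0(1) that] by (simp add: carrier_GL2)
  have "\<exists>n>0. \<exists>c. mpow A n = mat c" if A: "A \<in> generate GL2 S0" for A
  proof -
    obtain n :: nat where n: "n > 0" "pgl A [^]\<^bsub>PGL2\<^esub> n = \<one>\<^bsub>PGL2\<^esub>" using t[of "pgl A"] A unfolding gen by blast
    then have "mpow A n \<in> scalars" unfolding pgl_pow[OF D[OF A]] pgl_one_iff by simp
    then show ?thesis using n(1) unfolding scalars_def by blast
  qed
  then obtain F where F: "finite F" "\<forall>A\<in>generate GL2 S0. \<exists>B\<in>F. \<exists>c. c \<noteq> 0 \<and> A = mat c ** B"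
    using finitely_generated_torsion_finite[OF S0(2,1)] by blast
  have "generate PGL2 S \<subseteq> pgl ` F"
  proof
    fix h assume "h \<in> generate PGL2 S"
    then obtain A where A: "A \<in> generate GL2 S0" "h = pgl A" unfolding gen by blast
    then obtain B c where "B \<in> F" "c \<noteq> 0" "A = mat c ** B" using F(2) by blast
    then show "h \<in> pgl ` F" using A(2) pgl_scale[of c B] by simp
  qed
  then show ?thesis using F(1) finite_surj by blast
qed

text \<open>Fixed points are zeros of a nonzero quadratic, as the matrix is not scalar. The
  displacement under the n-th power is \<open>homog_sum a b n\<close> times that of the matrix, and
  this factor vanishes only if the power is scalar.\<close>

lemma PGL2_fixed_points:
  fixes h :: "('k::alg_closed_field^2^2) set"
  assumes h: "h \<in> carrier PGL2" and inf: "\<And>n::nat. n > 0 \<Longrightarrow> h [^]\<^bsub>PGL2\<^esub> n \<noteq> \<one>\<^bsub>PGL2\<^esub>"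
  shows "finite {p \<in> projective_line. PGL2_action h p = p} \<and>
    (\<forall>n::nat. n > 0 \<longrightarrow> (\<forall>p\<in>projective_line. PGL2_action (h [^]\<^bsub>PGL2\<^esub> n) p = p \<longrightarrow> PGL2_action h p = p))"
proof
  obtain A where A: "det A \<noteq> 0" "h = pgl A" using h by (auto simp: carrier_PGL2 carrier_GL2)
  have fix_iff: "PGL2_action (pgl B) (line x) = line x \<longleftrightarrow> wedge (B *v x) x = 0"
    if "det B \<noteq> 0" "x \<noteq> 0" for B :: "'k^2^2" and x
    using PGL2_action_line[OF that(2)] line_eq_iff[OF mat_vec_nonzero[OF that] that(2)] by simp
  have "A \<notin> scalars" using inf[of 1] unfolding A(2) pgl_pow[OF A(1)] pgl_one_iff by simp
  then have ns: "A$1$2 \<noteq> 0 \<or> A$2$1 \<noteq> 0 \<or> A$1$1 \<noteq> A$2$2"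
    using A(1) by (auto simp: scalars_def mat2_eq_iff mat2_mat det_2)
  \<comment> \<open>The value of \<open>wedge (A *v x) x\<close> at the vector with coordinates
    \<open>t\<close> and 1, as a polynomial in \<open>t\<close>.\<close>
  define p where "p = [:A$1$2, A$1$1 - A$2$2, - A$2$1:]"
  have p0: "p \<noteq> 0" using ns by (auto simp: p_def)
  define e where "e u v = (vec_lambda (\<lambda>i. if i = 1 then u else v) :: 'k^2)" for u v
  have e: "e u v$1 = u" "e u v$2 = v" for u v by (simp_all add: e_def)
  \<comment> \<open>The line through \<open>e 1 0\<close> is the point at infinity, which the affine
    coordinate \<open>t\<close> misses; it is added whether fixed or not.\<close>
  have "{L \<in> projective_line. PGL2_action h L = L} \<subseteq> insert (line (e 1 0)) ((\<lambda>t. line (e t 1)) ` {t. poly p t = 0})"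
  proof
    fix L assume "L \<in> {L \<in> projective_line. PGL2_action h L = L}"
    then obtain x where x: "x \<noteq> 0" "L = line x" "PGL2_action h (line x) = line x" by (auto simp: projective_line_eq)
    then have w: "wedge (A *v x) x = 0" using fix_iff[OF A(1) x(1)] A(2) by simp
    show "L \<in> insert (line (e 1 0)) ((\<lambda>t. line (e t 1)) ` {t. poly p t = 0})"
    proof (cases "x$2 = 0")
      case True
      have "line x = line (e 1 0)"
        using True x(1) by (subst line_eq_iff) (auto simp: wedge_def e vec2_eq_iff)
      then show ?thesis using x(2) by blast
    next
      case False
      have 1: "line x = line (e (x$1 / x$2) 1)"
        using False x(1) by (subst line_eq_iff) (auto simp: wedge_def e vec2_eq_iff)
      have "(x$2)\<^sup>2 * poly p (x$1 / x$2) = wedge (A *v x) x"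
        using False by (simp add: p_def wedge_def mat2_vec power2_eq_square field_simps)
      then have "poly p (x$1 / x$2) = 0" using w False by simp
      then show ?thesis using 1 x(2) by blast
    qed
  qed
  then show "finite {L \<in> projective_line. PGL2_action h L = L}"
    by (rule finite_subset) (use poly_roots_finite[OF p0] in simp)
  show "\<forall>n::nat. n > 0 \<longrightarrow> (\<forall>p\<in>projective_line. PGL2_action (h [^]\<^bsub>PGL2\<^esub> n) p = p \<longrightarrow> PGL2_action h p = p)"
  proof (intro allI impI ballI)
    fix n :: nat and L assume n: "n > 0" and L: "L \<in> projective_line" "PGL2_action (h [^]\<^bsub>PGL2\<^esub> n) L = L"
    obtain x where x: "x \<noteq> 0" "L = line x" using L(1) by (auto simp: projective_line_eq)
    obtain a b where e: "eigen_pair A a b" using eigen_pair_exists by blast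
    have "det (mpow A n) \<noteq> 0" using A(1) by (simp add: det_mpow)
    then have "wedge (mpow A n *v x) x = 0"
      using L(2) fix_iff[OF _ x(1)] unfolding x(2) A(2) pgl_pow[OF A(1)] by blast
    moreover have "homog_sum a b n \<noteq> 0"
      using mpow_eq_scalar[OF e A(1)] inf[OF n] unfolding A(2) pgl_pow[OF A(1)] pgl_one_iff by blast
    ultimately have "wedge (A *v x) x = 0" unfolding wedge_mpow[OF e] by simp
    then show "PGL2_action h L = L" using fix_iff[OF A(1) x(1)] unfolding x(2) A(2) by blast
  qed
qed

text \<open>The image of \<open>N\<close> in the projective group is the required subgroup, and
  nonvanishing of \<open>wedge\<close> becomes inequality of lines, since invertible matrices keep
  the vectors nonzero.\<close>

lemma PGL2_separates_of_separating_word: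
  fixes A B :: "'k::field^2^2"
  assumes A: "det A \<noteq> 0" and B: "det B \<noteq> 0" and x: "x \<noteq> 0" and E: "\<And>e. e \<in> E \<Longrightarrow> e \<noteq> 0"
    and s: "separating_word A B x E n m k"
  shows "monoid.separates PGL2 PGL2_action (pgl A) (pgl B) (line x) (line ` E) n m k"
proof -
  interpret H: group "PGL2 :: ('k^2^2) set monoid" by (rule group_PGL2)
  define v where "v = minv (mpow B m) ** (minv (mpow A n) ** (mpow B m ** mpow A k))"
  from s obtain N where N': "v \<in> N" "mat 1 \<in> N" "\<forall>C\<in>N. det C \<noteq> 0 \<and> minv C \<in> N \<and> (\<forall>D\<in>N. C ** D \<in> N)"
    and path': "\<forall>C\<in>N. (\<forall>e\<in>E. wedge (C *v x) e \<noteq> 0) \<and>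
        (\<forall>e\<in>insert x E. wedge (mpow A k *v (C *v x)) e \<noteq> 0 \<and>
          wedge (mpow B m *v (mpow A k *v (C *v x))) e \<noteq> 0 \<and>
          wedge (minv (mpow A n) *v (mpow B m *v (mpow A k *v (C *v x)))) e \<noteq> 0)"
    and np': "\<forall>j>0. wedge (mpow v j *v x) x \<noteq> 0"
    unfolding separating_word_def v_def[symmetric] by (elim conjE exE)
  have N: "v \<in> N" "mat 1 \<in> N" "\<And>C. C \<in> N \<Longrightarrow> det C \<noteq> 0" "\<And>C. C \<in> N \<Longrightarrow> minv C \<in> N"
      "\<And>C D. C \<in> N \<Longrightarrow> D \<in> N \<Longrightarrow> C ** D \<in> N" using N' by simp_all
  note path = path'[rule_format, THEN conjunct1, rule_format] path'[rule_format, THEN conjunct2, rule_format]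
  note np = np'[rule_format]
  have d: "det (mpow A i) \<noteq> 0" "det (mpow B i) \<noteq> 0" "det (minv (mpow A i)) \<noteq> 0" "det (minv (mpow B i)) \<noteq> 0" for i
    using A B by (auto simp: det_mpow det_minv)
  have pw: "pgl A [^]\<^bsub>PGL2\<^esub> i = pgl (mpow A i)" "pgl B [^]\<^bsub>PGL2\<^esub> i = pgl (mpow B i)"
    "inv\<^bsub>PGL2\<^esub> pgl (mpow A i) = pgl (minv (mpow A i))" "inv\<^bsub>PGL2\<^esub> pgl (mpow B i) = pgl (minv (mpow B i))" for i :: nat
    using pgl_pow A B pgl_inv d by blast+
  have dv: "det v \<noteq> 0" using N by blast
  have v: "inv\<^bsub>PGL2\<^esub> (pgl B [^]\<^bsub>PGL2\<^esub> m) \<otimes>\<^bsub>PGL2\<^esub> (inv\<^bsub>PGL2\<^esub> (pgl A [^]\<^bsub>PGL2\<^esub> n) \<otimes>\<^bsub>PGL2\<^esub>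
      (pgl B [^]\<^bsub>PGL2\<^esub> m \<otimes>\<^bsub>PGL2\<^esub> pgl A [^]\<^bsub>PGL2\<^esub> k)) = pgl v"
    unfolding pw v_def using d by (simp add: pgl_mult det_mul)
  have lineE: "line y \<notin> line ` E'" if "y \<noteq> 0" "\<And>e. e \<in> E' \<Longrightarrow> e \<noteq> 0 \<and> wedge y e \<noteq> 0" for y and E' :: "('k^2) set"
    using line_eq_iff[OF that(1)] that(2) by blast
  have sub: "subgroup (pgl ` N) PGL2"
  proof (rule H.subgroupI)
    show "pgl ` N \<subseteq> carrier PGL2" using N(3) by (auto simp: carrier_PGL2 carrier_GL2)
    show "pgl ` N \<noteq> {}" using N(2) by blast
    fix a b assume "a \<in> pgl ` N"
    then obtain C where C: "C \<in> N" "a = pgl C" by blast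
    then show "inv\<^bsub>PGL2\<^esub> a \<in> pgl ` N" using pgl_inv[OF N(3)] N(4) by blast
    assume "b \<in> pgl ` N"
    then obtain D where "D \<in> N" "b = pgl D" by blast
    then show "a \<otimes>\<^bsub>PGL2\<^esub> b \<in> pgl ` N" using C pgl_mult[OF N(3) N(3)] N(5) by blast
  qed
  show ?thesis
    unfolding H.separates_def v
  proof (intro conjI exI[of _ "pgl ` N"] ballI allI impI sub)
    show "pgl v \<in> pgl ` N" using N(1) by blast
  next
    fix c assume "c \<in> pgl ` N"
    then obtain C where C: "C \<in> N" "c = pgl C" by blast
    have nz: "C *v x \<noteq> 0" "mpow A k *v (C *v x) \<noteq> 0" "mpow B m *v (mpow A k *v (C *v x)) \<noteq> 0"
      "minv (mpow A n) *v (mpow B m *v (mpow A k *v (C *v x))) \<noteq> 0"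
      using mat_vec_nonzero[OF N(3)[OF C(1)] x] mat_vec_nonzero[OF d(1)] mat_vec_nonzero[OF d(2)] mat_vec_nonzero[OF d(3)] by blast+
    have i: "insert (line x) (line ` E) = line ` insert x E" by simp
    have ne: "e \<noteq> 0" if "e \<in> insert x E" for e using that x E by blast
    have 1: "PGL2_action c (line x) = line (C *v x)" unfolding C(2) by (rule PGL2_action_line[OF x])
    show "PGL2_action c (line x) \<notin> line ` E"
      unfolding 1 using lineE[OF nz(1), of E] path(1)[OF C(1)] E by blast
    show "PGL2_action (pgl A [^]\<^bsub>PGL2\<^esub> k) (PGL2_action c (line x)) \<notin> insert (line x) (line ` E)"
      unfolding 1 i pw PGL2_action_line[OF nz(1)] using lineE[OF nz(2), of "insert x E"] path(2)[OF C(1)] ne by blast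
    show "PGL2_action (pgl B [^]\<^bsub>PGL2\<^esub> m) (PGL2_action (pgl A [^]\<^bsub>PGL2\<^esub> k) (PGL2_action c (line x)))
        \<notin> insert (line x) (line ` E)"
      unfolding 1 i pw PGL2_action_line[OF nz(1)] PGL2_action_line[OF nz(2)]
      using lineE[OF nz(3), of "insert x E"] path(2)[OF C(1)] ne by blast
    show "PGL2_action (inv\<^bsub>PGL2\<^esub> (pgl A [^]\<^bsub>PGL2\<^esub> n)) (PGL2_action (pgl B [^]\<^bsub>PGL2\<^esub> m)
        (PGL2_action (pgl A [^]\<^bsub>PGL2\<^esub> k) (PGL2_action c (line x)))) \<notin> insert (line x) (line ` E)"
      unfolding 1 i pw PGL2_action_line[OF nz(1)] PGL2_action_line[OF nz(2)] PGL2_action_line[OF nz(3)]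
      using lineE[OF nz(4), of "insert x E"] path(2)[OF C(1)] ne by blast
  next
    fix j :: nat assume j: "j > 0"
    have "mpow v j *v x \<noteq> 0" using mat_vec_nonzero[OF _ x] dv by (simp add: det_mpow)
    then show "PGL2_action (pgl v [^]\<^bsub>PGL2\<^esub> j) (line x) \<noteq> line x"
      unfolding pgl_pow[OF dv] PGL2_action_line[OF x] using line_eq_iff[OF _ x] np[OF j] by blast
  qed
qed

lemma PGL2_separates:
  fixes a b :: "('k::alg_closed_field^2^2) set"
  assumes a: "a \<in> carrier PGL2" and b: "b \<in> carrier PGL2" and p: "p \<in> projective_line"
    and ia: "\<And>n::nat. n > 0 \<Longrightarrow> PGL2_action (a [^]\<^bsub>PGL2\<^esub> n) p \<noteq> p"
    and ib: "\<And>n::nat. n > 0 \<Longrightarrow> PGL2_action (b [^]\<^bsub>PGL2\<^esub> n) p \<noteq> p"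
    and E: "finite E" "E \<subseteq> projective_line" "p \<notin> E"
  shows "\<exists>n m k. monoid.separates PGL2 PGL2_action a b p E n m k \<or> monoid.separates PGL2 PGL2_action b a p E n m k"
proof -
  obtain A B where A: "det A \<noteq> 0" "a = pgl A" and B: "det B \<noteq> 0" "b = pgl B"
    using a b by (auto simp: carrier_PGL2 carrier_GL2)
  obtain x where x: "x \<noteq> 0" "p = line x" using p by (auto simp: projective_line_eq)
  obtain F where F: "F \<subseteq> {x. x \<noteq> 0}" "finite F" "E = line ` F"
    using finite_subset_image[OF E(1)] E(2) unfolding projective_line_eq by metis
  have "wedge (mpow C n *v x) x \<noteq> 0"
    if "\<And>n::nat. n > 0 \<Longrightarrow> PGL2_action (pgl C [^]\<^bsub>PGL2\<^esub> n) p \<noteq> p" "det C \<noteq> 0" "n > 0" for C :: "'k^2^2" and n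
  proof -
    have "det (mpow C n) \<noteq> 0" using that(2) by (simp add: det_mpow)
    then show ?thesis
      using that(1)[OF that(3)] line_eq_iff[OF mat_vec_nonzero[OF _ x(1)] x(1)]
      unfolding x(2) pgl_pow[OF that(2)] PGL2_action_line[OF x(1)] by blast
  qed
  moreover have "wedge x e \<noteq> 0" if "e \<in> F" for e
    using that E(3) F x line_eq_iff[OF x(1), of e] by auto
  ultimately obtain n m k where "separating_word A B x F n m k \<or> separating_word B A x F n m k"
    using separating_word_exists[OF A(1) B(1) x(1) _ _ F(2)] ia ib A B by metis
  then show ?thesis
    using PGL2_separates_of_separating_word[OF A(1) B(1) x(1), of F n m k]
      PGL2_separates_of_separating_word[OF B(1) A(1) x(1), of F n m k] F(1) unfolding A(2) B(2) x(2) F(3) by blast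
qed

section \<open>Axioms of the action and conclusion\<close>

lemma PGL2_line_cases:
  assumes "a \<in> carrier PGL2" "p \<in> (projective_line :: ('k::field^2) set set)"
  obtains A x where "det A \<noteq> 0" "a = pgl A" "x \<noteq> 0" "p = line x" "A *v x \<noteq> 0" "PGL2_action a p = line (A *v x)"
proof -
  obtain A where A: "det A \<noteq> 0" "a = pgl A" using assms(1) by (auto simp: carrier_PGL2 carrier_GL2)
  obtain x where x: "x \<noteq> 0" "p = line x" using assms(2) by (auto simp: projective_line_eq)
  show thesis using that[OF A x mat_vec_nonzero[OF A(1) x(1)]] PGL2_action_line[OF x(1), of A] A(2) x(2) by simp
qed

lemma PGL2_action_closed: "a \<in> carrier PGL2 \<Longrightarrow> p \<in> projective_line \<Longrightarrow> PGL2_action a p \<in> projective_line"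
  by (elim PGL2_line_cases) (auto simp only: projective_line_eq)

lemma PGL2_action_one:
  assumes "p \<in> projective_line" shows "PGL2_action \<one>\<^bsub>PGL2\<^esub> p = p"
proof -
  have 1: "\<one>\<^bsub>PGL2\<^esub> = pgl (mat 1)" by (rule group_hom.hom_one[OF pgl_group_hom, unfolded GL2_simps, symmetric])
  obtain x where "x \<noteq> 0" "p = line x" using assms by (auto simp: projective_line_eq)
  then show ?thesis unfolding 1 by (simp add: PGL2_action_line)
qed

lemma PGL2_action_mult:
  assumes "a \<in> carrier PGL2" "b \<in> carrier PGL2" "p \<in> projective_line"
  shows "PGL2_action (a \<otimes>\<^bsub>PGL2\<^esub> b) p = PGL2_action a (PGL2_action b p)"
proof -
  obtain B x where B: "det B \<noteq> 0" "b = pgl B" "x \<noteq> 0" "p = line x" "B *v x \<noteq> 0" "PGL2_action b p = line (B *v x)"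
    using PGL2_line_cases[OF assms(2,3)] .
  obtain A where A: "det A \<noteq> 0" "a = pgl A" using assms(1) by (auto simp: carrier_PGL2 carrier_GL2)
  show ?thesis unfolding B(6) unfolding A(2) B(2,4) pgl_mult[OF A(1) B(1)] PGL2_action_line[OF B(3)] PGL2_action_line[OF B(5)]
    by (simp add: matrix_vector_mul_assoc)
qed

theorem theorem1p10:
  fixes G\<^sub>0 :: "('g, 'r) monoid_scheme"
    and X\<^sub>0 :: "'x set"
    and \<phi> :: "'g \<Rightarrow> 'x \<Rightarrow> 'x"
    and x\<^sub>0 :: 'x
    and P :: "('k::alg_closed_field ^ 2) set set"
    and H :: "('k ^ 2 ^ 2) set monoid"
  assumes "decent_action G\<^sub>0 X\<^sub>0 \<phi>"
    and "x\<^sub>0 \<in> X\<^sub>0"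
    and "P = projective_line"
    and "H = PGL2"
  shows "decent_action
           (wreath_oplus G\<^sub>0 H P PGL2_action X\<^sub>0 \<phi> x\<^sub>0)
           (restricted_product P (\<lambda>_. X\<^sub>0) (\<lambda>_. x\<^sub>0))
           (oplus_action H P PGL2_action X\<^sub>0 \<phi> x\<^sub>0)"
proof -
  have "wreath_setup G\<^sub>0 X\<^sub>0 \<phi> PGL2 projective_line (PGL2_action :: ('k^2^2) set \<Rightarrow> _) x\<^sub>0"
  proof (intro wreath_setup.intro wreath_setup_axioms.intro)
    show "group_action G\<^sub>0 X\<^sub>0 \<phi>" using assms(1) unfolding decent_action_def by (rule conjunct1)
  qed (fact assms(1,2) group_PGL2 PGL2_action_closed PGL2_action_one PGL2_action_mult)+
  then interpret wreath_setup G\<^sub>0 X\<^sub>0 \<phi> PGL2 projective_line "PGL2_action :: ('k^2^2) set \<Rightarrow> _" x\<^sub>0 .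
  have "tame_bundle_action W projective_line X\<^sub>0 x\<^sub>0 base fibre PGL2 snd (PGL2_action :: ('k^2^2) set \<Rightarrow> _)"
  proof (intro tame_bundle_action.intro tame_bundle_action_axioms.intro)
    show "bundle_action W projective_line X\<^sub>0 x\<^sub>0 base fibre" by (rule bundle_action_W)
    show "group (PGL2 :: ('k^2^2) set monoid)" by (rule group_PGL2)
    show "snd \<in> hom W PGL2" by (rule snd_hom)
    show "base g p = PGL2_action (snd g) p" for g p by (rule base_def)
  qed (fact PGL2_torsion_finite PGL2_fixed_points PGL2_separates)+
  then show ?thesis unfolding assms(3,4) by (rule decent_wreath_oplus)
qed

end
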